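(* There exists $K_0$ such that for every integer $K\ge K_0$, every $d>2^{K-2}\ln 2$ and every even integer $r>0$, $$\lim_{n\to\infty}\mathbb{P}\big(\text{the BP-guided decimation algorithm with } r \text{ iterations solves } \mathbf{\Phi}(n,dn)\big)=0,$$ where "solves" means that the output assignment satisfies the formula.
   Context: NAE-$K$-SAT. A (non-reduced) instance $\Phi$ consists of Boolean variables $x_1,\dots,x_n$ and a finite list of clauses, each consisting of $K$ literals (a literal is a variable $x$ or its negation $\bar x$). An assignment satisfies $\Phi$ if every clause has at least one literal with value $1$ and at least one literal with value $0$. Random formula. $\mathbf{\Phi}(n,dn)$ has variables $x_1,\dots,x_n$ and $\lfloor dn\rfloor$ independent clauses; the $K$ variables of each clause are chosen uniformly at random without replacement from $x_1,\dots,x_n$, and each is negated with probability $1/2$, independently over all variables in the clause and over all clauses. $K$ and $d$ do not depend on $n$. Reduced instances. A reduced clause $C$ is a set of at most $K$ literals together with a sign $\mathrm{sign}(C)\in\{+,-,0\}$, where $C$ has exactly $K$ literals if and only if $\mathrm{sign}(C)=0$. An assignment satisfies $C$ if: $\mathrm{sign}(C)=+$ and some literal of $C$ has value $0$; or $\mathrm{sign}(C)=-$ and some literal of $C$ has value $1$; or $\mathrm{sign}(C)=0$ and $C$ has both a literal of value $0$ and a literal of value $1$. A reduced instance consists of reduced clauses and is satisfied when all its clauses are. Fixing a variable. When a variable is given a value, it is deleted from the instance. A sign-$0$ clause containing it loses the corresponding literal and gets sign $+$ if that literal has value $1$ and sign $-$ if it has value $0$. A clause with sign $+$ (resp. $-$)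 in which the literal takes value $0$ (resp. $1$) is satisfied and removed; otherwise it loses that literal and keeps its sign. A clause left with no literals and not satisfied is violated and is removed. Neighborhoods. The factor graph $\mathbb{F}(\Phi)$ is the bipartite graph on variables and clauses, a clause being adjacent to the variables appearing in it. For even $r$, $B_\Phi(x,r)$ is the depth-$r$ neighborhood of $x$ in $\mathbb{F}(\Phi)$, also viewed as the (reduced) instance formed by the clauses in it. BP-guided decimation with $r$ iterations. Set $\Phi_0=\Phi$. For $i=1,\dots,n$: among all assignments of the variables of $B_{\Phi_{i-1}}(x_i,r)$ that satisfy all clauses of the instance $B_{\Phi_{i-1}}(x_i,r)$, let $p_i$ be the fraction which assign value $1$ to $x_i$ (equivalently $p_i=\mu(x_i)/(\mu(x_i)+1)$, where $\mu(x_i)$ is the ratio of the number of such assignments with $x_i=1$ to the number with $x_i=0$); if there are no such assignments, put $p_i=1/2$. Set $\sigma(x_i)=1$ with probability $p_i$ and $\sigma(x_i)=0$ with probability $1-p_i$, using fresh independent randomness, and let $\Phi_i$ be obtained from $\Phi_{i-1}$ by fixing $x_i$ to $\sigma(x_i)$. The output is $(\sigma(x_1),\dots,\sigma(x_n))$. (The algorithm continues even if a clause gets violated.) *)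

theory Defs
  imports "HOL-Probability.Probability"
begin

datatype literal = Pos nat | Neg nat

primrec lit_var :: "literal \<Rightarrow> nat" where
  "lit_var (Pos x) = x"
| "lit_var (Neg x) = x"

primrec lit_val :: "(nat \<Rightarrow> bool) \<Rightarrow> literal \<Rightarrow> bool" where
  "lit_val \<sigma> (Pos x) = \<sigma> x"
| "lit_val \<sigma> (Neg x) = (\<not> \<sigma> x)"

datatype sign = Plus | Minus | Zero

text \<open>The unreduced clauses (exactly \<open>K\<close> literals) are those of sign \<open>Zero\<close>.\<close>

type_synonym clause = "literal set \<times> sign"

definition reduced_clause :: "nat \<Rightarrow> clause \<Rightarrow> bool" where
  "reduced_clause K C \<longleftrightarrow>
     finite (fst C) \<and> card (fst C) \<le> K \<and> (card (fst C) = K \<longleftrightarrow> snd C = Zero)"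

fun sat_clause :: "(nat \<Rightarrow> bool) \<Rightarrow> clause \<Rightarrow> bool" where
  "sat_clause \<sigma> (L, Plus)  \<longleftrightarrow> (\<exists>l\<in>L. \<not> lit_val \<sigma> l)"
| "sat_clause \<sigma> (L, Minus) \<longleftrightarrow> (\<exists>l\<in>L. lit_val \<sigma> l)"
| "sat_clause \<sigma> (L, Zero)  \<longleftrightarrow> (\<exists>l\<in>L. lit_val \<sigma> l) \<and> (\<exists>l\<in>L. \<not> lit_val \<sigma> l)"

text \<open>The clauses form a list, so a clause may occur more than once.\<close>

datatype inst = Inst (vars: "nat set") (clauses: "clause list")

text \<open>An assignment of the variables of an instance is \<open>undefined\<close> outside of \<open>vars \<Phi>\<close>, so
  that the number of satisfying assignments is the cardinality of this set.\<close>

definition solutions :: "inst \<Rightarrow> (nat \<Rightarrow> bool) set" where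
  "solutions \<Phi> = {\<sigma> \<in> vars \<Phi> \<rightarrow>\<^sub>E UNIV. \<forall>C\<in>set (clauses \<Phi>). sat_clause \<sigma> C}"

text \<open>\<open>None\<close> means that the clause is removed, being either satisfied or violated. The clauses
  that arise from the random formula never contain both \<open>Pos x\<close> and \<open>Neg x\<close>, so \<open>v\<close> is the value
  of the one literal of \<open>x\<close>.\<close>

definition fix_clause :: "nat \<Rightarrow> bool \<Rightarrow> clause \<Rightarrow> clause option" where
  "fix_clause x b C = (case C of (L, s) \<Rightarrow>
     if x \<notin> lit_var ` L then Some (L, s)
     else
       let v = (if Pos x \<in> L then b else \<not> b);
           L' = L - {Pos x, Neg x};
           keep = (\<lambda>s'. if L' = {} then None else Some (L', s'))
       in (case s of
             Zero \<Rightarrow> keep (if v then Plus else Minus)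
           | Plus \<Rightarrow> if v then keep Plus else None
           | Minus \<Rightarrow> if v then None else keep Minus))"

lemma reduced_clause_fix_clause:
  assumes "reduced_clause K C" "fix_clause x b C = Some C'"
  shows "reduced_clause K C'"
proof (cases "x \<in> lit_var ` fst C")
  case True
  obtain L s where C: "C = (L, s)" by (cases C)
  from True C have "Pos x \<in> L \<or> Neg x \<in> L"
    by (auto simp: image_iff) (metis literal.exhaust lit_var.simps)
  then have "L - {Pos x, Neg x} \<subset> L" by blast
  moreover have "finite L" using assms(1) C by (simp add: reduced_clause_def)
  ultimately have "card (L - {Pos x, Neg x}) < card L" by (rule psubset_card_mono[rotated])
  then show ?thesis using assms True C
    by (auto simp: reduced_clause_def fix_clause_def Let_def split: sign.splits if_splits)
qed (use assms in \<open>auto simp: fix_clause_def split: prod.splits\<close>)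

definition fix_var :: "nat \<Rightarrow> bool \<Rightarrow> inst \<Rightarrow> inst" where
  "fix_var x b \<Phi> = Inst (vars \<Phi> - {x}) (List.map_filter (fix_clause x b) (clauses \<Phi>))"

text \<open>In the factor graph, \<open>ClauseNode j\<close> is the clause at position \<open>j\<close> of the list.\<close>

datatype node = VarNode nat | ClauseNode nat

definition factor_graph :: "inst \<Rightarrow> (node \<times> node) set" where
  "factor_graph \<Phi> = (\<Union>j<length (clauses \<Phi>). \<Union>y\<in>lit_var ` fst (clauses \<Phi> ! j).
     {(VarNode y, ClauseNode j), (ClauseNode j, VarNode y)})"

definition nodes_within :: "inst \<Rightarrow> nat \<Rightarrow> nat \<Rightarrow> node set" where
  "nodes_within \<Phi> x r = (\<Union>k\<le>r. factor_graph \<Phi> ^^ k) `` {VarNode x}"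

definition nbhd :: "inst \<Rightarrow> nat \<Rightarrow> nat \<Rightarrow> inst" where
  "nbhd \<Phi> x r = Inst {y. VarNode y \<in> nodes_within \<Phi> x r}
     (nths (clauses \<Phi>) {j. ClauseNode j \<in> nodes_within \<Phi> x r})"

definition bp_prob :: "nat \<Rightarrow> inst \<Rightarrow> nat \<Rightarrow> real" where
  "bp_prob r \<Phi> x = (let S = solutions (nbhd \<Phi> x r) in
     if S = {} then 1 / 2 else real (card {\<sigma> \<in> S. \<sigma> x}) / real (card S))"

text \<open>The list contains the variables that are still to be fixed, in order. The assignment
  produced is \<open>undefined\<close> elsewhere, as in \<open>solutions\<close>.\<close>

primrec decimate :: "nat \<Rightarrow> inst \<Rightarrow> nat list \<Rightarrow> (nat \<Rightarrow> bool) pmf" where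
  "decimate r \<Phi> [] = return_pmf (\<lambda>_. undefined)"
| "decimate r \<Phi> (x # xs) = do {
     b \<leftarrow> bernoulli_pmf (bp_prob r \<Phi> x);
     \<sigma> \<leftarrow> decimate r (fix_var x b \<Phi>) xs;
     return_pmf (\<sigma>(x := b))
   }"

definition bp_decimation :: "nat \<Rightarrow> nat \<Rightarrow> inst \<Rightarrow> (nat \<Rightarrow> bool) pmf" where
  "bp_decimation r n \<Phi> = decimate r \<Phi> [1..<Suc n]"

text \<open>Meaningful only for \<open>K \<le> n\<close>.\<close>

definition random_clause :: "nat \<Rightarrow> nat \<Rightarrow> clause pmf" where
  "random_clause K n = do {
     V \<leftarrow> pmf_of_set {V. V \<subseteq> {1..n} \<and> card V = K};
     negated \<leftarrow> Pi_pmf V False (\<lambda>_. bernoulli_pmf (1 / 2));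
     return_pmf ((\<lambda>x. if negated x then Neg x else Pos x) ` V, Zero)
   }"

definition random_formula :: "nat \<Rightarrow> nat \<Rightarrow> nat \<Rightarrow> inst pmf" where
  "random_formula K n m = map_pmf (Inst {1..n}) (replicate_pmf m (random_clause K n))"

definition success_prob :: "nat \<Rightarrow> real \<Rightarrow> nat \<Rightarrow> nat \<Rightarrow> real" where
  "success_prob K d r n = measure_pmf.prob
     (do {
        \<Phi> \<leftarrow> random_formula K n (nat \<lfloor>d * real n\<rfloor>);
        \<sigma> \<leftarrow> bp_decimation r n \<Phi>;
        return_pmf (\<Phi>, \<sigma>)
      })
     {(\<Phi>, \<sigma>). \<sigma> \<in> solutions \<Phi>}"

end

theory Submission
  imports Defs
begin

text \<open>
  Fix the formula. A value chosen by the algorithm can affect a later variable only along a chain of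
  variables of increasing index, consecutive ones being at distance at most \<open>r\<close>. In a random formula
  the balls of radius \<open>r\<close> have size \<open>o(ln n)\<close>, and since the order of the variables is random relative
  to the graph, a chain of length \<open>l\<close> is increasing only with probability \<open>1/(l+1)!\<close>. So a single
  choice influences few variables, and an Efron--Stein type bound makes the Hamming distance of two
  runs concentrate around its mean, where the two runs share their first \<open>t\<close> choices and continue
  independently. This mean moves in small steps from \<open>n/2\<close> (at \<open>t = 0\<close>, because a NAE formula is
  invariant under complementing all values) to \<open>0\<close>, so for some \<open>t\<close> it is close to \<open>3n/256\<close>.

  Given the shared choices, three continuations are independent and identically distributed, so by
  Jensen's inequality they all succeed with probability at least the cube of the success
  probability. But at clause density above \<open>2^(K-2) ln 2\<close> there is with high probability no triple of
  solutions at pairwise distances about \<open>3n/256\<close>: the three solutions violate a random clause almost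
  disjointly, which costs a factor \<open>exp(-(3/2) n ln 2)\<close> in the first moment, against fewer than
  \<open>exp((5/4) n ln 2)\<close> triples of assignments.
\<close>

section \<open>Sequential processes with local dependence\<close>

text \<open>Why three solutions: at clause density 2^(K-2) ln 2 the event that a given assignment is
  a solution costs about 2^(-n/2), so solutions abound. A cluster of k mutually close assignments,
  of which there are about 2^n up to a small exponential factor, costs about 2^(-kn/2). For a first
  moment bound two are not enough, three are. The common distance has to be a positive fraction of
  \<open>n\<close>, so that for large \<open>K\<close> two solutions rarely agree, or differ, on all
  variables of a clause; this alone decides how large \<open>K\<close> must be.

  The obstacle is the variance of the distance. It is bounded by the sum of the squared influences,
  so pairs of affected variables must be counted, and two chains that lead to a pair may share
  vertices. Encoding the pair by one increasing list keeps the gain of 1/(l+1)!. Balls are truncated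
  at size D = (ln n)/6: chains then contribute n exp(3D) = n^(3/2), small against n^2, while larger
  balls occur with probability O(1/n).\<close>

text \<open>An expectation written as a finite recursion: every estimate about runs becomes an
  induction over the remaining variables, free of integrability conditions.\<close>

primrec run_mean :: "(nat \<Rightarrow> (nat \<Rightarrow> bool) \<Rightarrow> real) \<Rightarrow> nat list \<Rightarrow> ((nat \<Rightarrow> bool) \<Rightarrow> real) \<Rightarrow> (nat \<Rightarrow> bool) \<Rightarrow> real" where
  "run_mean p [] h \<tau> = h \<tau>"
| "run_mean p (x # xs) h \<tau> = p x \<tau> * run_mean p xs h (\<tau>(x := True)) + (1 - p x \<tau>) * run_mean p xs h (\<tau>(x := False))"

lemma run_mean_append: "run_mean p (xs @ ys) h \<tau> = run_mean p xs (run_mean p ys h) \<tau>"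
  by (induction xs arbitrary: \<tau>) simp_all

lemma run_mean_const [simp]: "run_mean p xs (\<lambda>_. c) \<tau> = c"
  by (induction xs arbitrary: \<tau>) (simp_all add: algebra_simps)

lemma run_mean_add: "run_mean p xs (\<lambda>\<sigma>. g \<sigma> + h \<sigma>) \<tau> = run_mean p xs g \<tau> + run_mean p xs h \<tau>"
  by (induction xs arbitrary: \<tau>) (simp_all add: algebra_simps)

lemma run_mean_diff: "run_mean p xs (\<lambda>\<sigma>. g \<sigma> - h \<sigma>) \<tau> = run_mean p xs g \<tau> - run_mean p xs h \<tau>"
  using run_mean_add[of p xs "\<lambda>\<sigma>. g \<sigma> - h \<sigma>" h \<tau>] by simp

lemma run_mean_cmult: "run_mean p xs (\<lambda>\<sigma>. c * h \<sigma>) \<tau> = c * run_mean p xs h \<tau>"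
  by (induction xs arbitrary: \<tau>) (simp_all add: algebra_simps)

lemma run_mean_multc: "run_mean p xs (\<lambda>\<sigma>. h \<sigma> * c) \<tau> = run_mean p xs h \<tau> * c"
  by (induction xs arbitrary: \<tau>) (simp_all add: algebra_simps)

lemma run_mean_sum: "run_mean p xs (\<lambda>\<sigma>. \<Sum>i\<in>I. h i \<sigma>) \<tau> = (\<Sum>i\<in>I. run_mean p xs (h i) \<tau>)"
  by (induction I rule: infinite_finite_induct) (simp_all add: run_mean_add)

text \<open>Fubini for two independent runs.\<close>

lemma run_mean_swap:
  "run_mean p xs (\<lambda>\<sigma>. run_mean p ys (\<lambda>\<sigma>'. g \<sigma> \<sigma>') \<tau>') \<tau> = run_mean p ys (\<lambda>\<sigma>'. run_mean p xs (\<lambda>\<sigma>. g \<sigma> \<sigma>') \<tau>) \<tau>'"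
  by (induction xs arbitrary: \<tau>) (simp_all add: run_mean_add run_mean_cmult)

lemma convex_comb_diff_le:
  fixes q :: real
  assumes "0 \<le> q" "q \<le> 1" "\<bar>a - c\<bar> \<le> e" "\<bar>b - c\<bar> \<le> e"
  shows "\<bar>q * a + (1 - q) * b - c\<bar> \<le> e"
proof -
  have "\<bar>q * a + (1 - q) * b - c\<bar> = \<bar>q * (a - c) + (1 - q) * (b - c)\<bar>"
    by (simp add: algebra_simps)
  also have "\<dots> \<le> q * \<bar>a - c\<bar> + (1 - q) * \<bar>b - c\<bar>"
    using assms by (intro order_trans[OF abs_triangle_ineq]) (simp add: abs_mult)
  also have "\<dots> \<le> q * e + (1 - q) * e"
    using assms by (intro add_mono mult_left_mono) auto
  finally show ?thesis by (simp add: algebra_simps)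
qed

definition hamming :: "nat \<Rightarrow> (nat \<Rightarrow> bool) \<Rightarrow> (nat \<Rightarrow> bool) \<Rightarrow> real" where
  "hamming n \<sigma> \<sigma>' = card {i \<in> {1..n}. \<sigma> i \<noteq> \<sigma>' i}"

text \<open>States are total functions, and locality concerns the variables fixed before step
  \<open>x\<close> only, so the values at later positions are arbitrary and harmless.\<close>

locale local_process =
  fixes n :: nat and p :: "nat \<Rightarrow> (nat \<Rightarrow> bool) \<Rightarrow> real" and N :: "nat \<Rightarrow> nat set"
  assumes p_range: "0 \<le> p x \<tau>" "p x \<tau> \<le> 1"
    and p_local: "x \<in> {1..n} \<Longrightarrow> (\<And>i. i \<in> N x \<Longrightarrow> 1 \<le> i \<Longrightarrow> i < x \<Longrightarrow> \<tau> i = \<tau>' i) \<Longrightarrow> p x \<tau> = p x \<tau>'"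
begin

lemma run_mean_mono: "(\<And>\<sigma>. g \<sigma> \<le> h \<sigma>) \<Longrightarrow> run_mean p xs g \<tau> \<le> run_mean p xs h \<tau>"
  using p_range by (induction xs arbitrary: \<tau>) (auto intro!: add_mono mult_left_mono)

lemma run_mean_nonneg: "(\<And>\<sigma>. 0 \<le> h \<sigma>) \<Longrightarrow> 0 \<le> run_mean p xs h \<tau>"
  using run_mean_mono[of "\<lambda>_. 0" h xs \<tau>] by simp

lemma run_mean_abs_diff_le:
  assumes "\<And>\<sigma>. \<bar>g \<sigma> - h \<sigma>\<bar> \<le> c"
  shows "\<bar>run_mean p xs g \<tau> - run_mean p xs h \<tau>\<bar> \<le> c"
proof -
  have "run_mean p xs (\<lambda>\<sigma>. g \<sigma> - h \<sigma>) \<tau> \<le> run_mean p xs (\<lambda>_. c) \<tau>"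
    using assms by (intro run_mean_mono) (simp add: abs_le_iff)
  moreover have "run_mean p xs (\<lambda>_. - c) \<tau> \<le> run_mean p xs (\<lambda>\<sigma>. g \<sigma> - h \<sigma>) \<tau>"
    using assms by (intro run_mean_mono) (simp add: abs_le_iff, smt (verit) assms)
  ultimately show ?thesis by (simp only: run_mean_diff run_mean_const abs_le_iff) auto
qed

text \<open>Jensen's inequality through a supporting line: on the nonnegative reals the tangent of
  the cube at the mean \<open>a\<close> lies below the cube, and affine functions are averaged
  exactly.\<close>

lemma run_mean_cube_ge:
  assumes "\<And>\<sigma>. 0 \<le> h \<sigma>"
  shows "run_mean p xs h \<tau> ^ 3 \<le> run_mean p xs (\<lambda>\<sigma>. h \<sigma> ^ 3) \<tau>"
proof -
  define a where "a = run_mean p xs h \<tau>"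
  have a: "0 \<le> a" unfolding a_def by (rule run_mean_nonneg) fact
  have *: "3 * a\<^sup>2 * x - 2 * a ^ 3 \<le> x ^ 3" if "0 \<le> x" for x :: real
  proof -
    have "x ^ 3 - 3 * a\<^sup>2 * x + 2 * a ^ 3 = (x - a)\<^sup>2 * (x + 2 * a)"
      by (simp add: power2_eq_square power3_eq_cube algebra_simps)
    also have "\<dots> \<ge> 0" using a that by simp
    finally show ?thesis by simp
  qed
  have "run_mean p xs (\<lambda>\<sigma>. 3 * a\<^sup>2 * h \<sigma> - 2 * a ^ 3) \<tau> \<le> run_mean p xs (\<lambda>\<sigma>. h \<sigma> ^ 3) \<tau>"
    using * assms by (intro run_mean_mono) auto
  then show ?thesis
    by (simp add: run_mean_diff run_mean_cmult a_def[symmetric]) (simp add: power2_eq_square power3_eq_cube)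
qed

text \<open>The variables that a change of the values on \<open>A\<close> can affect when the steps \<open>j..n\<close> are
  still to come.\<close>

inductive_set reach :: "nat \<Rightarrow> nat set \<Rightarrow> nat set" for j A where
  base: "i \<in> A \<Longrightarrow> i \<in> reach j A"
| step: "i \<in> reach j A \<Longrightarrow> i < w \<Longrightarrow> j \<le> w \<Longrightarrow> w \<le> n \<Longrightarrow> i \<in> N w \<Longrightarrow> w \<in> reach j A"

lemma reach_finite: "finite A \<Longrightarrow> finite (reach j A)"
proof -
  assume "finite A"
  moreover have "x \<in> A \<union> {..n}" if "x \<in> reach j A" for x
    using that by induction auto
  ultimately show ?thesis by (meson finite_UnI finite_atMost finite_subset subsetI)
qed

lemma reach_Suc: "reach (Suc j) A \<subseteq> reach j A"
proof
  fix x assume "x \<in> reach (Suc j) A"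
  then show "x \<in> reach j A"
  proof induction
    case (step i w)
    then show ?case using reach.step[of i j A w] by auto
  qed (rule reach.base)
qed

text \<open>If step \<open>j\<close> sees a changed variable, its own value may change as well. As
  \<open>j\<close> is already counted in \<open>reach j A\<close>, adding it to the changed set
  costs nothing.\<close>

lemma reach_Suc_insert:
  assumes "i \<in> A" "i \<in> N j" "i < j" "j \<le> n"
  shows "reach (Suc j) (insert j A) \<subseteq> reach j A"
proof
  fix x assume "x \<in> reach (Suc j) (insert j A)"
  then show "x \<in> reach j A"
  proof induction
    case (base i')
    then show ?case using assms reach.step[OF reach.base, of i A j j] reach.base by auto
  next
    case (step i' w)
    then show ?case using reach.step[of i' j A w] by auto
  qed
qed

lemma reach_end: "reach (Suc n) A = A"
proof -
  have "x \<in> A" if "x \<in> reach (Suc n) A" for x using that by induction auto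
  then show ?thesis by (auto intro: reach.base)
qed

lemma reach_empty: "reach j {} = {}"
proof -
  have "x \<in> {}" if "x \<in> reach j {}" for x using that by induction auto
  then show ?thesis by auto
qed

section \<open>Lipschitz estimates that propagate backwards along a run\<close>

definition agree :: "nat \<Rightarrow> nat set \<Rightarrow> (nat \<Rightarrow> bool) \<Rightarrow> (nat \<Rightarrow> bool) \<Rightarrow> bool" where
  "agree j A \<tau> \<tau>' \<longleftrightarrow> (\<forall>i. 1 \<le> i \<longrightarrow> i < j \<longrightarrow> i \<notin> A \<longrightarrow> \<tau> i = \<tau>' i)"

text \<open>Weighing the change by the reachable set instead of by \<open>A\<close> makes the
  property stable, with the same constant, under averaging over the preceding step. For empty
  \<open>A\<close> it says that \<open>H\<close> depends only on the variables
  \<open>1..j-1\<close>.\<close>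

definition reach_lipschitz :: "nat \<Rightarrow> real \<Rightarrow> ((nat \<Rightarrow> bool) \<Rightarrow> real) \<Rightarrow> bool" where
  "reach_lipschitz j c H \<longleftrightarrow>
     (\<forall>\<tau> \<tau>' A. finite A \<longrightarrow> agree j A \<tau> \<tau>' \<longrightarrow> \<bar>H \<tau> - H \<tau>'\<bar> \<le> c * card (reach j A))"

definition influence :: "nat \<Rightarrow> real" where
  "influence j = card (reach (Suc j) {j})"

text \<open>If step \<open>j\<close> sees no changed variable, its probability is the same in both
  states and the two runs are coupled to choose the same value. Otherwise no coupling is attempted:
  whatever the two values are, \<open>j\<close> joins the changed set, and \<open>reach j A\<close>
  already pays for it.\<close>

lemma reach_lipschitz_step:
  assumes L: "reach_lipschitz (Suc j) c H" and j: "j \<in> {1..n}" and c: "0 \<le> c"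
  shows "reach_lipschitz j c (run_mean p [j] H)"
  unfolding reach_lipschitz_def
proof (intro allI impI)
  fix \<tau> \<tau>' A assume A: "finite A" "agree j A \<tau> \<tau>'"
  let ?r = "c * card (reach j A)"
  show "\<bar>run_mean p [j] H \<tau> - run_mean p [j] H \<tau>'\<bar> \<le> ?r"
  proof (cases "\<exists>i. i \<in> A \<and> i \<in> N j \<and> i < j")
    case True
    then obtain i where i: "i \<in> A" "i \<in> N j" "i < j" by blast
    have "\<bar>H (\<tau>(j := b)) - H (\<tau>'(j := b'))\<bar> \<le> ?r" for b b'
    proof -
      have "agree (Suc j) (insert j A) (\<tau>(j := b)) (\<tau>'(j := b'))"
        using A(2) by (auto simp: agree_def)
      then have "\<bar>H (\<tau>(j := b)) - H (\<tau>'(j := b'))\<bar> \<le> c * card (reach (Suc j) (insert j A))"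
        using L A(1) by (auto simp: reach_lipschitz_def)
      also have "\<dots> \<le> ?r" using i j c A(1)
        by (intro mult_left_mono of_nat_mono card_mono reach_finite reach_Suc_insert) auto
      finally show ?thesis .
    qed
    then have "\<bar>run_mean p [j] H \<tau> - H (\<tau>'(j := b'))\<bar> \<le> ?r" for b'
      using p_range[of j \<tau>] by (auto intro!: convex_comb_diff_le)
    then have "\<bar>run_mean p [j] H \<tau>' - run_mean p [j] H \<tau>\<bar> \<le> ?r"
      using p_range[of j \<tau>'] by (subst run_mean.simps) (auto intro!: convex_comb_diff_le simp: abs_minus_commute)
    then show ?thesis by (simp add: abs_minus_commute)
  next
    case False
    have p: "p j \<tau>' = p j \<tau>"
      using A(2) False j by (intro p_local) (auto simp: agree_def)
    have *: "\<bar>H (\<tau>(j := b)) - H (\<tau>'(j := b))\<bar> \<le> ?r" for b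
    proof -
      have "agree (Suc j) A (\<tau>(j := b)) (\<tau>'(j := b))"
        using A(2) by (auto simp: agree_def)
      then have "\<bar>H (\<tau>(j := b)) - H (\<tau>'(j := b))\<bar> \<le> c * card (reach (Suc j) A)"
        using L A(1) by (auto simp: reach_lipschitz_def)
      also have "\<dots> \<le> ?r" using c A(1)
        by (intro mult_left_mono of_nat_mono card_mono reach_finite reach_Suc) auto
      finally show ?thesis .
    qed
    have "\<bar>run_mean p [j] H \<tau> - run_mean p [j] H \<tau>'\<bar> = \<bar>p j \<tau> * (H (\<tau>(j := True)) - H (\<tau>'(j := True)))
        + (1 - p j \<tau>) * (H (\<tau>(j := False)) - H (\<tau>'(j := False))) - 0\<bar>"
      by (simp add: p algebra_simps)
    also have "\<dots> \<le> ?r"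
      using p_range[of j \<tau>] * by (intro convex_comb_diff_le) auto
    finally show ?thesis .
  qed
qed

lemma reach_lipschitz_run_mean:
  assumes "reach_lipschitz j' c H" "1 \<le> j" "j \<le> j'" "j' \<le> Suc n" "0 \<le> c"
  shows "reach_lipschitz j c (run_mean p [j..<j'] H)"
  using assms(3,2)
proof (induction j rule: inc_induct)
  case base
  then show ?case using assms(1) by (simp add: reach_lipschitz_def)
next
  case (step j)
  have "reach_lipschitz j c (run_mean p [j] (run_mean p [Suc j..<j'] H))"
    using step assms by (intro reach_lipschitz_step step.IH) auto
  moreover have "run_mean p [j] (run_mean p [Suc j..<j'] H) = run_mean p [j..<j'] H"
    using step by (simp add: upt_conv_Cons fun_eq_iff)
  ultimately show ?case by simp
qed

lemma reach_lipschitz_flip: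
  assumes "reach_lipschitz (Suc j) c H"
  shows "\<bar>H (\<tau>(j := b)) - H (\<tau>(j := b'))\<bar> \<le> c * influence j"
  using assms by (auto simp: reach_lipschitz_def agree_def influence_def)

section \<open>Variance along a run\<close>

definition run_var :: "nat list \<Rightarrow> ((nat \<Rightarrow> bool) \<Rightarrow> real) \<Rightarrow> (nat \<Rightarrow> bool) \<Rightarrow> real" where
  "run_var xs H \<tau> = run_mean p xs (\<lambda>\<sigma>. (H \<sigma>)\<^sup>2) \<tau> - (run_mean p xs H \<tau>)\<^sup>2"

lemma run_mean_square_dev: "run_mean p xs (\<lambda>\<sigma>. (H \<sigma> - a)\<^sup>2) \<tau> = run_var xs H \<tau> + (run_mean p xs H \<tau> - a)\<^sup>2"
proof -
  have "(\<lambda>\<sigma>. (H \<sigma> - a)\<^sup>2) = (\<lambda>\<sigma>. ((H \<sigma>)\<^sup>2 - (2 * a) * H \<sigma>) + a\<^sup>2)"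
    by (auto simp: power2_eq_square algebra_simps)
  then show ?thesis
    by (simp only: run_mean_add run_mean_diff run_mean_cmult run_mean_const run_var_def) (simp add: power2_eq_square algebra_simps)
qed

text \<open>Backward induction by the law of total variance: the variance before step
  \<open>j\<close> is the mean of the variances after it plus that of a two-point distribution,
  whose values differ by at most \<open>c * influence j\<close>.\<close>

lemma run_var_le:
  assumes "reach_lipschitz j' c H" "1 \<le> j" "j \<le> j'" "j' \<le> Suc n" "0 \<le> c"
  shows "run_var [j..<j'] H \<tau> \<le> c\<^sup>2 * (\<Sum>x\<in>{j..<j'}. (influence x)\<^sup>2)"
  using assms(3,2)
proof (induction j arbitrary: \<tau> rule: inc_induct)
  case base
  then show ?case by (simp add: run_var_def)
next
  case (step j)
  let ?xs = "[Suc j..<j']" and ?s = "\<Sum>x\<in>{Suc j..<j'}. (influence x)\<^sup>2"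
  let ?a = "run_mean p ?xs H (\<tau>(j := True))" and ?b = "run_mean p ?xs H (\<tau>(j := False))" and ?q = "p j \<tau>"
  have upt: "[j..<j'] = j # ?xs" using step by (simp add: upt_conv_Cons)
  have IH: "run_var ?xs H (\<tau>(j := b)) \<le> c\<^sup>2 * ?s" for b
    using step by (intro step.IH) auto
  have "reach_lipschitz (Suc j) c (run_mean p ?xs H)"
    using step assms by (intro reach_lipschitz_run_mean) auto
  from reach_lipschitz_flip[OF this] have "\<bar>?a - ?b\<bar> \<le> c * influence j" .
  then have ab: "(?a - ?b)\<^sup>2 \<le> (c * influence j)\<^sup>2"
    by (metis abs_ge_zero power2_abs power_mono)
  have q: "0 \<le> ?q" "?q \<le> 1" by (rule p_range)+
  have "run_var [j..<j'] H \<tau> = ?q * run_var ?xs H (\<tau>(j := True)) + (1 - ?q) * run_var ?xs H (\<tau>(j := False))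
     + ?q * (1 - ?q) * (?a - ?b)\<^sup>2"
    unfolding upt run_var_def by (simp add: power2_eq_square algebra_simps)
  also have "\<dots> \<le> ?q * (c\<^sup>2 * ?s) + (1 - ?q) * (c\<^sup>2 * ?s) + 1 * (c * influence j)\<^sup>2"
    using q IH ab by (intro add_mono mult_left_mono mult_mono mult_le_one) auto
  also have "\<dots> = c\<^sup>2 * ((influence j)\<^sup>2 + ?s)"
    by (simp add: algebra_simps)
  also have "(influence j)\<^sup>2 + ?s = (\<Sum>x\<in>{j..<j'}. (influence x)\<^sup>2)"
    using step by (simp add: sum.atLeast_Suc_lessThan)
  finally show ?case .
qed

abbreviation ham :: "(nat \<Rightarrow> bool) \<Rightarrow> (nat \<Rightarrow> bool) \<Rightarrow> real" where
  "ham \<equiv> hamming n"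

lemma ham_sym: "ham \<sigma> \<sigma>' = ham \<sigma>' \<sigma>"
  unfolding hamming_def by (rule arg_cong[where f = "\<lambda>A. real (card A)"]) auto

lemma ham_le:
  assumes "finite A" "agree (Suc n) A \<sigma>\<^sub>1 \<sigma>\<^sub>2"
  shows "ham \<sigma> \<sigma>\<^sub>1 \<le> ham \<sigma> \<sigma>\<^sub>2 + card A"
proof -
  have "card {i \<in> {1..n}. \<sigma> i \<noteq> \<sigma>\<^sub>1 i} \<le> card ({i \<in> {1..n}. \<sigma> i \<noteq> \<sigma>\<^sub>2 i} \<union> A)"
    using assms by (intro card_mono) (auto simp: agree_def)
  also have "\<dots> \<le> card {i \<in> {1..n}. \<sigma> i \<noteq> \<sigma>\<^sub>2 i} + card A" by (rule card_Un_le)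
  finally show ?thesis unfolding hamming_def by linarith
qed

lemma agree_sym: "agree j A \<tau> \<tau>' \<Longrightarrow> agree j A \<tau>' \<tau>"
  by (auto simp: agree_def)

lemma reach_lipschitz_ham: "reach_lipschitz (Suc n) 1 (ham \<sigma>)"
  unfolding reach_lipschitz_def reach_end
proof (intro allI impI)
  fix \<tau> \<tau>' A assume "finite A" "agree (Suc n) A \<tau> \<tau>'"
  then show "\<bar>ham \<sigma> \<tau> - ham \<sigma> \<tau>'\<bar> \<le> 1 * real (card A)"
    using ham_le[of A \<tau> \<tau>' \<sigma>] ham_le[of A \<tau>' \<tau> \<sigma>] by (auto dest: agree_sym)
qed

lemma reach_lipschitz_ham': "reach_lipschitz (Suc n) 1 (\<lambda>\<tau>. ham \<tau> \<sigma>)"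
  using reach_lipschitz_ham[of \<sigma>] by (simp add: ham_sym[of _ \<sigma>])

lemma reach_lipschitz_average:
  assumes "\<And>\<sigma>. reach_lipschitz j c (\<lambda>\<tau>. H \<tau> \<sigma>)"
  shows "reach_lipschitz j c (\<lambda>\<tau>. run_mean p xs (H \<tau>) \<tau>')"
  unfolding reach_lipschitz_def
proof (intro allI impI)
  fix \<tau> \<tau>'' A assume A: "finite A" "agree j A \<tau> \<tau>''"
  show "\<bar>run_mean p xs (H \<tau>) \<tau>' - run_mean p xs (H \<tau>'') \<tau>'\<bar> \<le> c * card (reach j A)"
    by (rule run_mean_abs_diff_le) (use assms A in \<open>simp add: reach_lipschitz_def\<close>)
qed

section \<open>Mean distance of two runs with a common past\<close>

text \<open>Only equal starting states matter in the end, but the estimates change one of the two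
  states at a time.\<close>

definition pair_mean :: "nat \<Rightarrow> (nat \<Rightarrow> bool) \<Rightarrow> (nat \<Rightarrow> bool) \<Rightarrow> real" where
  "pair_mean t \<tau> \<tau>' = run_mean p [t..<Suc n] (\<lambda>\<sigma>. run_mean p [t..<Suc n] (ham \<sigma>) \<tau>') \<tau>"

lemma reach_lipschitz_pair_mean:
  assumes "1 \<le> t" "t \<le> Suc n"
  shows "reach_lipschitz t 1 (\<lambda>\<tau>. pair_mean t \<tau> \<tau>')" "reach_lipschitz t 1 (\<lambda>\<tau>. pair_mean t \<tau>' \<tau>)"
proof -
  show "reach_lipschitz t 1 (\<lambda>\<tau>. pair_mean t \<tau> \<tau>')"
    unfolding pair_mean_def using assms
    by (intro reach_lipschitz_run_mean reach_lipschitz_average reach_lipschitz_ham') auto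
  have "reach_lipschitz t 1 (\<lambda>\<tau>. run_mean p [t..<Suc n] (\<lambda>\<sigma>. run_mean p [t..<Suc n] (ham \<sigma>) \<tau>) \<tau>')"
    by (rule reach_lipschitz_average) (use assms in \<open>auto intro!: reach_lipschitz_run_mean reach_lipschitz_ham simp del: upt_Suc\<close>)
  then show "reach_lipschitz t 1 (\<lambda>\<tau>. pair_mean t \<tau>' \<tau>)"
    by (simp add: pair_mean_def del: upt_Suc)
qed

text \<open>A change of the common past disturbs both runs, whence the constant 2.\<close>

lemma reach_lipschitz_diag:
  assumes "1 \<le> t" "t \<le> Suc n"
  shows "reach_lipschitz t 2 (\<lambda>\<tau>. pair_mean t \<tau> \<tau>)"
  unfolding reach_lipschitz_def
proof (intro allI impI)
  fix \<tau> \<tau>' A assume "finite A" "agree t A \<tau> \<tau>'"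
  then have "\<bar>pair_mean t \<tau> \<tau> - pair_mean t \<tau>' \<tau>\<bar> \<le> 1 * real (card (reach t A))"
    "\<bar>pair_mean t \<tau>' \<tau> - pair_mean t \<tau>' \<tau>'\<bar> \<le> 1 * real (card (reach t A))"
    using reach_lipschitz_pair_mean(1)[OF assms, of \<tau>] reach_lipschitz_pair_mean(2)[OF assms, of \<tau>']
    by (simp_all add: reach_lipschitz_def)
  then show "\<bar>pair_mean t \<tau> \<tau> - pair_mean t \<tau>' \<tau>'\<bar> \<le> 2 * real (card (reach t A))" by linarith
qed

lemma influence_nonneg: "0 \<le> influence j" by (simp add: influence_def)

text \<open>The steps before \<open>t\<close> are shared, so \<open>t = 1\<close> means independent
  runs and \<open>t = Suc n\<close> identical ones.\<close>

definition mean_ham :: "(nat \<Rightarrow> bool) \<Rightarrow> nat \<Rightarrow> real" where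
  "mean_ham \<tau> t = run_mean p [1..<t] (\<lambda>\<tau>. pair_mean t \<tau> \<tau>) \<tau>"

text \<open>Sharing the choice at \<open>t\<close> as well matters only when the two runs would
  choose differently, which has probability 2q(1-q); it then amounts to flipping one value in one of
  the two states.\<close>

lemma pair_mean_step:
  assumes "t \<in> {1..n}"
  shows "\<bar>pair_mean t \<tau> \<tau> - run_mean p [t] (\<lambda>\<tau>. pair_mean (Suc t) \<tau> \<tau>) \<tau>\<bar> \<le> influence t"
proof -
  let ?g = "\<lambda>a b. pair_mean (Suc t) (\<tau>(t := a)) (\<tau>(t := b))" and ?q = "p t \<tau>" and ?zs = "[Suc t..<Suc n]"
  have upt: "[t..<Suc n] = [t] @ ?zs" using assms by (simp add: upt_conv_Cons del: upt_Suc)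
  have "pair_mean t \<tau> \<tau> = run_mean p [t] (\<lambda>a. run_mean p [t] (\<lambda>b. pair_mean (Suc t) a b) \<tau>) \<tau>"
    unfolding pair_mean_def upt run_mean_append by (subst run_mean_swap[of p "[t]" ?zs]) (rule refl)
  then have eq: "pair_mean t \<tau> \<tau> - run_mean p [t] (\<lambda>\<tau>. pair_mean (Suc t) \<tau> \<tau>) \<tau>
    = ?q * (1 - ?q) * (?g True False - ?g True True) + (1 - ?q) * ?q * (?g False True - ?g False False)"
    by (simp add: algebra_simps)
  have "\<bar>pair_mean t \<tau> \<tau> - run_mean p [t] (\<lambda>\<tau>. pair_mean (Suc t) \<tau> \<tau>) \<tau>\<bar>
    \<le> ?q * (1 - ?q) * influence t + (1 - ?q) * ?q * influence t"
    unfolding eq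
  proof (rule order_trans[OF abs_triangle_ineq add_mono])
    have q: "0 \<le> ?q" "?q \<le> 1" by (rule p_range)+
    have "\<bar>?g a b - ?g a b'\<bar> \<le> influence t" for a b b'
      using reach_lipschitz_flip[OF reach_lipschitz_pair_mean(2)[of "Suc t"]] assms by fastforce
    then show "\<bar>?q * (1 - ?q) * (?g True False - ?g True True)\<bar> \<le> ?q * (1 - ?q) * influence t"
      "\<bar>(1 - ?q) * ?q * (?g False True - ?g False False)\<bar> \<le> (1 - ?q) * ?q * influence t"
      using q by (auto simp: abs_mult intro!: mult_left_mono)
  qed
  also have "\<dots> = 2 * (?q * (1 - ?q)) * influence t" by simp
  also have "\<dots> \<le> 1 * influence t"
  proof (rule mult_right_mono[OF _ influence_nonneg])
    show "2 * (?q * (1 - ?q)) \<le> 1"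
      using sum_squares_ge_zero[of "?q - 1/2" "?q - 1/2"] by (simp add: algebra_simps)
  qed
  finally show ?thesis by simp
qed

lemma mean_ham_step:
  assumes "t \<in> {1..n}"
  shows "\<bar>mean_ham \<tau> t - mean_ham \<tau> (Suc t)\<bar> \<le> influence t"
proof -
  have "[1..<Suc t] = [1..<t] @ [t]" using assms by simp
  then have "mean_ham \<tau> (Suc t) = run_mean p [1..<t] (run_mean p [t] (\<lambda>\<tau>. pair_mean (Suc t) \<tau> \<tau>)) \<tau>"
    unfolding mean_ham_def by (simp only: run_mean_append)
  then show ?thesis
    unfolding mean_ham_def using pair_mean_step[OF assms] by (simp only: run_mean_abs_diff_le)
qed

lemma mean_ham_end: "mean_ham \<tau> (Suc n) = 0"
  by (simp add: mean_ham_def pair_mean_def hamming_def del: upt_Suc)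

text \<open>Total variance over three sources of randomness: the second continuation, the first one
  and the shared past. The continuations contribute one sum each; the past gets the factor 4, the
  square of the constant in \<open>reach_lipschitz_diag\<close>.\<close>

lemma ham_second_moment:
  assumes t: "1 \<le> t" "t \<le> Suc n"
  shows "run_mean p [1..<t] (\<lambda>\<tau>. run_mean p [t..<Suc n] (\<lambda>\<sigma>. run_mean p [t..<Suc n]
           (\<lambda>\<sigma>'. (ham \<sigma> \<sigma>' - mean_ham \<tau>\<^sub>0 t)\<^sup>2) \<tau>) \<tau>) \<tau>\<^sub>0 \<le> 4 * (\<Sum>x\<in>{1..n}. (influence x)\<^sup>2)"
proof -
  let ?Z = "[t..<Suc n]" and ?D = "mean_ham \<tau>\<^sub>0 t"
  let ?V = "\<Sum>x\<in>{t..<Suc n}. (influence x)\<^sup>2" and ?V' = "\<Sum>x\<in>{1..<t}. (influence x)\<^sup>2"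
  have 1: "run_mean p ?Z (\<lambda>\<sigma>'. (ham \<sigma> \<sigma>' - ?D)\<^sup>2) \<tau> \<le> ?V + (run_mean p ?Z (ham \<sigma>) \<tau> - ?D)\<^sup>2" for \<sigma> \<tau>
    using run_var_le[OF reach_lipschitz_ham, of t \<sigma> \<tau>] t by (simp add: run_mean_square_dev del: upt_Suc)
  have 2: "run_mean p ?Z (\<lambda>\<sigma>. run_mean p ?Z (\<lambda>\<sigma>'. (ham \<sigma> \<sigma>' - ?D)\<^sup>2) \<tau>) \<tau> \<le> 2 * ?V + (pair_mean t \<tau> \<tau> - ?D)\<^sup>2" for \<tau>
  proof -
    have "run_mean p ?Z (\<lambda>\<sigma>. run_mean p ?Z (\<lambda>\<sigma>'. (ham \<sigma> \<sigma>' - ?D)\<^sup>2) \<tau>) \<tau> \<le> run_mean p ?Z (\<lambda>\<sigma>. ?V + (run_mean p ?Z (ham \<sigma>) \<tau> - ?D)\<^sup>2) \<tau>"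
      by (intro run_mean_mono 1)
    also have "\<dots> = ?V + run_var ?Z (\<lambda>\<sigma>. run_mean p ?Z (ham \<sigma>) \<tau>) \<tau> + (pair_mean t \<tau> \<tau> - ?D)\<^sup>2"
      by (simp add: run_mean_add run_mean_square_dev pair_mean_def del: upt_Suc)
    also have "run_var ?Z (\<lambda>\<sigma>. run_mean p ?Z (ham \<sigma>) \<tau>) \<tau> \<le> 1\<^sup>2 * ?V"
      using t by (intro run_var_le reach_lipschitz_average reach_lipschitz_ham') auto
    finally show ?thesis by simp
  qed
  have "run_mean p [1..<t] (\<lambda>\<tau>. run_mean p ?Z (\<lambda>\<sigma>. run_mean p ?Z (\<lambda>\<sigma>'. (ham \<sigma> \<sigma>' - ?D)\<^sup>2) \<tau>) \<tau>) \<tau>\<^sub>0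
     \<le> run_mean p [1..<t] (\<lambda>\<tau>. 2 * ?V + (pair_mean t \<tau> \<tau> - ?D)\<^sup>2) \<tau>\<^sub>0"
    by (intro run_mean_mono 2)
  also have "\<dots> = 2 * ?V + run_var [1..<t] (\<lambda>\<tau>. pair_mean t \<tau> \<tau>) \<tau>\<^sub>0"
    by (simp add: run_mean_add run_mean_square_dev mean_ham_def del: upt_Suc)
  also have "run_var [1..<t] (\<lambda>\<tau>. pair_mean t \<tau> \<tau>) \<tau>\<^sub>0 \<le> 2\<^sup>2 * ?V'"
    using t by (intro run_var_le reach_lipschitz_diag) auto
  also have "2 * ?V + 2\<^sup>2 * ?V' \<le> 4 * (?V' + ?V)" by (simp add: sum_nonneg)
  also have "?V' + ?V = (\<Sum>x\<in>{1..<Suc n}. (influence x)\<^sup>2)"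
    using t by (intro sum.atLeastLessThan_concat) auto
  finally show ?thesis by (simp add: atLeastLessThanSuc_atLeastAtMost)
qed

text \<open>Given the past, the cube of the success probability is the probability that three
  independent continuations all lie in \<open>S\<close>. Some distance among them then deviates by
  \<open>w\<close> from its mean, which Chebyshev bounds; Jensen takes the cube out of the average
  over the past.\<close>

lemma success_cube_le:
  assumes t: "1 \<le> t" "t \<le> Suc n" and w: "0 < w"
    and S: "\<And>\<sigma>\<^sub>1 \<sigma>\<^sub>2 \<sigma>\<^sub>3. \<sigma>\<^sub>1 \<in> S \<Longrightarrow> \<sigma>\<^sub>2 \<in> S \<Longrightarrow> \<sigma>\<^sub>3 \<in> S \<Longrightarrow>
      w \<le> \<bar>ham \<sigma>\<^sub>1 \<sigma>\<^sub>2 - mean_ham \<tau>\<^sub>0 t\<bar> \<or> w \<le> \<bar>ham \<sigma>\<^sub>1 \<sigma>\<^sub>3 - mean_ham \<tau>\<^sub>0 t\<bar> \<or> w \<le> \<bar>ham \<sigma>\<^sub>2 \<sigma>\<^sub>3 - mean_ham \<tau>\<^sub>0 t\<bar>"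
  shows "run_mean p [1..<Suc n] (indicator S) \<tau>\<^sub>0 ^ 3 \<le> 12 * (\<Sum>x\<in>{1..n}. (influence x)\<^sup>2) / w\<^sup>2"
proof -
  let ?Z = "[t..<Suc n]" and ?D = "mean_ham \<tau>\<^sub>0 t" and ?s = "indicator S :: _ \<Rightarrow> real"
  let ?f = "\<lambda>\<sigma> \<sigma>'. (ham \<sigma> \<sigma>' - ?D)\<^sup>2"
  let ?M = "\<lambda>\<tau>. run_mean p ?Z (\<lambda>\<sigma>. run_mean p ?Z (\<lambda>\<sigma>'. ?f \<sigma> \<sigma>') \<tau>) \<tau>"
  have upt: "[1..<Suc n] = [1..<t] @ ?Z"
    using t by (metis upt_add_eq_append le_Suc_ex)
  have triple: "?s \<sigma>\<^sub>1 * (?s \<sigma>\<^sub>2 * ?s \<sigma>\<^sub>3) \<le> (1 / w\<^sup>2) * (?f \<sigma>\<^sub>1 \<sigma>\<^sub>2 + ?f \<sigma>\<^sub>1 \<sigma>\<^sub>3 + ?f \<sigma>\<^sub>2 \<sigma>\<^sub>3)" for \<sigma>\<^sub>1 \<sigma>\<^sub>2 \<sigma>\<^sub>3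
  proof (cases "\<sigma>\<^sub>1 \<in> S \<and> \<sigma>\<^sub>2 \<in> S \<and> \<sigma>\<^sub>3 \<in> S")
    case True
    have sq: "w\<^sup>2 \<le> x\<^sup>2" if "w \<le> \<bar>x\<bar>" for x :: real
      using that w by (metis less_eq_real_def power2_abs power_mono)
    have "w\<^sup>2 \<le> ?f \<sigma>\<^sub>1 \<sigma>\<^sub>2 + ?f \<sigma>\<^sub>1 \<sigma>\<^sub>3 + ?f \<sigma>\<^sub>2 \<sigma>\<^sub>3"
      using S[of \<sigma>\<^sub>1 \<sigma>\<^sub>2 \<sigma>\<^sub>3] True sq by (smt (verit) zero_le_power2)
    then show ?thesis using True w by (simp add: field_simps)
  next
    case False
    then have "?s \<sigma>\<^sub>1 * (?s \<sigma>\<^sub>2 * ?s \<sigma>\<^sub>3) = 0" by (auto simp: indicator_def)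
    then show ?thesis using w by (simp only:) simp
  qed
  have cube: "run_mean p ?Z ?s \<tau> ^ 3 \<le> (1 / w\<^sup>2) * (3 * ?M \<tau>)" for \<tau>
  proof -
    have "run_mean p ?Z ?s \<tau> ^ 3 = run_mean p ?Z (\<lambda>\<sigma>\<^sub>1. run_mean p ?Z (\<lambda>\<sigma>\<^sub>2. run_mean p ?Z (\<lambda>\<sigma>\<^sub>3. ?s \<sigma>\<^sub>1 * (?s \<sigma>\<^sub>2 * ?s \<sigma>\<^sub>3)) \<tau>) \<tau>) \<tau>"
      by (simp only: run_mean_cmult run_mean_multc power3_eq_cube)
    also have "\<dots> \<le> run_mean p ?Z (\<lambda>\<sigma>\<^sub>1. run_mean p ?Z (\<lambda>\<sigma>\<^sub>2. run_mean p ?Z (\<lambda>\<sigma>\<^sub>3.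
       (1 / w\<^sup>2) * (?f \<sigma>\<^sub>1 \<sigma>\<^sub>2 + ?f \<sigma>\<^sub>1 \<sigma>\<^sub>3 + ?f \<sigma>\<^sub>2 \<sigma>\<^sub>3)) \<tau>) \<tau>) \<tau>"
      by (intro run_mean_mono triple)
    also have "\<dots> = (1 / w\<^sup>2) * (3 * ?M \<tau>)"
      by (simp only: run_mean_cmult run_mean_add run_mean_const) simp
    finally show ?thesis .
  qed
  have "run_mean p [1..<Suc n] ?s \<tau>\<^sub>0 ^ 3 \<le> run_mean p [1..<t] (\<lambda>\<tau>. run_mean p ?Z ?s \<tau> ^ 3) \<tau>\<^sub>0"
    unfolding upt run_mean_append by (intro run_mean_cube_ge run_mean_nonneg) simp
  also have "\<dots> \<le> run_mean p [1..<t] (\<lambda>\<tau>. (1 / w\<^sup>2) * (3 * ?M \<tau>)) \<tau>\<^sub>0"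
    by (intro run_mean_mono cube)
  also have "\<dots> = (1 / w\<^sup>2) * (3 * run_mean p [1..<t] ?M \<tau>\<^sub>0)"
    by (simp only: run_mean_cmult)
  also have "\<dots> \<le> (1 / w\<^sup>2) * (3 * (4 * (\<Sum>x\<in>{1..n}. (influence x)\<^sup>2)))"
    using ham_second_moment[OF t, of \<tau>\<^sub>0] by (intro mult_left_mono) auto
  finally show ?thesis by simp
qed

lemma discrete_ivt:
  fixes D :: "nat \<Rightarrow> real"
  assumes "a \<le> D 1" "D (Suc m) \<le> a" "\<And>t. t \<in> {1..m} \<Longrightarrow> \<bar>D t - D (Suc t)\<bar> \<le> e" "0 \<le> e"
  shows "\<exists>t. 1 \<le> t \<and> t \<le> Suc m \<and> \<bar>D t - a\<bar> \<le> e"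
  using assms
proof (induction m)
  case 0
  then show ?case by (intro exI[of _ 1]) auto
next
  case (Suc m)
  show ?case
  proof (cases "D (Suc m) \<le> a")
    case True
    then obtain t where "1 \<le> t \<and> t \<le> Suc m \<and> \<bar>D t - a\<bar> \<le> e"
      using Suc.IH Suc.prems by force
    then show ?thesis by (intro exI[of _ t]) auto
  next
    case False
    then show ?thesis
      using Suc.prems(2) Suc.prems(3)[of "Suc m"] by (intro exI[of _ "Suc m"]) auto
  qed
qed

end

section \<open>Complementation symmetry of the process\<close>

locale symmetric_local_process = local_process +
  assumes p_flip: "x \<in> {1..n} \<Longrightarrow> p x (\<lambda>i. \<not> \<tau> i) = 1 - p x \<tau>"
begin

lemma run_mean_flip:
  assumes "set xs \<subseteq> {1..n}"
  shows "run_mean p xs h (\<lambda>i. \<not> \<tau> i) = run_mean p xs (\<lambda>\<sigma>. h (\<lambda>i. \<not> \<sigma> i)) \<tau>"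
  using assms
proof (induction xs arbitrary: \<tau>)
  case (Cons x xs)
  have upd: "(\<lambda>i. \<not> \<tau> i)(x := b) = (\<lambda>i. \<not> (\<tau>(x := \<not> b)) i)" for b by auto
  have "run_mean p xs h ((\<lambda>i. \<not> \<tau> i)(x := b)) = run_mean p xs (\<lambda>\<sigma>. h (\<lambda>i. \<not> \<sigma> i)) (\<tau>(x := \<not> b))" for b
    unfolding upd by (rule Cons.IH) (use Cons.prems in simp)
  then show ?case using Cons.prems by (simp add: p_flip)
qed simp

text \<open>Complementing the starting state complements the outcome, by symmetry, yet it cannot
  affect the law of the outcome: before step 1 nothing is fixed, and \<open>reach 1 {}\<close> is
  empty.\<close>

lemma marginal_half:
  assumes i: "i \<in> {1..n}"
  shows "run_mean p [1..<Suc n] (\<lambda>\<sigma>. of_bool (\<sigma> i)) \<tau> = 1 / 2"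
proof -
  let ?h = "\<lambda>\<sigma>. of_bool (\<sigma> i) :: real"
  have "reach_lipschitz (Suc n) 1 ?h"
    unfolding reach_lipschitz_def reach_end
  proof (intro allI impI)
    fix \<tau> \<tau>' :: "nat \<Rightarrow> bool" and A assume A: "finite A" "agree (Suc n) A \<tau> \<tau>'"
    have "card {i} \<le> card A" if "i \<in> A" using A that by (intro card_mono) auto
    then show "\<bar>?h \<tau> - ?h \<tau>'\<bar> \<le> 1 * real (card A)"
      using A i by (cases "i \<in> A") (auto simp: agree_def of_bool_def)
  qed
  then have "reach_lipschitz 1 1 (run_mean p [1..<Suc n] ?h)"
    by (intro reach_lipschitz_run_mean) auto
  then have "\<bar>run_mean p [1..<Suc n] ?h \<tau> - run_mean p [1..<Suc n] ?h (\<lambda>i. \<not> \<tau> i)\<bar> \<le> 1 * real (card (reach 1 {}))"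
    unfolding reach_lipschitz_def by (auto simp: agree_def simp del: upt_Suc)
  then have "run_mean p [1..<Suc n] ?h \<tau> = run_mean p [1..<Suc n] ?h (\<lambda>i. \<not> \<tau> i)"
    by (simp add: reach_empty)
  also have "\<dots> = run_mean p [1..<Suc n] (\<lambda>\<sigma>. 1 - ?h \<sigma>) \<tau>"
    by (subst run_mean_flip) (simp_all only: of_bool_not_iff, auto)
  also have "\<dots> = 1 - run_mean p [1..<Suc n] ?h \<tau>" by (simp only: run_mean_diff run_mean_const)
  finally show ?thesis by simp
qed

lemma mean_ham_1: "mean_ham \<tau> 1 = n / 2"
proof -
  let ?Z = "[1..<Suc n]"
  \<comment> \<open>Each summand is affine in the value of \<open>\<sigma>'\<close> at
    \<open>i\<close>, and becomes 1/2 when that value is replaced by its mean 1/2, whatever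
    \<open>\<sigma> i\<close> is.\<close>
  have ham: "ham \<sigma> \<sigma>' = (\<Sum>i\<in>{1..n}. of_bool (\<sigma> i) + (1 - 2 * of_bool (\<sigma> i)) * of_bool (\<sigma>' i))" for \<sigma> \<sigma>'
  proof -
    have "ham \<sigma> \<sigma>' = (\<Sum>i\<in>{1..n}. of_bool (\<sigma> i \<noteq> \<sigma>' i))"
      unfolding hamming_def by (subst sum_of_bool_eq) (auto simp: Int_def)
    also have "\<dots> = (\<Sum>i\<in>{1..n}. of_bool (\<sigma> i) + (1 - 2 * of_bool (\<sigma> i)) * of_bool (\<sigma>' i))"
      by (intro sum.cong) auto
    finally show ?thesis .
  qed
  have half: "run_mean p ?Z (ham \<sigma>) \<tau> = n / 2" for \<sigma>
  proof -
    have "run_mean p ?Z (ham \<sigma>) \<tau> = (\<Sum>i\<in>{1..n}. of_bool (\<sigma> i) + (1 - 2 * of_bool (\<sigma> i)) * (1 / 2))"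
      unfolding ham by (simp only: run_mean_sum run_mean_add run_mean_const run_mean_cmult marginal_half cong: sum.cong)
    also have "\<dots> = n / 2" by (simp add: algebra_simps)
    finally show ?thesis .
  qed
  have "mean_ham \<tau> 1 = run_mean p ?Z (\<lambda>\<sigma>. run_mean p ?Z (ham \<sigma>) \<tau>) \<tau>"
    by (simp add: mean_ham_def pair_mean_def del: upt_Suc)
  also have "\<dots> = n / 2" by (simp only: half run_mean_const)
  finally show ?thesis .
qed

text \<open>When all influences are at most \<open>\<delta>\<close>, the mean distance falls from
  \<open>n / 2\<close> to 0 in steps of at most \<open>\<delta>\<close> and so comes within
  \<open>\<delta>\<close> of \<open>a\<close>. The other half of the forbidden window
  \<open>2 * \<delta>\<close> is left to Chebyshev.\<close>

theorem overlap_gap_bound: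
  assumes a: "0 \<le> a" "a \<le> n / 2" and \<delta>: "0 < \<delta>"
    and S: "\<And>\<sigma>\<^sub>1 \<sigma>\<^sub>2 \<sigma>\<^sub>3. \<sigma>\<^sub>1 \<in> S \<Longrightarrow> \<sigma>\<^sub>2 \<in> S \<Longrightarrow> \<sigma>\<^sub>3 \<in> S \<Longrightarrow>
      2 * \<delta> \<le> \<bar>ham \<sigma>\<^sub>1 \<sigma>\<^sub>2 - a\<bar> \<or> 2 * \<delta> \<le> \<bar>ham \<sigma>\<^sub>1 \<sigma>\<^sub>3 - a\<bar> \<or> 2 * \<delta> \<le> \<bar>ham \<sigma>\<^sub>2 \<sigma>\<^sub>3 - a\<bar>"
  shows "run_mean p [1..<Suc n] (indicator S) \<tau>\<^sub>0 ^ 3 \<le> 12 * (\<Sum>x\<in>{1..n}. (influence x)\<^sup>2) / \<delta>\<^sup>2"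
proof (cases "\<forall>t\<in>{1..n}. influence t \<le> \<delta>")
  case True
  have "\<exists>t. 1 \<le> t \<and> t \<le> Suc n \<and> \<bar>mean_ham \<tau>\<^sub>0 t - a\<bar> \<le> \<delta>"
  proof (rule discrete_ivt)
    fix t assume "t \<in> {1..n}"
    then show "\<bar>mean_ham \<tau>\<^sub>0 t - mean_ham \<tau>\<^sub>0 (Suc t)\<bar> \<le> \<delta>"
      using mean_ham_step[of t \<tau>\<^sub>0] True by force
  qed (use a \<delta> mean_ham_1[of \<tau>\<^sub>0] in \<open>simp_all add: mean_ham_end\<close>)
  then obtain t where t: "1 \<le> t" "t \<le> Suc n" "\<bar>mean_ham \<tau>\<^sub>0 t - a\<bar> \<le> \<delta>" by blast
  show ?thesis
  proof (rule success_cube_le[OF t(1,2) \<delta>])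
    fix \<sigma>\<^sub>1 \<sigma>\<^sub>2 \<sigma>\<^sub>3 assume "\<sigma>\<^sub>1 \<in> S" "\<sigma>\<^sub>2 \<in> S" "\<sigma>\<^sub>3 \<in> S"
    from S[OF this] show "\<delta> \<le> \<bar>ham \<sigma>\<^sub>1 \<sigma>\<^sub>2 - mean_ham \<tau>\<^sub>0 t\<bar> \<or> \<delta> \<le> \<bar>ham \<sigma>\<^sub>1 \<sigma>\<^sub>3 - mean_ham \<tau>\<^sub>0 t\<bar> \<or>
      \<delta> \<le> \<bar>ham \<sigma>\<^sub>2 \<sigma>\<^sub>3 - mean_ham \<tau>\<^sub>0 t\<bar>" using t(3) by linarith
  qed
next
  \<comment> \<open>One influence above \<open>\<delta>\<close> already makes the right-hand side at
    least 1.\<close>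
  case False
  then obtain t where t: "t \<in> {1..n}" "\<delta> < influence t" by force
  have "run_mean p [1..<Suc n] (indicator S) \<tau>\<^sub>0 \<le> run_mean p [1..<Suc n] (\<lambda>_. 1) \<tau>\<^sub>0"
    by (intro run_mean_mono) (simp add: indicator_def)
  then have "run_mean p [1..<Suc n] (indicator S) \<tau>\<^sub>0 ^ 3 \<le> 1 ^ 3"
    by (intro power_mono run_mean_nonneg) (auto simp del: upt_Suc)
  also have "\<dots> \<le> (\<Sum>x\<in>{1..n}. (influence x)\<^sup>2) / \<delta>\<^sup>2"
  proof -
    have "\<delta>\<^sup>2 \<le> (influence t)\<^sup>2" using t \<delta> by (intro power_mono) auto
    also have "\<dots> \<le> (\<Sum>x\<in>{1..n}. (influence x)\<^sup>2)" using t by (intro member_le_sum) auto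
    finally show ?thesis using \<delta> by (simp add: field_simps)
  qed
  also have "\<dots> \<le> 12 * (\<Sum>x\<in>{1..n}. (influence x)\<^sup>2) / \<delta>\<^sup>2"
    by (intro divide_right_mono) (auto intro!: sum_nonneg)
  finally show ?thesis .
qed

end

section \<open>Locality and symmetry of belief propagation\<close>

definition expand :: "'a set set \<Rightarrow> 'a set \<Rightarrow> 'a set" where
  "expand E W = W \<union> \<Union>{e \<in> E. e \<inter> W \<noteq> {}}"

definition hball :: "'a set set \<Rightarrow> nat \<Rightarrow> 'a set \<Rightarrow> 'a set" where
  "hball E k = expand E ^^ k"

lemma hball_0 [simp]: "hball E 0 W = W"
  by (simp add: hball_def)

lemma hball_Suc: "hball E (Suc k) W = expand E (hball E k W)"
  by (simp add: hball_def)

lemma hball_Suc': "hball E (Suc k) W = hball E k (expand E W)"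
  by (simp add: hball_def funpow_swap1)

lemma expand_increasing: "W \<subseteq> expand E W"
  by (auto simp: expand_def)

lemma hball_increasing: "W \<subseteq> hball E k W"
  by (induction k) (auto simp: hball_Suc intro: expand_increasing[THEN subsetD])

lemma hball_mono_radius: "k \<le> l \<Longrightarrow> hball E k W \<subseteq> hball E l W"
  by (induction l rule: dec_induct) (auto simp: hball_Suc intro: expand_increasing[THEN subsetD])

lemma hball_subset:
  assumes "\<Union>E \<subseteq> U" "W \<subseteq> U"
  shows "hball E k W \<subseteq> U"
  using assms by (induction k) (auto simp: hball_Suc expand_def)

lemma finite_hball:
  assumes "finite E" "\<And>e. e \<in> E \<Longrightarrow> finite e" "finite W"
  shows "finite (hball E k W)"
  using assms by (induction k) (auto simp: hball_Suc expand_def)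

abbreviation cvars :: "clause \<Rightarrow> nat set" where
  "cvars C \<equiv> lit_var ` fst C"

definition edges :: "inst \<Rightarrow> nat set set" where
  "edges \<Phi> = cvars ` set (clauses \<Phi>)"

lemma edges_conv_nth: "edges \<Phi> = (\<lambda>j. cvars (clauses \<Phi> ! j)) ` {..<length (clauses \<Phi>)}"
proof -
  have "set (clauses \<Phi>) = (!) (clauses \<Phi>) ` {..<length (clauses \<Phi>)}"
    by (auto simp: set_conv_nth)
  then show ?thesis by (simp add: edges_def image_image)
qed

lemma nodes_within_0: "nodes_within \<Phi> x 0 = {VarNode x}"
  by (simp add: nodes_within_def)

lemma nodes_within_Suc:
  "nodes_within \<Phi> x (Suc r) = nodes_within \<Phi> x r \<union> factor_graph \<Phi> `` nodes_within \<Phi> x r"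
proof -
  let ?R = "factor_graph \<Phi>"
  have "nodes_within \<Phi> x (Suc r) = nodes_within \<Phi> x r \<union> (?R ^^ Suc r) `` {VarNode x}"
    by (auto simp: nodes_within_def atMost_Suc simp del: relpow.simps)
  moreover have "(?R ^^ Suc r) `` {VarNode x} \<subseteq> ?R `` nodes_within \<Phi> x r"
    by (fastforce simp: nodes_within_def)
  moreover have "?R `` nodes_within \<Phi> x r \<subseteq> nodes_within \<Phi> x (Suc r)"
  proof
    fix v assume "v \<in> ?R `` nodes_within \<Phi> x r"
    then obtain k u where "k \<le> r" "(VarNode x, u) \<in> ?R ^^ k" "(u, v) \<in> ?R"
      by (auto simp: nodes_within_def)
    then have "Suc k \<le> Suc r" "(VarNode x, v) \<in> ?R ^^ Suc k" by (auto intro: relpow_Suc_I)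
    then show "v \<in> nodes_within \<Phi> x (Suc r)" unfolding nodes_within_def by blast
  qed
  ultimately show ?thesis by blast
qed

lemma factor_graph_Image:
  "factor_graph \<Phi> `` (VarNode ` V \<union> ClauseNode ` J) =
     ClauseNode ` {j. j < length (clauses \<Phi>) \<and> cvars (clauses \<Phi> ! j) \<inter> V \<noteq> {}} \<union>
     VarNode ` (\<Union>j\<in>{j \<in> J. j < length (clauses \<Phi>)}. cvars (clauses \<Phi> ! j))"
  unfolding factor_graph_def by (auto simp: image_iff Image_iff) blast+

text \<open>Two steps in the factor graph are one step in the hypergraph of clauses. The last step
  reaches no new clauses, so the clauses found are those that meet the ball of radius
  \<open>k\<close>, not of radius \<open>Suc k\<close>.\<close>

lemma nodes_within_even:
  "nodes_within \<Phi> x (2 * Suc k) = VarNode ` hball (edges \<Phi>) (Suc k) {x} \<union>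
     ClauseNode ` {j. j < length (clauses \<Phi>) \<and> cvars (clauses \<Phi> ! j) \<inter> hball (edges \<Phi>) k {x} \<noteq> {}}"
    (is "_ = VarNode ` ?B (Suc k) \<union> ClauseNode ` ?T k")
proof -
  have UN: "(\<Union>j\<in>?T k. cvars (clauses \<Phi> ! j)) = \<Union>{e \<in> edges \<Phi>. e \<inter> ?B k \<noteq> {}}" for k
    by (auto simp: edges_conv_nth)
  have mono: "?T k \<subseteq> ?T (Suc k)" for k
    using hball_mono_radius[of k "Suc k" "edges \<Phi>" "{x}"] by auto
  \<comment> \<open>\<open>J\<close> holds the clauses found so far. Their variables are in the
    current ball, so the first step adds clauses only and the second step variables only.\<close>
  have step: "nodes_within \<Phi> x (Suc (Suc r)) = VarNode ` ?B (Suc k) \<union> ClauseNode ` ?T k"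
    if r: "nodes_within \<Phi> x r = VarNode ` ?B k \<union> ClauseNode ` J"
      and J: "J \<subseteq> ?T k" "(\<Union>j\<in>J. cvars (clauses \<Phi> ! j)) \<subseteq> ?B k" for r k J
  proof -
    have absorb1: "V \<union> A \<union> (T \<union> B) = V \<union> T" if "A \<subseteq> T" "B \<subseteq> V" for V A T B :: "node set"
      using that by blast
    have absorb2: "V \<union> T \<union> (T \<union> B) = V \<union> B \<union> T" for V T B :: "node set" by blast
    have J': "{j \<in> J. j < length (clauses \<Phi>)} = J" "{j \<in> ?T k. j < length (clauses \<Phi>)} = ?T k"
      using J(1) by auto
    have "nodes_within \<Phi> x (Suc r) = VarNode ` ?B k \<union> ClauseNode ` ?T k"
      unfolding nodes_within_Suc r factor_graph_Image J'
      by (rule absorb1) (intro image_mono J)+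
    then have "nodes_within \<Phi> x (Suc (Suc r)) = VarNode ` (?B k \<union> (\<Union>j\<in>?T k. cvars (clauses \<Phi> ! j))) \<union> ClauseNode ` ?T k"
      by (simp only: nodes_within_Suc[of \<Phi> x "Suc r"] factor_graph_Image J' image_Un absorb2)
    also have "?B k \<union> (\<Union>j\<in>?T k. cvars (clauses \<Phi> ! j)) = ?B (Suc k)"
      unfolding UN by (simp add: hball_Suc expand_def)
    finally show ?thesis .
  qed
  show ?thesis
  proof (induction k)
    case 0
    have "nodes_within \<Phi> x (Suc (Suc 0)) = VarNode ` ?B (Suc 0) \<union> ClauseNode ` ?T 0"
      by (rule step[where J = "{}"]) (auto simp: nodes_within_0)
    then show ?case by (simp add: numeral_2_eq_2)
  next
    case (Suc k)
    have "nodes_within \<Phi> x (Suc (Suc (2 * Suc k))) = VarNode ` ?B (Suc (Suc k)) \<union> ClauseNode ` ?T (Suc k)"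
    proof (rule step[OF Suc.IH mono])
      show "(\<Union>j\<in>?T k. cvars (clauses \<Phi> ! j)) \<subseteq> ?B (Suc k)"
        unfolding UN by (auto simp: hball_Suc expand_def)
    qed
    then show ?case by (simp only: mult_Suc_right add_2_eq_Suc)
  qed
qed

text \<open>Order and multiplicity of the clauses do not affect the marginal. With sets in place of
  lists, locality and symmetry reduce to equations between sets.\<close>

definition local_prob :: "nat set \<Rightarrow> clause set \<Rightarrow> nat \<Rightarrow> real" where
  "local_prob V Cs x = (let S = {\<sigma> \<in> V \<rightarrow>\<^sub>E UNIV. \<forall>C\<in>Cs. sat_clause \<sigma> C} in
     if S = {} then 1 / 2 else real (card {\<sigma> \<in> S. \<sigma> x}) / real (card S))"

definition touching :: "inst \<Rightarrow> nat set \<Rightarrow> clause set" where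
  "touching \<Phi> V = {C \<in> set (clauses \<Phi>). cvars C \<inter> V \<noteq> {}}"

lemma bp_prob_eq_local_prob:
  "bp_prob (2 * Suc k) \<Phi> x =
     local_prob (hball (edges \<Phi>) (Suc k) {x}) (touching \<Phi> (hball (edges \<Phi>) k {x})) x"
proof -
  have "vars (nbhd \<Phi> x (2 * Suc k)) = hball (edges \<Phi>) (Suc k) {x}"
    unfolding nbhd_def nodes_within_even by auto
  moreover have "set (clauses (nbhd \<Phi> x (2 * Suc k))) = touching \<Phi> (hball (edges \<Phi>) k {x})"
  proof -
    let ?T = "{j. j < length (clauses \<Phi>) \<and> cvars (clauses \<Phi> ! j) \<inter> hball (edges \<Phi>) k {x} \<noteq> {}}"
    have "{j. ClauseNode j \<in> nodes_within \<Phi> x (2 * Suc k)} = ?T"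
      unfolding nodes_within_even by auto
    then have "set (clauses (nbhd \<Phi> x (2 * Suc k))) = {clauses \<Phi> ! j |j. j < length (clauses \<Phi>) \<and> j \<in> ?T}"
      by (simp only: nbhd_def inst.sel set_nths)
    also have "\<dots> = touching \<Phi> (hball (edges \<Phi>) k {x})"
      unfolding touching_def set_conv_nth by blast
    finally show ?thesis .
  qed
  ultimately show ?thesis
    by (simp add: bp_prob_def local_prob_def solutions_def)
qed

lemma local_prob_range: "0 \<le> local_prob V Cs x" "local_prob V Cs x \<le> 1"
proof -
  let ?S = "{\<sigma> \<in> V \<rightarrow>\<^sub>E UNIV. \<forall>C\<in>Cs. sat_clause \<sigma> C}"
  have "card {\<sigma> \<in> ?S. \<sigma> x} \<le> card ?S" if "finite ?S" using that by (intro card_mono) auto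
  then show "0 \<le> local_prob V Cs x" "local_prob V Cs x \<le> 1"
    by (cases "finite ?S"; auto simp: local_prob_def Let_def divide_le_eq)+
qed

section \<open>Complementation of reduced clauses and of the marginal\<close>

primrec flip_sign :: "sign \<Rightarrow> sign" where
  "flip_sign Plus = Minus"
| "flip_sign Minus = Plus"
| "flip_sign Zero = Zero"

definition flip_clause :: "clause \<Rightarrow> clause" where
  "flip_clause C = (fst C, flip_sign (snd C))"

lemma cvars_flip [simp]: "cvars (flip_clause C) = cvars C"
  by (simp add: flip_clause_def)

lemma lit_val_flip: "lit_val (\<lambda>i. \<not> \<sigma> i) l \<longleftrightarrow> \<not> lit_val \<sigma> l"
  by (cases l) auto

lemma sat_clause_flip: "sat_clause (\<lambda>i. \<not> \<sigma> i) (flip_clause C) \<longleftrightarrow> sat_clause \<sigma> C"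
  by (cases C; cases "snd C") (auto simp: flip_clause_def lit_val_flip)

lemma lit_val_cong: "\<sigma> (lit_var l) = \<sigma>' (lit_var l) \<Longrightarrow> lit_val \<sigma> l = lit_val \<sigma>' l"
  by (cases l) auto

lemma sat_clause_cong:
  assumes "\<And>x. x \<in> cvars C \<Longrightarrow> \<sigma> x = \<sigma>' x"
  shows "sat_clause \<sigma> C = sat_clause \<sigma>' C"
proof -
  have "lit_val \<sigma> l = lit_val \<sigma>' l" if "l \<in> fst C" for l
    using that assms by (intro lit_val_cong) auto
  then show ?thesis by (cases C; cases "snd C") auto
qed

text \<open>Complementation within \<open>V\<close> is a bijection between the two sets of solutions
  that exchanges the two values of \<open>x\<close>.\<close>

lemma local_prob_flip:
  assumes V: "finite V" "x \<in> V" "\<And>C. C \<in> Cs \<Longrightarrow> cvars C \<subseteq> V"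
  shows "local_prob V (flip_clause ` Cs) x = 1 - local_prob V Cs x"
proof -
  define sol where "sol Cs = {\<sigma> \<in> V \<rightarrow>\<^sub>E UNIV. \<forall>C\<in>Cs. sat_clause \<sigma> C}" for Cs
  let ?f = "\<lambda>\<sigma>::nat \<Rightarrow> bool. \<lambda>i\<in>V. \<not> \<sigma> i" and ?Cs = "flip_clause ` Cs"
  have fin: "finite (sol Cs')" for Cs'
    using V(1) finite_PiE[of V "\<lambda>_. UNIV :: bool set"] by (auto simp: sol_def)
  have sat: "sat_clause (?f \<sigma>) (flip_clause C) = sat_clause \<sigma> C" if "C \<in> Cs" for \<sigma> C
  proof -
    have "sat_clause (?f \<sigma>) (flip_clause C) = sat_clause (\<lambda>i. \<not> \<sigma> i) (flip_clause C)"
      using V(3)[OF that] by (intro sat_clause_cong) auto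
    then show ?thesis by (simp add: sat_clause_flip)
  qed
  have ff: "?f (?f \<sigma>) = \<sigma>" if "\<sigma> \<in> V \<rightarrow>\<^sub>E UNIV" for \<sigma>
    using that by (auto simp: fun_eq_iff PiE_def extensional_def)
  have bij: "bij_betw ?f {\<sigma> \<in> sol Cs. P \<sigma>} {\<sigma> \<in> sol ?Cs. P (?f \<sigma>)}" for P
  proof (rule bij_betwI[where g = ?f])
    show "?f \<in> {\<sigma> \<in> sol Cs. P \<sigma>} \<rightarrow> {\<sigma> \<in> sol ?Cs. P (?f \<sigma>)}"
      using sat ff by (auto simp: sol_def)
    show "?f \<in> {\<sigma> \<in> sol ?Cs. P (?f \<sigma>)} \<rightarrow> {\<sigma> \<in> sol Cs. P \<sigma>}"
      using sat ff by (auto simp: sol_def) (metis ff sat)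
    show "?f (?f a) = a" if "a \<in> {\<sigma> \<in> sol Cs. P \<sigma>}" for a
      using that by (intro ff) (simp add: sol_def)
    show "?f (?f a) = a" if "a \<in> {\<sigma> \<in> sol ?Cs. P (?f \<sigma>)}" for a
      using that by (intro ff) (simp add: sol_def)
  qed
  have c1: "card (sol ?Cs) = card (sol Cs)"
    using bij_betw_same_card[OF bij[of "\<lambda>_. True"]] by simp
  have "{\<sigma> \<in> sol ?Cs. \<sigma> x} = {\<sigma> \<in> sol ?Cs. \<not> (?f \<sigma>) x}"
    using V(2) by auto
  then have c2: "card {\<sigma> \<in> sol ?Cs. \<sigma> x} = card {\<sigma> \<in> sol Cs. \<not> \<sigma> x}"
    using bij_betw_same_card[OF bij[of "\<lambda>\<sigma>. \<not> \<sigma> x"]] by simp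
  have "card {\<sigma> \<in> sol Cs. \<not> \<sigma> x} + card {\<sigma> \<in> sol Cs. \<sigma> x} = card ({\<sigma> \<in> sol Cs. \<not> \<sigma> x} \<union> {\<sigma> \<in> sol Cs. \<sigma> x})"
    using fin by (intro card_Un_disjoint[symmetric]) auto
  also have "{\<sigma> \<in> sol Cs. \<not> \<sigma> x} \<union> {\<sigma> \<in> sol Cs. \<sigma> x} = sol Cs" by auto
  finally have c3: "real (card {\<sigma> \<in> sol Cs. \<not> \<sigma> x}) = real (card (sol Cs)) - real (card {\<sigma> \<in> sol Cs. \<sigma> x})"
    by linarith
  \<comment> \<open>Without solutions both sides are 1/2: the default value is its own
    complement.\<close>
  have "sol ?Cs = {} \<longleftrightarrow> sol Cs = {}" using c1 fin by (metis card_eq_0_iff)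
  moreover have "real (card (sol Cs)) \<noteq> 0" if "sol Cs \<noteq> {}" using that fin by simp
  ultimately show ?thesis
    unfolding local_prob_def sol_def[symmetric] Let_def c1 c2 c3
    by (cases "sol Cs = {}") (simp_all add: field_simps)
qed

section \<open>Fixing several variables\<close>

text \<open>A removed clause stays removed, so fixing a list of variables acts separately on each
  clause of the original formula; see \<open>clauses_fix_vars\<close>.\<close>

primrec fix_clauses :: "(nat \<Rightarrow> bool) \<Rightarrow> nat list \<Rightarrow> clause \<Rightarrow> clause option" where
  "fix_clauses \<tau> [] C = Some C"
| "fix_clauses \<tau> (x # xs) C = Option.bind (fix_clause x (\<tau> x) C) (fix_clauses \<tau> xs)"

definition fix_vars :: "(nat \<Rightarrow> bool) \<Rightarrow> nat list \<Rightarrow> inst \<Rightarrow> inst" where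
  "fix_vars \<tau> xs \<Phi> = fold (\<lambda>x. fix_var x (\<tau> x)) xs \<Phi>"

lemma set_map_filter: "set (List.map_filter f xs) = {y. \<exists>x\<in>set xs. f x = Some y}"
  by (auto simp: List.map_filter_def) force

lemma map_filter_bind:
  "List.map_filter g (List.map_filter f xs) = List.map_filter (\<lambda>x. Option.bind (f x) g) xs"
  by (induction xs) (auto simp: map_filter_simps split: option.splits)

lemma clauses_fix_vars: "clauses (fix_vars \<tau> xs \<Phi>) = List.map_filter (fix_clauses \<tau> xs) (clauses \<Phi>)"
proof (induction xs arbitrary: \<Phi>)
  case Nil
  then show ?case by (simp add: fix_vars_def List.map_filter_def)
next
  case (Cons x xs)
  have "clauses (fix_vars \<tau> (x # xs) \<Phi>) = clauses (fix_vars \<tau> xs (fix_var x (\<tau> x) \<Phi>))"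
    by (simp add: fix_vars_def)
  then show ?case unfolding Cons.IH by (simp add: fix_var_def map_filter_bind)
qed

lemma cvars_fix_clause: "fix_clause x b C = Some C' \<Longrightarrow> cvars C' \<subseteq> cvars C"
  by (cases C) (auto simp: fix_clause_def Let_def split: if_splits sign.splits)

lemma cvars_fix_clauses: "fix_clauses \<tau> xs C = Some C' \<Longrightarrow> cvars C' \<subseteq> cvars C"
proof (induction xs arbitrary: C)
  case (Cons x xs)
  then obtain C'' where "fix_clause x (\<tau> x) C = Some C''" "fix_clauses \<tau> xs C'' = Some C'"
    by (auto simp: bind_eq_Some_conv)
  then show ?case using Cons.IH cvars_fix_clause by blast
qed simp

lemma fix_clauses_cong:
  assumes "\<And>x. x \<in> set xs \<Longrightarrow> x \<in> cvars C \<Longrightarrow> \<tau> x = \<tau>' x"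
  shows "fix_clauses \<tau> xs C = fix_clauses \<tau>' xs C"
  using assms
proof (induction xs arbitrary: C)
  case (Cons x xs)
  have "fix_clause x (\<tau> x) C = fix_clause x (\<tau>' x) C"
    using Cons.prems[of x] by (cases "x \<in> cvars C") (auto simp: fix_clause_def split: prod.splits)
  moreover have "fix_clauses \<tau> xs C' = fix_clauses \<tau>' xs C'" if "fix_clause x (\<tau>' x) C = Some C'" for C'
    using cvars_fix_clause[OF that] Cons.prems by (intro Cons.IH) auto
  ultimately show ?case by (auto intro!: Option.bind_cong)
qed simp

lemma fix_clause_flip: "fix_clause x (\<not> b) (flip_clause C) = map_option flip_clause (fix_clause x b C)"
  by (cases C; cases "snd C") (auto simp: fix_clause_def flip_clause_def Let_def)

lemma fix_clauses_flip:
  "fix_clauses (\<lambda>i. \<not> \<tau> i) xs (flip_clause C) = map_option flip_clause (fix_clauses \<tau> xs C)"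
proof (induction xs arbitrary: C)
  case (Cons x xs)
  then show ?case by (cases "fix_clause x (\<tau> x) C") (auto simp: fix_clause_flip)
qed simp

lemma edges_fix_vars: "e \<in> edges (fix_vars \<tau> xs \<Phi>) \<Longrightarrow> \<exists>e'\<in>edges \<Phi>. e \<subseteq> e'"
proof -
  assume "e \<in> edges (fix_vars \<tau> xs \<Phi>)"
  then obtain C C' where "C \<in> set (clauses \<Phi>)" "fix_clauses \<tau> xs C = Some C'" "e = cvars C'"
    by (auto simp only: edges_def clauses_fix_vars set_map_filter)
  then have "e \<subseteq> cvars C" "cvars C \<in> edges \<Phi>"
    using cvars_fix_clauses by (simp_all add: edges_def del: split_paired_All)
  then show ?thesis by blast
qed

lemma hball_fix_vars: "hball (edges (fix_vars \<tau> xs \<Phi>)) k W \<subseteq> hball (edges \<Phi>) k W"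
proof (induction k)
  case (Suc k)
  then show ?case using edges_fix_vars[of _ \<tau> xs \<Phi>]
    by (fastforce simp: hball_Suc expand_def)
qed simp

lemma expand_edges: "expand (edges \<Phi>) V = V \<union> (\<Union>C\<in>touching \<Phi> V. cvars C)"
  by (auto simp: expand_def edges_def touching_def)

text \<open>The ball in the reduced instance itself depends on the fixed values. But it lies in the
  ball of the original hypergraph, where a clause meeting radius \<open>k\<close> has all its
  variables within radius \<open>Suc k\<close>. Hence both reduced instances show the same clauses,
  and the balls coincide by induction on the radius.\<close>

lemma bp_prob_cong:
  assumes "\<And>i. i \<in> set xs \<Longrightarrow> i \<in> hball (edges \<Phi>) (Suc k) {x} \<Longrightarrow> \<tau> i = \<tau>' i"
  shows "bp_prob (2 * Suc k) (fix_vars \<tau> xs \<Phi>) x = bp_prob (2 * Suc k) (fix_vars \<tau>' xs \<Phi>) x"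
proof -
  let ?E = "\<lambda>\<tau>. edges (fix_vars \<tau> xs \<Phi>)" and ?t = "\<lambda>\<tau>. touching (fix_vars \<tau> xs \<Phi>)"
  have sub: "?t \<tau> V \<subseteq> ?t \<tau>' V"
    if agree: "\<And>i. i \<in> set xs \<Longrightarrow> i \<in> hball (edges \<Phi>) (Suc k) {x} \<Longrightarrow> \<tau> i = \<tau>' i"
      and V: "V \<subseteq> hball (edges \<Phi>) k {x}" for \<tau> \<tau>' V
  proof
    fix C assume "C \<in> ?t \<tau> V"
    then obtain C\<^sub>0 where C: "C\<^sub>0 \<in> set (clauses \<Phi>)" "fix_clauses \<tau> xs C\<^sub>0 = Some C" "cvars C \<inter> V \<noteq> {}"
      by (auto simp: touching_def clauses_fix_vars set_map_filter)
    then have "cvars C\<^sub>0 \<inter> hball (edges \<Phi>) k {x} \<noteq> {}"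
      using cvars_fix_clauses[OF C(2)] V by auto
    then have "cvars C\<^sub>0 \<subseteq> hball (edges \<Phi>) (Suc k) {x}"
      using C(1) by (auto simp: hball_Suc expand_def edges_def)
    then have "fix_clauses \<tau> xs C\<^sub>0 = fix_clauses \<tau>' xs C\<^sub>0"
      by (intro fix_clauses_cong agree) auto
    with C(2) have "fix_clauses \<tau>' xs C\<^sub>0 = Some C" by simp
    then show "C \<in> ?t \<tau>' V"
      using C by (auto simp: touching_def clauses_fix_vars set_map_filter)
  qed
  have touching: "?t \<tau> V = ?t \<tau>' V" if "V \<subseteq> hball (edges \<Phi>) k {x}" for V
    using sub[of \<tau> \<tau>', OF _ that] sub[of \<tau>' \<tau>, OF _ that] assms by auto
  have hball_sub: "hball (?E \<tau>) l {x} \<subseteq> hball (edges \<Phi>) k {x}" if "l \<le> k" for l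
    using hball_fix_vars[of \<tau> xs \<Phi> l "{x}"] hball_mono_radius[OF that, of "edges \<Phi>" "{x}"] by (rule order_trans)
  have balls: "hball (?E \<tau>) l {x} = hball (?E \<tau>') l {x}" if "l \<le> Suc k" for l
    using that
  proof (induction l)
    case (Suc l)
    then show ?case using touching[OF hball_sub[of l]] by (simp add: hball_Suc expand_edges)
  qed simp
  have "?t \<tau> (hball (?E \<tau>) k {x}) = ?t \<tau>' (hball (?E \<tau>') k {x})"
    using touching[OF hball_sub[of k]] balls[of k] by simp
  then show ?thesis
    unfolding bp_prob_eq_local_prob using balls[of "Suc k"] by simp
qed

lemma Collect_image_invariant:
  assumes "\<And>x. g (f x) = g x"
  shows "{y \<in> f ` A. g y \<inter> V \<noteq> {}} = f ` {x \<in> A. g x \<inter> V \<noteq> {}}"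
  using assms by auto

text \<open>Unreduced clauses are invariant under \<open>flip_clause\<close>, so complementing the
  fixed values only exchanges signs in the reduced instance; its edges, and hence its balls, stay
  the same.\<close>

lemma bp_prob_flip:
  assumes "\<And>C. C \<in> set (clauses \<Phi>) \<Longrightarrow> snd C = Zero \<and> finite (fst C)"
  shows "bp_prob (2 * Suc k) (fix_vars (\<lambda>i. \<not> \<tau> i) xs \<Phi>) x = 1 - bp_prob (2 * Suc k) (fix_vars \<tau> xs \<Phi>) x"
proof -
  let ?\<Psi> = "fix_vars \<tau> xs \<Phi>" and ?\<Psi>' = "fix_vars (\<lambda>i. \<not> \<tau> i) xs \<Phi>"
  have "flip_clause C = C" if "C \<in> set (clauses \<Phi>)" for C
    using assms[OF that] by (cases C) (simp add: flip_clause_def)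
  then have "fix_clauses (\<lambda>i. \<not> \<tau> i) xs C = map_option flip_clause (fix_clauses \<tau> xs C)"
    if "C \<in> set (clauses \<Phi>)" for C
    using that fix_clauses_flip[of \<tau> xs C] by simp
  then have "set (clauses ?\<Psi>') = {y. \<exists>C\<in>set (clauses \<Phi>). map_option flip_clause (fix_clauses \<tau> xs C) = Some y}"
    unfolding clauses_fix_vars set_map_filter by simp
  also have "\<dots> = flip_clause ` {C'. \<exists>C\<in>set (clauses \<Phi>). fix_clauses \<tau> xs C = Some C'}"
    unfolding map_option_eq_Some by blast
  finally have cl: "set (clauses ?\<Psi>') = flip_clause ` set (clauses ?\<Psi>)"
    by (simp only: clauses_fix_vars set_map_filter)
  then have e: "edges ?\<Psi>' = edges ?\<Psi>"
    by (simp add: edges_def image_image)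
  have t: "touching ?\<Psi>' V = flip_clause ` touching ?\<Psi> V" for V
    unfolding touching_def cl by (rule Collect_image_invariant) simp
  show ?thesis
    unfolding bp_prob_eq_local_prob e t
  proof (rule local_prob_flip)
    have fin: "finite e" if e: "e \<in> edges ?\<Psi>" for e
    proof -
      obtain C where "C \<in> set (clauses \<Phi>)" "e \<subseteq> cvars C"
        using edges_fix_vars[OF e] by (auto simp only: edges_def)
      then show ?thesis using assms[of C] by (meson finite_imageI finite_subset)
    qed
    then show "finite (hball (edges ?\<Psi>) (Suc k) {x})"
      by (intro finite_hball) (simp_all add: edges_def)
    show "x \<in> hball (edges ?\<Psi>) (Suc k) {x}" by (rule subsetD[OF hball_increasing]) simp
    show "cvars C \<subseteq> hball (edges ?\<Psi>) (Suc k) {x}" if "C \<in> touching ?\<Psi> (hball (edges ?\<Psi>) k {x})" for C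
      using that by (auto simp: hball_Suc expand_edges)
  qed
qed

section \<open>Decimation as a symmetric local process\<close>

definition decimation_prob :: "nat \<Rightarrow> inst \<Rightarrow> nat \<Rightarrow> (nat \<Rightarrow> bool) \<Rightarrow> real" where
  "decimation_prob r \<Phi> x \<tau> = bp_prob r (fix_vars \<tau> [1..<x] \<Phi>) x"

lemma decimation_prob_process:
  assumes "\<And>C. C \<in> set (clauses \<Phi>) \<Longrightarrow> snd C = Zero \<and> finite (fst C)"
  shows "symmetric_local_process n (decimation_prob (2 * Suc k) \<Phi>) (\<lambda>x. hball (edges \<Phi>) (Suc k) {x})"
proof
  fix x :: nat and \<tau> :: "nat \<Rightarrow> bool"
  show "0 \<le> decimation_prob (2 * Suc k) \<Phi> x \<tau>" "decimation_prob (2 * Suc k) \<Phi> x \<tau> \<le> 1"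
    unfolding decimation_prob_def bp_prob_eq_local_prob by (rule local_prob_range)+
  show "decimation_prob (2 * Suc k) \<Phi> x (\<lambda>i. \<not> \<tau> i) = 1 - decimation_prob (2 * Suc k) \<Phi> x \<tau>"
    unfolding decimation_prob_def by (rule bp_prob_flip) (rule assms)
next
  fix x :: nat and \<tau> \<tau>' :: "nat \<Rightarrow> bool"
  assume "\<And>i. i \<in> hball (edges \<Phi>) (Suc k) {x} \<Longrightarrow> 1 \<le> i \<Longrightarrow> i < x \<Longrightarrow> \<tau> i = \<tau>' i"
  then show "decimation_prob (2 * Suc k) \<Phi> x \<tau> = decimation_prob (2 * Suc k) \<Phi> x \<tau>'"
    unfolding decimation_prob_def by (intro bp_prob_cong) auto
qed

lemma finite_set_decimate: "finite (set_pmf (decimate r \<Phi> xs))"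
  by (induction xs arbitrary: \<Phi>) auto

lemma bp_prob_range: "0 \<le> bp_prob r \<Phi> x" "bp_prob r \<Phi> x \<le> 1"
proof -
  have "bp_prob r \<Phi> x = local_prob (vars (nbhd \<Phi> x r)) (set (clauses (nbhd \<Phi> x r))) x"
    by (simp add: bp_prob_def local_prob_def solutions_def)
  then show "0 \<le> bp_prob r \<Phi> x" "bp_prob r \<Phi> x \<le> 1" by (simp_all add: local_prob_range)
qed

text \<open>This carries the estimates for \<open>run_mean\<close> over to the algorithm. The output
  of \<open>decimate\<close> is \<open>undefined\<close> at the variables fixed before
  \<open>j\<close>, so it is merged with the past \<open>\<tau>\<close> before \<open>h\<close> is
  applied.\<close>

lemma expectation_decimate:
  assumes "1 \<le> j" "j \<le> Suc n"
  shows "measure_pmf.expectation (decimate r (fix_vars \<tau> [1..<j] \<Phi>) [j..<Suc n])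
      (\<lambda>\<sigma>. h (\<lambda>i. if i \<in> {j..n} then \<sigma> i else \<tau> i)) = run_mean (decimation_prob r \<Phi>) [j..<Suc n] h \<tau>"
  using assms(2,1)
proof (induction j arbitrary: \<tau> rule: inc_induct)
  case base
  then show ?case by simp
next
  case (step j)
  let ?q = "bp_prob r (fix_vars \<tau> [1..<j] \<Phi>) j"
  let ?dec = "\<lambda>b. decimate r (fix_var j b (fix_vars \<tau> [1..<j] \<Phi>)) [Suc j..<Suc n]"
  let ?g = "\<lambda>\<sigma>. h (\<lambda>i. if i \<in> {j..n} then \<sigma> i else \<tau> i)"
  have fixed: "fix_var j b (fix_vars \<tau> [1..<j] \<Phi>) = fix_vars (\<tau>(j := b)) [1..<Suc j] \<Phi>" for b
  proof -
    have "fold (\<lambda>x. fix_var x (\<tau> x)) [1..<j] \<Phi> = fold (\<lambda>x. fix_var x ((\<tau>(j := b)) x)) [1..<j] \<Phi>"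
      by (rule fold_cong) auto
    then show ?thesis using step by (simp add: fix_vars_def)
  qed
  have upd: "?g (\<sigma>(j := b)) = h (\<lambda>i. if i \<in> {Suc j..n} then \<sigma> i else (\<tau>(j := b)) i)" for \<sigma> b
    using step by (intro arg_cong[where f = h]) auto
  have IH: "measure_pmf.expectation (?dec b) (\<lambda>\<sigma>. ?g (\<sigma>(j := b))) = run_mean (decimation_prob r \<Phi>) [Suc j..<Suc n] h (\<tau>(j := b))" for b
    unfolding upd fixed using step by (intro step.IH) auto
  have IH': "measure_pmf.expectation (map_pmf (\<lambda>\<sigma>. \<sigma>(j := b)) (?dec b)) ?g
      = run_mean (decimation_prob r \<Phi>) [Suc j..<Suc n] h (\<tau>(j := b))" for b
    by (simp only: integral_map_pmf IH)
  have "measure_pmf.expectation (decimate r (fix_vars \<tau> [1..<j] \<Phi>) [j..<Suc n]) ?g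
    = measure_pmf.expectation (bernoulli_pmf ?q \<bind> (\<lambda>b. map_pmf (\<lambda>\<sigma>. \<sigma>(j := b)) (?dec b))) ?g"
    using step by (simp add: upt_conv_Cons map_pmf_def del: upt_Suc)
  also have "\<dots> = (\<Sum>b\<in>UNIV. pmf (bernoulli_pmf ?q) b *\<^sub>R measure_pmf.expectation (map_pmf (\<lambda>\<sigma>. \<sigma>(j := b)) (?dec b)) ?g)"
    by (rule pmf_expectation_bind) (auto simp: finite_set_decimate)
  also have "\<dots> = ?q * run_mean (decimation_prob r \<Phi>) [Suc j..<Suc n] h (\<tau>(j := True))
      + (1 - ?q) * run_mean (decimation_prob r \<Phi>) [Suc j..<Suc n] h (\<tau>(j := False))"
    unfolding IH' by (simp add: UNIV_bool bp_prob_range del: upt_Suc)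
  also have "\<dots> = run_mean (decimation_prob r \<Phi>) [j..<Suc n] h \<tau>"
    using step by (simp add: upt_conv_Cons decimation_prob_def del: upt_Suc)
  finally show ?case .
qed

section \<open>Balls in random hypergraphs\<close>

definition avg :: "'a set \<Rightarrow> ('a \<Rightarrow> real) \<Rightarrow> real" where
  "avg A f = (\<Sum>x\<in>A. f x) / card A"

primrec list_avg :: "'a set \<Rightarrow> nat \<Rightarrow> ('a list \<Rightarrow> real) \<Rightarrow> real" where
  "list_avg A 0 f = f []"
| "list_avg A (Suc m) f = avg A (\<lambda>x. list_avg A m (\<lambda>xs. f (x # xs)))"

lemma avg_add: "avg A (\<lambda>x. f x + g x) = avg A f + avg A g"
  by (simp add: avg_def sum.distrib add_divide_distrib)

lemma avg_cmult: "avg A (\<lambda>x. c * f x) = c * avg A f"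
  by (simp add: avg_def sum_distrib_left)

lemma avg_multc: "avg A (\<lambda>x. f x * c) = avg A f * c"
  by (simp add: avg_def sum_distrib_right)

lemma avg_mono: "(\<And>x. x \<in> A \<Longrightarrow> f x \<le> g x) \<Longrightarrow> avg A f \<le> avg A g"
  by (simp add: avg_def sum_mono divide_right_mono)

lemma avg_cong: "(\<And>x. x \<in> A \<Longrightarrow> f x = g x) \<Longrightarrow> avg A f = avg A g"
  by (simp add: avg_def)

lemma avg_const: "finite A \<Longrightarrow> A \<noteq> {} \<Longrightarrow> avg A (\<lambda>_. c) = c"
  by (simp add: avg_def)

lemma avg_list_avg_swap:
  "avg B (\<lambda>y. list_avg A m (\<lambda>xs. f y xs)) = list_avg A m (\<lambda>xs. avg B (\<lambda>y. f y xs))"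
proof (induction m arbitrary: f)
  case (Suc m)
  have "avg B (\<lambda>y. avg A (\<lambda>x. list_avg A m (\<lambda>xs. f y (x # xs))))
      = avg A (\<lambda>x. avg B (\<lambda>y. list_avg A m (\<lambda>xs. f y (x # xs))))"
    unfolding avg_def sum_divide_distrib by (subst sum.swap) (simp add: field_simps)
  then show ?case by (simp add: Suc)
qed simp

lemma list_avg_add: "list_avg A m (\<lambda>x. f x + g x) = list_avg A m f + list_avg A m g"
  by (induction m arbitrary: f g) (simp_all add: avg_add)

lemma list_avg_cmult: "list_avg A m (\<lambda>x. c * f x) = c * list_avg A m f"
  by (induction m arbitrary: f) (simp_all add: avg_cmult)

lemma list_avg_sum: "list_avg A m (\<lambda>x. \<Sum>i\<in>I. f i x) = (\<Sum>i\<in>I. list_avg A m (f i))"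
proof (induction I rule: infinite_finite_induct)
  case (infinite I)
  then show ?case using list_avg_cmult[of A m 0] by simp
next
  case empty
  then show ?case using list_avg_cmult[of A m 0] by simp
next
  case (insert i I)
  then show ?case by (simp add: list_avg_add)
qed

lemma list_avg_mono:
  "(\<And>xs. set xs \<subseteq> A \<Longrightarrow> length xs = m \<Longrightarrow> f xs \<le> g xs) \<Longrightarrow> list_avg A m f \<le> list_avg A m g"
  by (induction m arbitrary: f g) (auto intro!: avg_mono)

lemma list_avg_cong:
  "(\<And>xs. set xs \<subseteq> A \<Longrightarrow> length xs = m \<Longrightarrow> f xs = g xs) \<Longrightarrow> list_avg A m f = list_avg A m g"
  by (rule antisym) (auto intro!: list_avg_mono)

lemma list_avg_const: "finite A \<Longrightarrow> A \<noteq> {} \<Longrightarrow> list_avg A m (\<lambda>_. c) = c"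
  by (induction m) (simp_all add: avg_const)

lemma list_avg_bij:
  assumes "bij_betw h A A"
  shows "list_avg A m (\<lambda>xs. f (map h xs)) = list_avg A m f"
proof (induction m arbitrary: f)
  case (Suc m)
  have "avg A (\<lambda>x. list_avg A m (\<lambda>xs. f (h x # map h xs))) = avg A (\<lambda>x. list_avg A m (\<lambda>xs. f (h x # xs)))"
    using Suc[of "\<lambda>xs. f (h x # xs)" for x] by simp
  also have "\<dots> = avg A (\<lambda>x. list_avg A m (\<lambda>xs. f (x # xs)))"
    unfolding avg_def by (subst sum.reindex_bij_betw[OF assms, of "\<lambda>x. list_avg A m (\<lambda>xs. f (x # xs))"]) rule
  finally show ?case by simp
qed simp

text \<open>Conditioning on which entries satisfy \<open>T\<close>. The conditioning on the other entries not
  satisfying \<open>T\<close> is simply dropped, which only increases the bound.\<close>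

lemma list_avg_filter_le:
  assumes "finite A" "A \<noteq> {}" "0 \<le> a" "0 \<le> y" "\<And>as bs. 0 \<le> h as bs"
    and h: "\<And>as j. set as \<subseteq> {x \<in> A. T x} \<Longrightarrow> j + length as \<le> m \<Longrightarrow> list_avg A j (h as) \<le> a * y ^ length as"
  shows "list_avg A m (\<lambda>xs. h (filter T xs) (filter (\<lambda>x. \<not> T x) xs)) \<le> a * (1 + avg A (\<lambda>x. of_bool (T x)) * y) ^ m"
  using assms(3,5,6)
proof (induction m arbitrary: a h)
  case 0
  then show ?case using 0(3)[of "[]" 0] by simp
next
  case (Suc m)
  let ?q = "avg A (\<lambda>x. of_bool (T x))" and ?nT = "\<lambda>x. \<not> T x"
  let ?E = "\<lambda>g. list_avg A m (\<lambda>xs. g (filter T xs) (filter ?nT xs))"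
  let ?h = "\<lambda>as bs. avg A (\<lambda>x. h as (x # bs))"
  have q: "0 \<le> ?q" unfolding avg_def by (intro divide_nonneg_nonneg sum_nonneg) auto
  have 1: "?E (\<lambda>as. h (x # as)) \<le> (a * y) * (1 + ?q * y) ^ m" if "x \<in> A" "T x" for x
  proof (rule Suc.IH)
    fix as j assume "set as \<subseteq> {x \<in> A. T x}" "j + length as \<le> m"
    then show "list_avg A j (h (x # as)) \<le> a * y * y ^ length as"
      using Suc.prems(3)[of "x # as" j] that by (simp add: mult_ac)
  qed (use Suc.prems assms in auto)
  have 2: "?E ?h \<le> a * (1 + ?q * y) ^ m"
  proof (rule Suc.IH)
    fix as j assume "set as \<subseteq> {x \<in> A. T x}" "j + length as \<le> m"
    then have "list_avg A (Suc j) (h as) \<le> a * y ^ length as"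
      by (intro Suc.prems) auto
    then show "list_avg A j (?h as) \<le> a * y ^ length as" by (simp add: avg_list_avg_swap)
  next
    show "0 \<le> ?h as bs" for as bs
      unfolding avg_def using Suc.prems(2) by (intro divide_nonneg_nonneg sum_nonneg) auto
  qed (use Suc.prems in auto)
  have "list_avg A (Suc m) (\<lambda>xs. h (filter T xs) (filter ?nT xs))
    = avg A (\<lambda>x. if T x then ?E (\<lambda>as. h (x # as)) else ?E (\<lambda>as bs. h as (x # bs)))"
    by (auto intro: avg_cong)
  also have "\<dots> \<le> avg A (\<lambda>x. of_bool (T x) * ((a * y) * (1 + ?q * y) ^ m) + ?E (\<lambda>as bs. h as (x # bs)))"
  proof (rule avg_mono)
    fix x assume x: "x \<in> A"
    have "0 \<le> list_avg A m (\<lambda>_. 0)" using list_avg_const[of A m 0] assms by simp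
    also have "\<dots> \<le> ?E (\<lambda>as bs. h as (x # bs))" using Suc.prems(2) by (intro list_avg_mono) auto
    finally show "(if T x then ?E (\<lambda>as. h (x # as)) else ?E (\<lambda>as bs. h as (x # bs)))
      \<le> of_bool (T x) * ((a * y) * (1 + ?q * y) ^ m) + ?E (\<lambda>as bs. h as (x # bs))"
      using 1[OF x] by auto
  qed
  also have "\<dots> = ?q * ((a * y) * (1 + ?q * y) ^ m) + ?E ?h"
    by (simp only: avg_add avg_multc avg_list_avg_swap)
  also have "\<dots> \<le> ?q * ((a * y) * (1 + ?q * y) ^ m) + a * (1 + ?q * y) ^ m"
    using 2 by simp
  also have "\<dots> = a * (1 + ?q * y) ^ Suc m" by (simp add: algebra_simps)
  finally show ?case .
qed

section \<open>Exponential moments of ball sizes\<close>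

text \<open>Edges already swallowed by the starting set have no further effect on the
  exploration.\<close>

lemma hball_Un_inside:
  assumes "\<Union>E \<subseteq> W"
  shows "hball (E \<union> E') k W = hball E' k W"
proof (induction k)
  case (Suc k)
  have "W \<subseteq> hball E' k W" by (rule hball_increasing)
  then have "expand (E \<union> E') (hball E' k W) = expand E' (hball E' k W)"
    using assms by (auto simp: expand_def)
  then show ?case by (simp add: hball_Suc Suc)
qed simp

definition ksubsets :: "nat \<Rightarrow> nat \<Rightarrow> nat set set" where
  "ksubsets K n = {V. V \<subseteq> {1..n} \<and> card V = K}"

lemma finite_ksubsets: "finite (ksubsets K n)"
  unfolding ksubsets_def by (rule finite_subset[of _ "Pow {1..n}"]) auto

lemma card_ksubsets: "card (ksubsets K n) = n choose K"
  unfolding ksubsets_def using n_subsets[of "{1..n}" K] by simp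

lemma ksubsets_nonempty: "K \<le> n \<Longrightarrow> ksubsets K n \<noteq> {}"
  using card_ksubsets[of K n] by (metis card.empty not_less zero_less_binomial_iff binomial_eq_0_iff)

lemma ksubsets_member_prob:
  assumes "x \<in> {1..n}" "K \<le> n"
  shows "avg (ksubsets K n) (\<lambda>e. of_bool (x \<in> e)) = K / n"
proof (cases "K = 0")
  case True
  have "finite e \<Longrightarrow> card e = 0 \<Longrightarrow> x \<notin> e" for e by auto
  then have "avg (ksubsets K n) (\<lambda>e. of_bool (x \<in> e)) = avg (ksubsets K n) (\<lambda>e. 0)"
    using True by (intro avg_cong) (auto simp: ksubsets_def dest: finite_subset)
  then show ?thesis using True by (simp add: avg_def)
next
  case False
  have "{e \<in> ksubsets K n. x \<in> e} = insert x ` {V. V \<subseteq> {1..n} - {x} \<and> card V = K - 1}"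
  proof (intro set_eqI iffI)
    fix e assume "e \<in> {e \<in> ksubsets K n. x \<in> e}"
    then have e: "e \<subseteq> {1..n}" "card e = K" "x \<in> e" by (auto simp: ksubsets_def)
    then have "finite e" using finite_subset by blast
    then have "e = insert x (e - {x})" "card (e - {x}) = K - 1" using e by auto
    then show "e \<in> insert x ` {V. V \<subseteq> {1..n} - {x} \<and> card V = K - 1}" using e by blast
  next
    fix e assume "e \<in> insert x ` {V. V \<subseteq> {1..n} - {x} \<and> card V = K - 1}"
    then obtain V where V: "e = insert x V" "V \<subseteq> {1..n} - {x}" "card V = K - 1" by auto
    then have "finite V" "x \<notin> V" using finite_subset[OF V(2)] by auto
    then show "e \<in> {e \<in> ksubsets K n. x \<in> e}" using V assms False by (auto simp: ksubsets_def)
  qed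
  moreover have "inj_on (insert x) {V. V \<subseteq> {1..n} - {x} \<and> card V = K - 1}"
    by (rule inj_onI) (auto simp: insert_eq_iff)
  ultimately have "card {e \<in> ksubsets K n. x \<in> e} = (n - 1) choose (K - 1)"
    using n_subsets[of "{1..n} - {x}" "K - 1"] assms by (simp add: card_image)
  then have "avg (ksubsets K n) (\<lambda>e. of_bool (x \<in> e)) = real ((n - 1) choose (K - 1)) / (n choose K)"
    using finite_ksubsets[of K n] by (simp add: avg_def card_ksubsets Int_def)
  also have "\<dots> = K / n"
  proof -
    have "K * (n choose K) = n * ((n - 1) choose (K - 1))"
      using False assms binomial_absorption[of "K - 1" n] by simp
    then have "real K * real (n choose K) = real n * real ((n - 1) choose (K - 1))"
      by (metis of_nat_mult)
    moreover have "real (n choose K) \<noteq> 0" using assms by simp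
    ultimately show ?thesis using assms by (simp add: field_simps)
  qed
  finally show ?thesis .
qed

lemma ksubsets_touch_prob:
  assumes "W \<subseteq> {1..n}" "K \<le> n"
  shows "avg (ksubsets K n) (\<lambda>e. of_bool (e \<inter> W \<noteq> {})) \<le> card W * (K / n)"
proof -
  have W: "finite W" using assms finite_subset by blast
  have "avg (ksubsets K n) (\<lambda>e. of_bool (e \<inter> W \<noteq> {})) \<le> avg (ksubsets K n) (\<lambda>e. \<Sum>x\<in>W. of_bool (x \<in> e))"
  proof (rule avg_mono)
    fix e
    show "of_bool (e \<inter> W \<noteq> {}) \<le> (\<Sum>x\<in>W. of_bool (x \<in> e) :: real)"
    proof (cases "e \<inter> W = {}")
      case False
      then obtain x where "x \<in> W" "x \<in> e" by blast
      then show ?thesis using member_le_sum[of x W "\<lambda>x. of_bool (x \<in> e) :: real"] W by auto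
    qed (simp add: sum_nonneg)
  qed
  also have "\<dots> = (\<Sum>x\<in>W. avg (ksubsets K n) (\<lambda>e. of_bool (x \<in> e)))"
    unfolding avg_def sum_divide_distrib by (rule sum.swap)
  also have "\<dots> = (\<Sum>x\<in>W. K / n)" using assms by (intro sum.cong ksubsets_member_prob) auto
  finally show ?thesis by simp
qed

text \<open>Exponents of the moment bounds: one further step of the exploration replaces the weight
  \<open>exp g\<close> of a vertex by \<open>exp (g + c * exp (K * g))\<close>, where \<open>c\<close> bounds the mean degree.\<close>

primrec ball_exponent :: "nat \<Rightarrow> real \<Rightarrow> real \<Rightarrow> nat \<Rightarrow> real" where
  "ball_exponent K c \<theta> 0 = \<theta>"
| "ball_exponent K c \<theta> (Suc k) = ball_exponent K c \<theta> k + c * exp (K * ball_exponent K c \<theta> k)"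

lemma ball_exponent_nonneg:
  fixes c \<theta> :: real
  shows "0 \<le> c \<Longrightarrow> 0 \<le> \<theta> \<Longrightarrow> 0 \<le> ball_exponent K c \<theta> k"
  by (induction k) auto

text \<open>One step of exploration exposes the edges meeting \<open>W\<close>; they join the
  starting set, and the other edges are explored to radius \<open>k\<close>. So the induction needs
  arbitrary starting sets. \<open>M\<close> stays fixed while exposed edges use up \<open>m\<close>,
  so that one bound \<open>c\<close> serves at every radius.\<close>

lemma hball_exp_moment:
  fixes c \<theta> :: real
  assumes K: "K \<le> n" and n: "0 < n" and \<theta>: "0 \<le> \<theta>" and c: "real M * K / n \<le> c"
    and W: "W \<subseteq> {1..n}" and m: "m \<le> M"
  shows "list_avg (ksubsets K n) m (\<lambda>es. exp (\<theta> * card (hball (set es) k W))) \<le> exp (ball_exponent K c \<theta> k * card W)"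
  using W m
proof (induction k arbitrary: W m)
  case 0
  then show ?case using list_avg_const[OF finite_ksubsets ksubsets_nonempty[OF K]] by simp
next
  case (Suc k)
  let ?A = "ksubsets K n" and ?g = "ball_exponent K c \<theta> k"
  let ?T = "\<lambda>e. e \<inter> W \<noteq> {}" and ?q = "avg (ksubsets K n) (\<lambda>e. of_bool (e \<inter> W \<noteq> {}))"
  let ?h = "\<lambda>as bs. exp (\<theta> * card (hball (set bs) k (W \<union> \<Union>(set as))))"
  have "0 \<le> real M * K / n" by simp
  with c have c0: "0 \<le> c" by linarith
  note g = ball_exponent_nonneg[OF c0 \<theta>, of K k]
  have W: "finite W" using Suc.prems finite_subset by blast
  have q: "0 \<le> ?q" unfolding avg_def by (intro divide_nonneg_nonneg sum_nonneg) auto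
  have "list_avg ?A m (\<lambda>es. exp (\<theta> * card (hball (set es) (Suc k) W)))
    = list_avg ?A m (\<lambda>es. ?h (filter ?T es) (filter (\<lambda>e. \<not> ?T e) es))"
  proof (rule list_avg_cong)
    fix es
    have "set es = set (filter ?T es) \<union> set (filter (\<lambda>e. \<not> ?T e) es)" by auto
    then have "hball (set es) k (W \<union> \<Union>(set (filter ?T es)))
        = hball (set (filter (\<lambda>e. \<not> ?T e) es)) k (W \<union> \<Union>(set (filter ?T es)))"
      by (metis hball_Un_inside Un_upper2)
    moreover have "expand (set es) W = W \<union> \<Union>(set (filter ?T es))"
      by (simp add: expand_def)
    ultimately show "exp (\<theta> * card (hball (set es) (Suc k) W)) = ?h (filter ?T es) (filter (\<lambda>e. \<not> ?T e) es)"
      by (simp only: hball_Suc')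
  qed
  also have "\<dots> \<le> exp (?g * card W) * (1 + ?q * exp (K * ?g)) ^ m"
  proof (rule list_avg_filter_le)
    fix as j assume as: "set as \<subseteq> {e \<in> ?A. ?T e}" and j: "j + length as \<le> m"
    have "card (W \<union> \<Union>(set as)) \<le> card W + K * length as"
    proof -
      have "card (\<Union>(set as)) \<le> (\<Sum>e\<in>set as. card e)" by (rule card_Union_le_sum_card)
      also have "\<dots> = (\<Sum>e\<in>set as. K)" using as by (intro sum.cong) (auto simp: ksubsets_def)
      also have "\<dots> \<le> K * length as" using card_length[of as] by simp
      finally show ?thesis using card_Un_le[of W "\<Union>(set as)"] by linarith
    qed
    then have le: "real (card (W \<union> \<Union>(set as))) \<le> card W + K * length as" by (metis of_nat_le_iff of_nat_add of_nat_mult)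
    have "list_avg ?A j (?h as) \<le> exp (?g * card (W \<union> \<Union>(set as)))"
      using as j Suc.prems by (intro Suc.IH) (auto simp: ksubsets_def)
    also have "\<dots> \<le> exp (?g * (card W + K * length as))"
      using mult_left_mono[OF le g] by simp
    also have "\<dots> = exp (?g * card W) * exp (K * ?g) ^ length as"
      by (simp add: exp_add[symmetric] exp_of_nat_mult[symmetric] algebra_simps)
    finally show "list_avg ?A j (?h as) \<le> exp (?g * card W) * exp (K * ?g) ^ length as" .
  qed (use finite_ksubsets ksubsets_nonempty[OF K] in auto)
  also have "\<dots> \<le> exp (?g * card W) * exp (?q * exp (K * ?g)) ^ m"
    using q by (intro mult_left_mono power_mono) (auto intro!: add_nonneg_nonneg)
  also have "\<dots> = exp (?g * card W + m * (?q * exp (K * ?g)))"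
    by (simp add: exp_add exp_of_nat_mult)
  also have "\<dots> \<le> exp (?g * card W + c * card W * exp (K * ?g))"
  proof -
    have "real m * ?q \<le> real M * (card W * (K / n))"
      using Suc.prems q ksubsets_touch_prob[OF Suc.prems(1) K] by (intro mult_mono) auto
    also have "\<dots> \<le> c * card W"
      using mult_right_mono[OF c, of "real (card W)"] by (simp add: mult_ac)
    finally show ?thesis by (simp add: mult_right_mono mult.assoc[symmetric])
  qed
  also have "\<dots> = exp (ball_exponent K c \<theta> (Suc k) * card W)"
    by (simp add: algebra_simps)
  finally show ?case .
qed

section \<open>Increasing chains\<close>

text \<open>A pair of vertices reached from \<open>v\<close> is generated from \<open>(v, v)\<close> by moving either its first
  (code 0) or its second component (code 1), or both together (code 2), always to a vertex larger
  than all previous ones. Hence the vertices visited form a single increasing list.\<close>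

definition tip :: "nat \<Rightarrow> 'a \<times> 'a \<Rightarrow> 'a" where
  "tip c t = (if c = 1 then snd t else fst t)"

definition move :: "nat \<Rightarrow> 'a \<Rightarrow> 'a \<times> 'a \<Rightarrow> 'a \<times> 'a" where
  "move c w t = (if c = 0 then (w, snd t) else if c = 1 then (fst t, w) else (w, w))"

primrec valid_moves :: "('a \<Rightarrow> 'a \<Rightarrow> bool) \<Rightarrow> 'a \<times> 'a \<Rightarrow> (nat \<times> 'a) list \<Rightarrow> bool" where
  "valid_moves R t [] = True"
| "valid_moves R t (m # ms) = (R (tip (fst m) t) (snd m) \<and> valid_moves R (move (fst m) (snd m) t) ms)"

primrec apply_moves :: "'a \<times> 'a \<Rightarrow> (nat \<times> 'a) list \<Rightarrow> 'a \<times> 'a" where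
  "apply_moves t [] = t"
| "apply_moves t (m # ms) = apply_moves (move (fst m) (snd m) t) ms"

lemma apply_moves_append: "apply_moves t (ms @ [m]) = move (fst m) (snd m) (apply_moves t ms)"
  by (induction ms arbitrary: t) auto

lemma valid_moves_append:
  "valid_moves R t (ms @ [m]) \<longleftrightarrow> valid_moves R t ms \<and> R (tip (fst m) (apply_moves t ms)) (snd m)"
  by (induction ms arbitrary: t) auto

text \<open>Codes and vertices are kept in separate lists, so that a permutation of the vertices
  acts on the second list alone.\<close>

definition walk :: "('a \<Rightarrow> 'a \<Rightarrow> bool) \<Rightarrow> nat list \<Rightarrow> 'a list \<Rightarrow> bool" where
  "walk R cs ws = valid_moves R (hd ws, hd ws) (zip cs (tl ws))"

definition codes :: "nat \<Rightarrow> nat list set" where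
  "codes l = {cs. set cs \<subseteq> {0, 1, 2} \<and> length cs = l}"

definition increasing_lists :: "nat \<Rightarrow> nat \<Rightarrow> nat list set" where
  "increasing_lists n l = {ws. set ws \<subseteq> {1..n} \<and> length ws = Suc l \<and> sorted_wrt (<) ws}"

definition distinct_lists :: "nat \<Rightarrow> nat \<Rightarrow> nat list set" where
  "distinct_lists n l = {ws. set ws \<subseteq> {1..n} \<and> length ws = Suc l \<and> distinct ws}"

lemma finite_codes: "finite (codes l)"
  unfolding codes_def by (rule finite_lists_length_eq) simp

lemma finite_distinct_lists: "finite (distinct_lists n l)"
  by (rule finite_subset[OF _ finite_lists_length_eq[of "{1..n}" "Suc l"]]) (auto simp: distinct_lists_def)

lemma increasing_subset_distinct: "increasing_lists n l \<subseteq> distinct_lists n l"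
  by (auto simp: increasing_lists_def distinct_lists_def strict_sorted_iff)

lemma finite_increasing_lists: "finite (increasing_lists n l)"
  using finite_subset[OF increasing_subset_distinct finite_distinct_lists] .

context local_process
begin

lemma reach_singleton_cases:
  assumes "j \<in> reach (Suc v) {v}"
  shows "j = v \<or> (v < j \<and> j \<le> n \<and> (\<exists>i\<in>reach (Suc v) {v}. i < j \<and> i \<in> N j))"
  using assms by cases auto

text \<open>Induction on the larger vertex: its last step is undone, leading back to a smaller
  reached vertex, so each move goes beyond everything visited before. Equal vertices are moved
  together from a common predecessor; moving them one after the other would visit the same vertex
  twice, which is why code 2 exists.\<close>

lemma reach_pair_moves:
  assumes "j \<in> reach (Suc v) {v}" "j' \<in> reach (Suc v) {v}"
  shows "\<exists>ms. fst ` set ms \<subseteq> {0, 1, 2} \<and> sorted_wrt (<) (v # map snd ms) \<and>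
    (\<forall>x\<in>snd ` set ms. x \<le> max j j' \<and> v < x \<and> x \<le> n) \<and>
    valid_moves (\<lambda>x y. x \<in> N y) (v, v) ms \<and> apply_moves (v, v) ms = (j, j')"
  using assms
proof (induction "max j j'" arbitrary: j j' rule: less_induct)
  case less
  let ?P = "\<lambda>ms j j'. fst ` set ms \<subseteq> {0, 1, 2} \<and> sorted_wrt (<) (v # map snd ms) \<and>
    (\<forall>x\<in>snd ` set ms. x \<le> max j j' \<and> v < x \<and> x \<le> n) \<and>
    valid_moves (\<lambda>x y. x \<in> N y) (v, v) ms \<and> apply_moves (v, v) ms = (j, j')"
  have extend: "?P (ms @ [(c, w)]) k k'"
    if "?P ms i i'" "max i i' < w" "v < w" "w \<le> n" "tip c (i, i') \<in> N w" "move c w (i, i') = (k, k')"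
      "c \<in> {0, 1, 2}" "max k k' = w" for ms c w i i' k k'
  proof -
    have "sorted_wrt (<) ((v # map snd ms) @ [w])"
      unfolding sorted_wrt_append using that by fastforce
    moreover have "\<forall>x\<in>snd ` set (ms @ [(c, w)]). x \<le> max k k' \<and> v < x \<and> x \<le> n"
      using that by (auto simp: le_less_trans)
    ultimately show ?thesis
      using that by (simp add: valid_moves_append apply_moves_append)
  qed
  have ge: "v \<le> i" if "i \<in> reach (Suc v) {v}" for i
    using reach_singleton_cases[OF that] by auto
  consider "j = v" "j' = v" | "j = j'" "v < j" | "j < j'" | "j' < j"
    using ge less.prems by (metis le_neq_implies_less nat_neq_iff)
  then show ?case
  proof cases
    case 1
    then have "?P [] j j'" by simp
    then show ?thesis by blast
  next
    case 2
    then obtain i where i: "i \<in> reach (Suc v) {v}" "i < j" "i \<in> N j" "j \<le> n"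
      using reach_singleton_cases[OF less.prems(1)] by auto
    then obtain ms where "?P ms i i" using less.hyps[of i i] 2 by auto
    then have "?P (ms @ [(2, j)]) j j'"
      using i 2 by (intro extend[of ms i i]) (simp_all add: tip_def move_def)
    then show ?thesis by blast
  next
    case 3
    then obtain i where i: "i \<in> reach (Suc v) {v}" "i < j'" "i \<in> N j'" "j' \<le> n" "v < j'"
      using reach_singleton_cases[OF less.prems(2)] ge[OF less.prems(1)] by auto
    then obtain ms where "?P ms j i" using less.hyps[of j i] less.prems(1) 3 by auto
    then have "?P (ms @ [(1, j')]) j j'"
      using i 3 by (intro extend[of ms j i]) (simp_all add: tip_def move_def)
    then show ?thesis by blast
  next
    case 4
    then obtain i where i: "i \<in> reach (Suc v) {v}" "i < j" "i \<in> N j" "j \<le> n" "v < j"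
      using reach_singleton_cases[OF less.prems(1)] ge[OF less.prems(2)] by auto
    then obtain ms where "?P ms i j'" using less.hyps[of i j'] less.prems(2) 4 by auto
    then have "?P (ms @ [(0, j)]) j j'"
      using i 4 by (intro extend[of ms i j']) (simp_all add: tip_def move_def)
    then show ?thesis by blast
  qed
qed

text \<open>A squared influence counts pairs of reached vertices, and every pair is the end of some
  walk. The bound \<open>l < n\<close> holds since a walk visits \<open>Suc l\<close> distinct
  vertices of \<open>{1..n}\<close>.\<close>

lemma sum_reach_square_le:
  "(\<Sum>v\<in>{1..n}. (influence v)\<^sup>2) \<le>
     (\<Sum>l<n. \<Sum>cs\<in>codes l. \<Sum>ws\<in>increasing_lists n l. of_bool (walk (\<lambda>x y. x \<in> N y) cs ws))"
proof -
  let ?R = "\<lambda>v. reach (Suc v) {v}" and ?walk = "walk (\<lambda>x y. x \<in> N y)"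
  let ?X = "SIGMA l:{..<n}. SIGMA cs:codes l. {ws \<in> increasing_lists n l. ?walk cs ws}"
  let ?f = "\<lambda>(l::nat, cs, ws). (hd ws, apply_moves (hd ws, hd ws) (zip cs (tl ws)))"
  have "(SIGMA v:{1..n}. ?R v \<times> ?R v) \<subseteq> ?f ` ?X"
  proof
    fix z assume "z \<in> (SIGMA v:{1..n}. ?R v \<times> ?R v)"
    then obtain v j j' where z: "z = (v, j, j')" "v \<in> {1..n}" "j \<in> ?R v" "j' \<in> ?R v" by auto
    then obtain ms where ms: "fst ` set ms \<subseteq> {0, 1, 2}" "sorted_wrt (<) (v # map snd ms)"
      "\<forall>x\<in>snd ` set ms. x \<le> max j j' \<and> v < x \<and> x \<le> n"
      "valid_moves (\<lambda>x y. x \<in> N y) (v, v) ms" "apply_moves (v, v) ms = (j, j')"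
      using reach_pair_moves[of j v j'] by blast
    let ?ws = "v # map snd ms" and ?cs = "map fst ms"
    have set_ws: "set ?ws \<subseteq> {1..n}" using ms(3) z(2) by auto
    then have "card (set ?ws) \<le> n" using card_mono[of "{1..n}" "set ?ws"] by simp
    moreover have "card (set ?ws) = length ?ws"
      using ms(2) by (intro distinct_card) (simp add: strict_sorted_iff del: sorted_wrt.simps)
    ultimately have "length ms < n" by simp
    have zip: "zip ?cs (tl ?ws) = ms" by (simp add: zip_map_fst_snd)
    have "?cs \<in> codes (length ms)" using ms(1) by (simp add: codes_def)
    moreover have "?ws \<in> increasing_lists n (length ms)"
      unfolding increasing_lists_def using ms(2) set_ws by (simp del: sorted_wrt.simps set_simps)
    moreover have "?walk ?cs ?ws" using ms(4) zip by (simp add: walk_def)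
    ultimately have in_X: "(length ms, ?cs, ?ws) \<in> ?X" using \<open>length ms < n\<close> by simp
    have "z = ?f (length ms, ?cs, ?ws)" using ms(5) zip z(1) by simp
    with in_X show "z \<in> ?f ` ?X" by (rule rev_image_eqI)
  qed
  moreover have X: "finite ?X"
    by (intro finite_SigmaI finite_lessThan finite_codes finite_subset[OF _ finite_increasing_lists]) auto
  ultimately have "card (SIGMA v:{1..n}. ?R v \<times> ?R v) \<le> card ?X"
    by (rule surj_card_le[rotated])
  moreover have "card ?X = (\<Sum>l<n. \<Sum>cs\<in>codes l. card {ws \<in> increasing_lists n l. ?walk cs ws})"
    by (simp add: card_SigmaI finite_codes finite_increasing_lists)
  moreover have "card (SIGMA v:{1..n}. ?R v \<times> ?R v) = (\<Sum>v\<in>{1..n}. (card (?R v))\<^sup>2)"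
    by (simp add: card_SigmaI reach_finite card_cartesian_product power2_eq_square)
  ultimately have "(\<Sum>v\<in>{1..n}. (card (?R v))\<^sup>2) \<le> (\<Sum>l<n. \<Sum>cs\<in>codes l. card {ws \<in> increasing_lists n l. ?walk cs ws})"
    by simp
  then have "real (\<Sum>v\<in>{1..n}. (card (?R v))\<^sup>2) \<le> real (\<Sum>l<n. \<Sum>cs\<in>codes l. card {ws \<in> increasing_lists n l. ?walk cs ws})"
    by (rule of_nat_mono)
  then show ?thesis
    by (simp add: influence_def finite_increasing_lists Int_def)
qed

end

section \<open>Relabelling symmetry and the gain from increasing order\<close>

lemma exists_permutation_map:
  assumes "distinct ws" "distinct ws'" "length ws = length ws'" "set ws \<subseteq> A" "set ws' \<subseteq> A"
  shows "\<exists>\<pi>. \<pi> permutes A \<and> map \<pi> ws = ws'"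
  using assms(3,1,2,4,5)
proof (induction ws ws' rule: list_induct2)
  case Nil
  then show ?case by (auto intro: permutes_id)
next
  case (Cons w ws w' ws')
  then obtain \<pi> where \<pi>: "\<pi> permutes A" "map \<pi> ws = ws'" by auto
  let ?\<pi> = "Transposition.transpose (\<pi> w) w' \<circ> \<pi>"
  have "\<pi> w \<notin> set ws'"
  proof
    assume "\<pi> w \<in> set ws'"
    then obtain x where "x \<in> set ws" "\<pi> w = \<pi> x" unfolding \<pi>(2)[symmetric] by auto
    then show False using injD[OF permutes_inj[OF \<pi>(1)], of w x] Cons.prems(1) by simp
  qed
  moreover have "w' \<notin> set ws'" using Cons.prems(2) by simp
  ultimately have "map (Transposition.transpose (\<pi> w) w') ws' = ws'"
    by (intro map_idI) (metis transpose_apply_other)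
  then have "map ?\<pi> (w # ws) = w' # ws'"
    using \<pi>(2) by (simp flip: map_map)
  moreover have "?\<pi> permutes A"
  proof (rule permutes_compose[OF \<pi>(1)], rule permutes_swap_id)
    show "\<pi> w \<in> A" using permutes_in_image[OF \<pi>(1)] Cons.prems(3) by simp
    show "w' \<in> A" using Cons.prems(4) by simp
  qed
  ultimately show ?case by (intro exI[of _ ?\<pi>] conjI)
qed

lemma expand_image:
  assumes "inj \<pi>"
  shows "expand ((`) \<pi> ` E) (\<pi> ` W) = \<pi> ` expand E W"
proof -
  have "{e \<in> (`) \<pi> ` E. e \<inter> \<pi> ` W \<noteq> {}} = (`) \<pi> ` {e \<in> E. e \<inter> W \<noteq> {}}"
    using assms by (auto simp: inj_def)
  then show ?thesis by (simp add: expand_def image_Un image_Union)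
qed

lemma hball_image: "inj \<pi> \<Longrightarrow> hball ((`) \<pi> ` E) k (\<pi> ` W) = \<pi> ` hball E k W"
  by (induction k) (simp_all add: hball_Suc expand_image)

definition near :: "'a set set \<Rightarrow> nat \<Rightarrow> 'a \<Rightarrow> 'a \<Rightarrow> bool" where
  "near E k x y \<longleftrightarrow> x \<in> hball E k {y}"

lemma expand_UN: "expand E W = (\<Union>z\<in>W. expand E {z})"
  by (auto simp: expand_def)

text \<open>A walk moves to a vertex whose ball contains the current one, whereas
  \<open>small_balls\<close> bounds the ball around the current vertex; symmetry connects the
  two.\<close>

lemma near_sym: "near E k x y \<longleftrightarrow> near E k y x"
proof -
  have "y \<in> hball E k {x} \<Longrightarrow> x \<in> hball E k {y}" for x y
  proof (induction k arbitrary: y)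
    case (Suc k)
    then obtain z where z: "z \<in> hball E k {x}" "y \<in> expand E {z}"
      by (subst (asm) hball_Suc, subst (asm) expand_UN) blast
    then have "z \<in> expand E {y}" by (auto simp: expand_def)
    moreover have "hball E k {z} \<subseteq> hball E k W" if "z \<in> W" for W
      using that by (induction k) (auto simp: hball_Suc expand_def)
    ultimately show ?case using Suc.IH[OF z(1)] by (auto simp: hball_Suc')
  qed simp
  then show ?thesis by (auto simp: near_def)
qed

lemma valid_moves_map:
  assumes "\<And>x y. R' (\<pi> x) (\<pi> y) = R x y"
  shows "valid_moves R' (map_prod \<pi> \<pi> t) (map (map_prod id \<pi>) ms) = valid_moves R t ms"
proof (induction ms arbitrary: t)
  case (Cons m ms)
  have "tip c (map_prod \<pi> \<pi> t) = \<pi> (tip c t)" "move c (\<pi> w) (map_prod \<pi> \<pi> t) = map_prod \<pi> \<pi> (move c w t)" for c w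
    by (cases t; simp add: tip_def move_def)+
  then show ?case using Cons by (simp add: assms)
qed simp

lemma walk_map:
  assumes "\<And>x y. R' (\<pi> x) (\<pi> y) = R x y" "ws \<noteq> []"
  shows "walk R' cs (map \<pi> ws) = walk R cs ws"
proof -
  have "zip cs (tl (map \<pi> ws)) = map (map_prod id \<pi>) (zip cs (tl ws))"
    by (simp add: map_tl[symmetric] zip_map2 map_prod_def)
  then show ?thesis
    using valid_moves_map[of R' \<pi> R "(hd ws, hd ws)" "zip cs (tl ws)", OF assms(1)] assms(2)
    by (simp add: walk_def hd_map)
qed

definition small_balls :: "nat \<Rightarrow> nat set set \<Rightarrow> nat \<Rightarrow> real \<Rightarrow> bool" where
  "small_balls n E k D \<longleftrightarrow> (\<forall>x\<in>{1..n}. real (card (hball E k {x})) \<le> D)"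

text \<open>The truncation to small balls is part of the event: being invariant under relabelling,
  it leaves the symmetry of the random edges intact.\<close>

definition walk_prob :: "nat \<Rightarrow> nat \<Rightarrow> nat \<Rightarrow> nat \<Rightarrow> real \<Rightarrow> nat list \<Rightarrow> nat list \<Rightarrow> real" where
  "walk_prob K n m k D cs ws = list_avg (ksubsets K n) m
     (\<lambda>es. of_bool (small_balls n (set es) k D \<and> walk (near (set es) k) cs ws))"

lemma walk_prob_permute:
  assumes \<pi>: "\<pi> permutes {1..n}" and ws: "ws \<noteq> []"
  shows "walk_prob K n m k D cs (map \<pi> ws) = walk_prob K n m k D cs ws"
proof -
  note inj = permutes_inj[OF \<pi>]
  have bij: "bij_betw ((`) \<pi>) (ksubsets K n) (ksubsets K n)"
  proof (rule bij_betw_imageI)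
    show inj': "inj_on ((`) \<pi>) (ksubsets K n)"
      using inj by (auto simp: inj_on_def inj_image_eq_iff)
    have "(`) \<pi> ` ksubsets K n \<subseteq> ksubsets K n"
      using inj permutes_image[OF \<pi>] by (auto simp: ksubsets_def card_image inj_on_subset)
    then show "(`) \<pi> ` ksubsets K n = ksubsets K n"
      using inj' finite_ksubsets by (intro card_subset_eq) (auto simp: card_image)
  qed
  have near: "near ((`) \<pi> ` E) k (\<pi> x) (\<pi> y) = near E k x y" for E x y
    using hball_image[OF inj, of E k "{y}"] inj by (simp add: near_def inj_image_mem_iff)
  have card: "card (hball ((`) \<pi> ` E) k {\<pi> x}) = card (hball E k {x})" for E x
    using hball_image[OF inj, of E k "{x}"] inj by (simp add: card_image inj_on_subset)
  have small: "small_balls n ((`) \<pi> ` E) k D \<longleftrightarrow> small_balls n E k D" for E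
  proof -
    have "small_balls n ((`) \<pi> ` E) k D \<longleftrightarrow> (\<forall>x\<in>\<pi> ` {1..n}. real (card (hball ((`) \<pi> ` E) k {x})) \<le> D)"
      by (simp only: small_balls_def permutes_image[OF \<pi>])
    also have "\<dots> \<longleftrightarrow> (\<forall>x\<in>{1..n}. real (card (hball ((`) \<pi> ` E) k {\<pi> x})) \<le> D)"
      by blast
    finally show ?thesis by (simp only: card small_balls_def)
  qed
  have walk: "walk (near ((`) \<pi> ` E) k) cs (map \<pi> ws) = walk (near E k) cs ws" for E
    by (rule walk_map[OF _ ws]) (rule near)
  have "walk_prob K n m k D cs (map \<pi> ws) = list_avg (ksubsets K n) m
      (\<lambda>es. of_bool (small_balls n (set (map ((`) \<pi>) es)) k D \<and> walk (near (set (map ((`) \<pi>) es)) k) cs (map \<pi> ws)))"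
    unfolding walk_prob_def by (rule list_avg_bij[OF bij, symmetric])
  also have "\<dots> = walk_prob K n m k D cs ws"
    unfolding walk_prob_def set_map small walk ..
  finally show ?thesis .
qed

lemma card_increasing_lists: "fact (Suc l) * card (increasing_lists n l) \<le> card (distinct_lists n l)"
proof (cases "Suc l \<le> n")
  case True
  have "card (increasing_lists n l) \<le> card {S. S \<subseteq> {1..n} \<and> card S = Suc l}"
  proof (rule card_inj_on_le[where f = set])
    show "inj_on set (increasing_lists n l)"
      by (rule inj_onI) (auto simp: increasing_lists_def strict_sorted_iff intro: sorted_distinct_set_unique)
    show "set ` increasing_lists n l \<subseteq> {S. S \<subseteq> {1..n} \<and> card S = Suc l}"
      by (auto simp: increasing_lists_def strict_sorted_iff distinct_card)
  qed simp
  also have "\<dots> = n choose Suc l" using n_subsets[of "{1..n}" "Suc l"] by simp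
  finally have "fact (Suc l) * card (increasing_lists n l) \<le> fact (Suc l) * (n choose Suc l)"
    by (rule mult_le_mono2)
  also have "\<dots> = fact n div fact (n - Suc l)"
    using binomial_fact_lemma[OF True] by (metis fact_nonzero mult.assoc mult.commute nonzero_mult_div_cancel_left)
  also have "\<dots> = \<Prod>{n - Suc l + 1..n}" by (rule fact_div_fact) simp
  also have "\<dots> = card (distinct_lists n l)"
    using card_lists_distinct_length_eq[of "{1..n}" "Suc l"] True
    by (simp add: distinct_lists_def conj_ac)
  finally show ?thesis .
next
  case False
  have "increasing_lists n l = {}"
  proof -
    have "length ws \<le> n" if "distinct ws" "set ws \<subseteq> {1..n}" for ws
      using card_mono[of "{1..n}" "set ws"] that by (simp add: distinct_card)
    then show ?thesis using False by (fastforce simp: increasing_lists_def strict_sorted_iff)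
  qed
  then show ?thesis by simp
qed

text \<open>All lists of distinct vertices are equally likely to be walks, and of the (l+1)!
  orderings of a vertex set just one is increasing.\<close>

lemma sum_walk_prob_increasing_le:
  "fact (Suc l) * (\<Sum>ws\<in>increasing_lists n l. walk_prob K n m k D cs ws)
     \<le> (\<Sum>ws\<in>distinct_lists n l. walk_prob K n m k D cs ws)"
proof (cases "increasing_lists n l = {}")
  case True
  have "0 \<le> walk_prob K n m k D cs ws" for ws
  proof -
    have "list_avg (ksubsets K n) m (\<lambda>_. 0) \<le> walk_prob K n m k D cs ws"
      unfolding walk_prob_def by (rule list_avg_mono) simp
    then show ?thesis using list_avg_cmult[of "ksubsets K n" m 0] by simp
  qed
  then show ?thesis using True by (simp add: sum_nonneg)
next
  case False
  then obtain ws\<^sub>0 where ws\<^sub>0: "ws\<^sub>0 \<in> distinct_lists n l" using increasing_subset_distinct by blast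
  let ?c = "walk_prob K n m k D cs ws\<^sub>0"
  have const: "walk_prob K n m k D cs ws = ?c" if "ws \<in> distinct_lists n l" for ws
  proof -
    have "\<exists>\<pi>. \<pi> permutes {1..n} \<and> map \<pi> ws\<^sub>0 = ws"
      using ws\<^sub>0 that by (intro exists_permutation_map) (auto simp: distinct_lists_def)
    then obtain \<pi> where "\<pi> permutes {1..n}" "map \<pi> ws\<^sub>0 = ws" by blast
    moreover have "ws\<^sub>0 \<noteq> []" using ws\<^sub>0 by (auto simp: distinct_lists_def)
    ultimately show ?thesis using walk_prob_permute by metis
  qed
  have "0 \<le> ?c"
  proof -
    have "list_avg (ksubsets K n) m (\<lambda>_. 0) \<le> ?c"
      unfolding walk_prob_def by (rule list_avg_mono) simp
    then show ?thesis using list_avg_cmult[of "ksubsets K n" m 0] by simp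
  qed
  have "fact (Suc l) * (\<Sum>ws\<in>increasing_lists n l. walk_prob K n m k D cs ws) = real (fact (Suc l) * card (increasing_lists n l)) * ?c"
    using const increasing_subset_distinct[of n l] by (simp add: subset_iff algebra_simps)
  also have "\<dots> \<le> real (card (distinct_lists n l)) * ?c"
    using \<open>0 \<le> ?c\<close> card_increasing_lists by (intro mult_right_mono of_nat_mono)
  also have "\<dots> = (\<Sum>ws\<in>distinct_lists n l. walk_prob K n m k D cs ws)"
    using const by simp
  finally show ?thesis .
qed

section \<open>Counting walks when all balls are small\<close>

text \<open>Each move has three codes and at most \<open>D\<close> targets. Finiteness is carried
  through the induction because the bound alone would also hold for infinite sets, whose
  \<open>card\<close> is 0.\<close>

lemma card_valid_moves_le:
  fixes D :: real
  assumes E: "\<Union>E \<subseteq> {1..n}" "small_balls n E k D" "0 \<le> D" and t: "fst t \<in> {1..n}" "snd t \<in> {1..n}"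
  shows "finite {ms. length ms = l \<and> fst ` set ms \<subseteq> {0, 1, 2} \<and> snd ` set ms \<subseteq> {1..n} \<and> valid_moves (near E k) t ms} \<and>
    real (card {ms. length ms = l \<and> fst ` set ms \<subseteq> {0, 1, 2} \<and> snd ` set ms \<subseteq> {1..n} \<and> valid_moves (near E k) t ms}) \<le> (3 * D) ^ l"
    (is "finite (?S l t) \<and> _")
  using t
proof (induction l arbitrary: t)
  case 0
  have "?S 0 t = {[]}" by auto
  then show ?case by simp
next
  case (Suc l)
  let ?W = "\<lambda>c. {w \<in> {1..n}. near E k (tip c t) w}"
  have S: "?S (Suc l) t = (\<Union>c\<in>{0, 1, 2}. \<Union>w\<in>?W c. Cons (c, w) ` ?S l (move c w t))"
  proof (intro set_eqI iffI)
    fix ms assume "ms \<in> ?S (Suc l) t"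
    then obtain c w ms' where "ms = (c, w) # ms'" "ms' \<in> ?S l (move c w t)" "c \<in> {0, 1, 2}" "w \<in> ?W c"
      by (cases ms) auto
    then show "ms \<in> (\<Union>c\<in>{0, 1, 2}. \<Union>w\<in>?W c. Cons (c, w) ` ?S l (move c w t))" by blast
  next
    fix ms assume "ms \<in> (\<Union>c\<in>{0, 1, 2}. \<Union>w\<in>?W c. Cons (c, w) ` ?S l (move c w t))"
    then obtain c w ms' where "ms = (c, w) # ms'" "ms' \<in> ?S l (move c w t)" "c \<in> {0, 1, 2}" "w \<in> ?W c"
      by blast
    then show "ms \<in> ?S (Suc l) t" by simp
  qed
  have mv: "fst (move c w t) \<in> {1..n}" "snd (move c w t) \<in> {1..n}" if "w \<in> ?W c" for c w
    using that Suc.prems by (auto simp: move_def)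
  have fin: "finite (Cons (c, w) ` ?S l (move c w t))"
    and le: "real (card (Cons (c, w) ` ?S l (move c w t))) \<le> (3 * D) ^ l" if "w \<in> ?W c" for c w
    using Suc.IH[OF mv[OF that]] by (auto simp: card_image)
  have W: "card (?W c) \<le> D" for c
  proof -
    have tip: "tip c t \<in> {1..n}" using Suc.prems by (auto simp: tip_def)
    then have sub: "hball E k {tip c t} \<subseteq> {1..n}" using E(1) by (intro hball_subset) auto
    have "?W c \<subseteq> hball E k {tip c t}" using near_sym[of E k] by (auto simp: near_def)
    then have "card (?W c) \<le> card (hball E k {tip c t})"
      using finite_subset[OF sub] by (intro card_mono) auto
    also have "real \<dots> \<le> D" using E(2) tip by (auto simp: small_balls_def)
    finally show ?thesis by simp
  qed
  have "real (card (?S (Suc l) t)) \<le> (\<Sum>c\<in>{0, 1, 2}. \<Sum>w\<in>?W c. real (card (Cons (c, w) ` ?S l (move c w t))))"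
  proof -
    have "card (?S (Suc l) t) \<le> (\<Sum>c\<in>{0, 1, 2}. card (\<Union>w\<in>?W c. Cons (c, w) ` ?S l (move c w t)))"
      unfolding S by (rule card_UN_le) simp
    also have "\<dots> \<le> (\<Sum>c\<in>{0, 1, 2}. \<Sum>w\<in>?W c. card (Cons (c, w) ` ?S l (move c w t)))"
      by (intro sum_mono card_UN_le) simp
    finally show ?thesis by (simp only: of_nat_sum[symmetric] of_nat_le_iff)
  qed
  also have "\<dots> \<le> (\<Sum>c\<in>{0, 1, 2::nat}. \<Sum>w\<in>?W c. (3 * D) ^ l)"
    by (intro sum_mono le)
  also have "\<dots> = (\<Sum>c\<in>{0, 1, 2::nat}. card (?W c) * (3 * D) ^ l)" by simp
  also have "\<dots> \<le> (\<Sum>c\<in>{0, 1, 2::nat}. D * (3 * D) ^ l)"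
    using W E(3) by (intro sum_mono mult_right_mono) auto
  also have "\<dots> = (3 * D) ^ Suc l" by simp
  finally have "real (card (?S (Suc l) t)) \<le> (3 * D) ^ Suc l" .
  moreover have "finite (?S (Suc l) t)" unfolding S
    by (rule finite_UN_I, simp, rule finite_UN_I, simp, erule fin)
  ultimately show ?case by (rule conjI[rotated])
qed

lemma sum_walks_le:
  fixes D :: real
  assumes E: "\<Union>E \<subseteq> {1..n}" "small_balls n E k D" "0 \<le> D"
  shows "(\<Sum>cs\<in>codes l. \<Sum>ws\<in>distinct_lists n l. of_bool (walk (near E k) cs ws)) \<le> n * (3 * D) ^ l"
proof -
  let ?X = "SIGMA cs:codes l. {ws \<in> distinct_lists n l. walk (near E k) cs ws}"
  let ?S = "\<lambda>v. {ms. length ms = l \<and> fst ` set ms \<subseteq> {0, 1, 2} \<and> snd ` set ms \<subseteq> {1..n} \<and> valid_moves (near E k) (v, v) ms}"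
  let ?f = "\<lambda>(cs::nat list, ws::nat list). (hd ws, zip cs (tl ws))"
  note S = card_valid_moves_le[OF E, of "(v, v)" l for v]
  have "inj_on ?f ?X"
  proof (rule inj_onI, clarify)
    fix cs ws cs' ws'
    assume *: "cs \<in> codes l" "ws \<in> distinct_lists n l" "cs' \<in> codes l" "ws' \<in> distinct_lists n l"
      "hd ws = hd ws'" "zip cs (tl ws) = zip cs' (tl ws')"
    then have len: "length cs = length (tl ws)" "length cs' = length (tl ws')" "ws \<noteq> []" "ws' \<noteq> []"
      by (auto simp: codes_def distinct_lists_def)
    then have "cs = cs'" "tl ws = tl ws'" using *(6) by (metis map_fst_zip, metis map_snd_zip)
    then show "cs = cs' \<and> ws = ws'" using *(5) len by (metis list.collapse)
  qed
  moreover have "?f ` ?X \<subseteq> (SIGMA v:{1..n}. ?S v)"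
  proof clarify
    fix cs ws assume *: "cs \<in> codes l" "ws \<in> distinct_lists n l" "walk (near E k) cs ws"
    then obtain w ws' where ws: "ws = w # ws'" by (cases ws) (auto simp: distinct_lists_def)
    have "length cs = length ws'" using * ws by (simp add: codes_def distinct_lists_def)
    then have "fst ` set (zip cs ws') = set cs" "snd ` set (zip cs ws') = set ws'"
      by (metis map_fst_zip set_map, metis map_snd_zip set_map)
    then show "hd ws \<in> {1..n} \<and> zip cs (tl ws) \<in> ?S (hd ws)"
      using * ws \<open>length cs = length ws'\<close> by (auto simp: codes_def distinct_lists_def walk_def)
  qed
  moreover have "finite (SIGMA v:{1..n}. ?S v)" using S by (intro finite_SigmaI) auto
  ultimately have "card ?X \<le> card (SIGMA v:{1..n}. ?S v)" by (rule card_inj_on_le)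
  also have "\<dots> = (\<Sum>v\<in>{1..n}. card (?S v))" using S by (intro card_SigmaI) auto
  finally have "real (card ?X) \<le> (\<Sum>v\<in>{1..n}. real (card (?S v)))"
    by (simp only: of_nat_sum[symmetric] of_nat_le_iff)
  also have "\<dots> \<le> (\<Sum>v\<in>{1..n}. (3 * D) ^ l)" using S by (intro sum_mono) auto
  finally have "real (card ?X) \<le> n * (3 * D) ^ l" by simp
  moreover have "real (card ?X) = (\<Sum>cs\<in>codes l. \<Sum>ws\<in>distinct_lists n l. of_bool (walk (near E k) cs ws))"
    by (simp add: card_SigmaI finite_codes finite_distinct_lists Int_def)
  ultimately show ?thesis by simp
qed

text \<open>Length \<open>l\<close> contributes at most n (3D)^l / (l+1)!, which is below n times a
  term of the exponential series at 3D.\<close>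

lemma expected_walks_le:
  fixes D :: real
  assumes K: "K \<le> n" and D: "0 \<le> D"
  shows "list_avg (ksubsets K n) m (\<lambda>es. of_bool (small_balls n (set es) k D) *
      (\<Sum>l<n. \<Sum>cs\<in>codes l. \<Sum>ws\<in>increasing_lists n l. of_bool (walk (near (set es) k) cs ws))) \<le> n * exp (3 * D)"
proof -
  let ?A = "ksubsets K n" and ?P = "walk_prob K n m k D"
  have *: "(\<Sum>cs\<in>codes l. \<Sum>ws\<in>increasing_lists n l. ?P cs ws) \<le> n * ((3 * D) ^ l /\<^sub>R fact l)" for l
  proof -
    have "fact (Suc l) * (\<Sum>cs\<in>codes l. \<Sum>ws\<in>increasing_lists n l. ?P cs ws)
       = (\<Sum>cs\<in>codes l. fact (Suc l) * (\<Sum>ws\<in>increasing_lists n l. ?P cs ws))"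
      by (rule sum_distrib_left)
    also have "\<dots> \<le> (\<Sum>cs\<in>codes l. \<Sum>ws\<in>distinct_lists n l. ?P cs ws)"
      by (intro sum_mono sum_walk_prob_increasing_le)
    also have "\<dots> = list_avg ?A m (\<lambda>es. \<Sum>cs\<in>codes l. \<Sum>ws\<in>distinct_lists n l.
        of_bool (small_balls n (set es) k D \<and> walk (near (set es) k) cs ws))"
      by (simp only: walk_prob_def list_avg_sum)
    also have "\<dots> \<le> list_avg ?A m (\<lambda>_. n * (3 * D) ^ l)"
    proof (rule list_avg_mono)
      fix es assume "set es \<subseteq> ?A"
      then have "\<Union>(set es) \<subseteq> {1..n}" by (auto simp: ksubsets_def)
      then show "(\<Sum>cs\<in>codes l. \<Sum>ws\<in>distinct_lists n l.
        of_bool (small_balls n (set es) k D \<and> walk (near (set es) k) cs ws)) \<le> n * (3 * D) ^ l"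
        using sum_walks_le[of "set es" n k D l] D
        by (cases "small_balls n (set es) k D") simp_all
    qed
    also have "\<dots> = n * (3 * D) ^ l"
      by (rule list_avg_const[OF finite_ksubsets ksubsets_nonempty[OF K]])
    finally have "(\<Sum>cs\<in>codes l. \<Sum>ws\<in>increasing_lists n l. ?P cs ws) \<le> n * (3 * D) ^ l / fact (Suc l)"
      by (simp add: field_simps del: fact_Suc)
    also have "\<dots> \<le> n * (3 * D) ^ l / fact l"
      using D by (intro divide_left_mono) (auto intro!: fact_mono mult_pos_pos simp del: fact_Suc)
    finally show ?thesis by (simp add: field_simps)
  qed
  have "list_avg ?A m (\<lambda>es. of_bool (small_balls n (set es) k D) *
      (\<Sum>l<n. \<Sum>cs\<in>codes l. \<Sum>ws\<in>increasing_lists n l. of_bool (walk (near (set es) k) cs ws)))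
    = (\<Sum>l<n. \<Sum>cs\<in>codes l. \<Sum>ws\<in>increasing_lists n l. ?P cs ws)"
    by (simp only: sum_distrib_left of_bool_conj[symmetric] list_avg_sum walk_prob_def)
  also have "\<dots> \<le> (\<Sum>l<n. n * ((3 * D) ^ l /\<^sub>R fact l))"
    by (intro sum_mono *)
  also have "\<dots> = n * (\<Sum>l<n. (3 * D) ^ l /\<^sub>R fact l)" by (simp only: sum_distrib_left)
  also have "(\<Sum>l<n. (3 * D) ^ l /\<^sub>R fact l) \<le> exp (3 * D)"
    unfolding exp_def using D summable_exp_generic[of "3 * D"] by (intro sum_le_suminf) auto
  finally show ?thesis by (simp add: mult_left_mono)
qed

section \<open>Triples of solutions\<close>

lemma expectation_bind_finite:
  fixes h :: "'b \<Rightarrow> real"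
  assumes "finite (set_pmf p)" "\<And>x. x \<in> set_pmf p \<Longrightarrow> finite (set_pmf (f x))"
  shows "measure_pmf.expectation (p \<bind> f) h = measure_pmf.expectation p (\<lambda>x. measure_pmf.expectation (f x) h)"
proof -
  have "measure_pmf.expectation (p \<bind> f) h = (\<Sum>x\<in>set_pmf p. pmf p x *\<^sub>R measure_pmf.expectation (f x) h)"
    by (rule pmf_expectation_bind) (use assms in auto)
  also have "\<dots> = measure_pmf.expectation p (\<lambda>x. measure_pmf.expectation (f x) h)"
    by (subst integral_measure_pmf_real[of "set_pmf p"]) (simp_all add: assms mult.commute)
  finally show ?thesis .
qed

lemma finite_set_replicate_pmf: "finite (set_pmf p) \<Longrightarrow> finite (set_pmf (replicate_pmf m p))"
  using finite_lists_length_eq[of "set_pmf p" m]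
  by (simp add: set_replicate_pmf lists_eq_set conj_commute)

lemma expectation_replicate_Suc:
  fixes f :: "'a list \<Rightarrow> real"
  assumes "finite (set_pmf p)"
  shows "measure_pmf.expectation (replicate_pmf (Suc m) p) f
    = measure_pmf.expectation p (\<lambda>x. measure_pmf.expectation (replicate_pmf m p) (\<lambda>xs. f (x # xs)))"
proof -
  have eq: "replicate_pmf (Suc m) p = p \<bind> (\<lambda>x. map_pmf ((#) x) (replicate_pmf m p))"
    by (simp add: map_pmf_def)
  show ?thesis
    unfolding eq using assms finite_set_replicate_pmf[OF assms]
    by (subst expectation_bind_finite) simp_all
qed

lemma expectation_replicate_all:
  assumes "finite (set_pmf p)"
  shows "measure_pmf.expectation (replicate_pmf m p) (\<lambda>xs. of_bool (\<forall>x\<in>set xs. P x)) =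
    (measure_pmf.expectation p (\<lambda>x. of_bool (P x)) :: real) ^ m"
proof (induction m)
  case (Suc m)
  have "measure_pmf.expectation (replicate_pmf (Suc m) p) (\<lambda>xs. of_bool (\<forall>x\<in>set xs. P x)) =
    measure_pmf.expectation p (\<lambda>x. of_bool (P x) * (measure_pmf.expectation p (\<lambda>x. of_bool (P x)) :: real) ^ m)"
    unfolding expectation_replicate_Suc[OF assms] by (simp add: of_bool_conj Suc)
  then show ?case by simp
qed simp

abbreviation clause_of :: "nat set \<Rightarrow> (nat \<Rightarrow> bool) \<Rightarrow> clause" where
  "clause_of V negated \<equiv> ((\<lambda>x. if negated x then Neg x else Pos x) ` V, Zero)"

abbreviation signs :: "nat set \<Rightarrow> (nat \<Rightarrow> bool) pmf" where
  "signs V \<equiv> Pi_pmf V False (\<lambda>_. bernoulli_pmf (1 / 2))"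

lemma random_clause_eq:
  "random_clause K n = pmf_of_set (ksubsets K n) \<bind> (\<lambda>V. map_pmf (clause_of V) (signs V))"
  by (simp add: random_clause_def ksubsets_def map_pmf_def)

lemma cvars_clause_of: "cvars (clause_of V negated) = V"
proof -
  have "lit_var (if negated x then Neg x else Pos x) = x" for x by simp
  then show ?thesis by (simp only: fst_conv image_image image_ident)
qed

lemma finite_set_signs:
  assumes "finite V"
  shows "finite (set_pmf (signs V))"
proof (rule finite_subset)
  show "set_pmf (signs V) \<subseteq> PiE_dflt V False (\<lambda>_. UNIV)"
    using set_Pi_pmf_subset[OF assms] by (fastforce simp: PiE_dflt_def)
  show "finite (PiE_dflt V False (\<lambda>_. UNIV :: bool set))"
    using assms by (intro finite_PiE_dflt) auto
qed

lemma expectation_random_clause: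
  assumes "K \<le> n"
  shows "measure_pmf.expectation (random_clause K n) f
    = avg (ksubsets K n) (\<lambda>V. measure_pmf.expectation (signs V) (\<lambda>negated. f (clause_of V negated) :: real))"
proof -
  have "finite (set_pmf (map_pmf (clause_of V) (signs V)))" if "V \<in> ksubsets K n" for V
    using that by (auto simp: ksubsets_def intro!: finite_set_signs dest: finite_subset)
  then have "measure_pmf.expectation (random_clause K n) f
    = (\<Sum>V\<in>ksubsets K n. measure_pmf.expectation (map_pmf (clause_of V) (signs V)) f /\<^sub>R real (card (ksubsets K n)))"
    unfolding random_clause_eq
    by (rule pmf_expectation_bind_pmf_of_set[OF ksubsets_nonempty[OF assms] finite_ksubsets])
  then show ?thesis
    unfolding avg_def sum_divide_distrib integral_map_pmf real_scaleR_def
    by (simp only: divide_inverse mult.commute)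
qed

lemma set_random_clause:
  assumes "K \<le> n" "C \<in> set_pmf (random_clause K n)"
  shows "snd C = Zero" "cvars C \<in> ksubsets K n" "finite (fst C)"
proof -
  have "C \<in> (\<Union>V\<in>ksubsets K n. clause_of V ` set_pmf (signs V))"
    using assms(2) unfolding random_clause_eq set_bind_pmf set_map_pmf
      set_pmf_of_set[OF ksubsets_nonempty[OF assms(1)] finite_ksubsets] .
  then obtain V negated where *: "V \<in> ksubsets K n" "C = clause_of V negated" by blast
  show "snd C = Zero" using *(2) by simp
  show "cvars C \<in> ksubsets K n" unfolding *(2) cvars_clause_of by (rule *(1))
  have "finite V" using *(1) by (auto simp: ksubsets_def intro: finite_subset)
  then show "finite (fst C)" using *(2) by simp
qed

lemma finite_set_random_clause:
  assumes "K \<le> n"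
  shows "finite (set_pmf (random_clause K n))"
  unfolding random_clause_eq set_bind_pmf
    set_pmf_of_set[OF ksubsets_nonempty[OF assms] finite_ksubsets]
  by (auto intro!: finite_ksubsets finite_set_signs simp: ksubsets_def dest: finite_subset)

lemma expectation_clauses_cvars:
  assumes "K \<le> n"
  shows "measure_pmf.expectation (replicate_pmf m (random_clause K n)) (\<lambda>Cs. f (map cvars Cs))
    = list_avg (ksubsets K n) m f"
proof (induction m arbitrary: f)
  case (Suc m)
  have "measure_pmf.expectation (replicate_pmf (Suc m) (random_clause K n)) (\<lambda>Cs. f (map cvars Cs))
    = measure_pmf.expectation (random_clause K n) (\<lambda>C. list_avg (ksubsets K n) m (\<lambda>xs. f (cvars C # xs)))"
    unfolding expectation_replicate_Suc[OF finite_set_random_clause[OF assms]]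
    using Suc[of "\<lambda>xs. f (y # xs)" for y] by simp
  also have "\<dots> = list_avg (ksubsets K n) (Suc m) f"
    unfolding expectation_random_clause[OF assms] cvars_clause_of by simp
  finally show ?case .
qed simp

section \<open>Clauses violated by several assignments\<close>

lemma sat_clause_of:
  "sat_clause \<sigma> (clause_of V negated) \<longleftrightarrow> (\<exists>x\<in>V. negated x \<noteq> \<sigma> x) \<and> (\<exists>x\<in>V. negated x = \<sigma> x)"
proof -
  have val: "lit_val \<sigma> (if negated x then Neg x else Pos x) \<longleftrightarrow> negated x \<noteq> \<sigma> x" for x by simp
  have bex: "(\<exists>l\<in>f ` V. P l) \<longleftrightarrow> (\<exists>x\<in>V. P (f x))" for f :: "nat \<Rightarrow> literal" and P by blast
  show ?thesis by (simp only: sat_clause.simps bex val not_not)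
qed

text \<open>Exactly two sign patterns violate a NAE clause, the assignment on \<open>V\<close> and
  its complement; they are distinct since \<open>V\<close> is nonempty.\<close>

lemma violated_clause_of:
  assumes "V \<noteq> {}"
  shows "of_bool (\<not> sat_clause \<sigma> (clause_of V negated)) =
    (indicator (Pi V (\<lambda>x. {\<sigma> x})) negated + indicator (Pi V (\<lambda>x. {\<not> \<sigma> x})) negated :: real)"
proof -
  let ?P = "\<forall>x\<in>V. negated x = \<sigma> x" and ?Q = "\<forall>x\<in>V. negated x \<noteq> \<sigma> x"
  have ind: "indicator (Pi V (\<lambda>x. {\<sigma> x})) negated = (of_bool ?P :: real)"
    "indicator (Pi V (\<lambda>x. {\<not> \<sigma> x})) negated = (of_bool ?Q :: real)"
    by (auto simp: indicator_def Pi_def)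
  have violated: "\<not> sat_clause \<sigma> (clause_of V negated) \<longleftrightarrow> ?P \<or> ?Q" unfolding sat_clause_of by blast
  have disjoint: "\<not> (?P \<and> ?Q)" using assms by blast
  have "of_bool (P \<or> Q) = (of_bool P + of_bool Q :: real)" if "\<not> (P \<and> Q)" for P Q
    using that by auto
  from this[OF disjoint] show ?thesis unfolding ind violated .
qed

lemma prob_signs_eq:
  assumes "finite V"
  shows "measure_pmf.prob (signs V) (Pi V (\<lambda>x. {s x})) = (1 / 2) ^ card V"
proof -
  have half: "measure_pmf.prob (bernoulli_pmf (1 / 2)) {b} = 1 / 2" for b
    by (cases b) (simp_all add: measure_pmf_single)
  show ?thesis
    unfolding measure_Pi_pmf_Pi[OF assms] half by (rule prod_constant)
qed

text \<open>Two assignments can violate the same clause only on such a variable set; see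
  \<open>violated_both_homogeneous\<close>.\<close>

definition homogeneous :: "(nat \<Rightarrow> bool) \<Rightarrow> (nat \<Rightarrow> bool) \<Rightarrow> nat set \<Rightarrow> bool" where
  "homogeneous \<sigma> \<sigma>' V \<longleftrightarrow> (\<forall>x\<in>V. \<sigma> x = \<sigma>' x) \<or> (\<forall>x\<in>V. \<sigma> x \<noteq> \<sigma>' x)"

lemma expectation_violated:
  assumes "finite V" "V \<noteq> {}"
  shows "measure_pmf.expectation (signs V) (\<lambda>negated. of_bool (\<not> sat_clause \<sigma> (clause_of V negated))) = (2 / 2 ^ card V :: real)"
  unfolding violated_clause_of[OF assms(2)]
  by (subst Bochner_Integration.integral_add)
    (simp_all add: integrable_measure_pmf_finite finite_set_signs assms prob_signs_eq power_divide)

lemma violated_both_homogeneous: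
  assumes "V \<noteq> {}" "\<not> sat_clause \<sigma> (clause_of V negated)" "\<not> sat_clause \<sigma>' (clause_of V negated)"
  shows "homogeneous \<sigma> \<sigma>' V"
proof -
  have "(\<forall>x\<in>V. negated x = \<sigma> x) \<or> (\<forall>x\<in>V. negated x \<noteq> \<sigma> x)"
    "(\<forall>x\<in>V. negated x = \<sigma>' x) \<or> (\<forall>x\<in>V. negated x \<noteq> \<sigma>' x)"
    using assms(2,3) unfolding sat_clause_of by blast+
  then show ?thesis unfolding homogeneous_def by metis
qed

text \<open>Pointwise, the event is at most one minus a weighted count of violations, where
  simultaneous violations are cancelled by the homogeneity terms until the count is at most 1. The
  weights do not depend on the signs, so \<open>expectation_violated\<close> suffices.\<close>

lemma expectation_sat_triple:
  assumes V: "finite V" "V \<noteq> {}"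
  shows "measure_pmf.expectation (signs V) (\<lambda>negated. of_bool (sat_clause \<sigma>\<^sub>1 (clause_of V negated) \<and>
      sat_clause \<sigma>\<^sub>2 (clause_of V negated) \<and> sat_clause \<sigma>\<^sub>3 (clause_of V negated)))
    \<le> 1 - (2 / 2 ^ card V) * (3 - (of_bool (homogeneous \<sigma>\<^sub>1 \<sigma>\<^sub>2 V) + of_bool (homogeneous \<sigma>\<^sub>1 \<sigma>\<^sub>3 V) +
        of_bool (homogeneous \<sigma>\<^sub>2 \<sigma>\<^sub>3 V)) :: real)"
proof -
  let ?v = "\<lambda>\<sigma> negated. of_bool (\<not> sat_clause \<sigma> (clause_of V negated)) :: real"
  let ?h = "\<lambda>\<sigma> \<sigma>'. of_bool (homogeneous \<sigma> \<sigma>' V) :: real"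
  have int: "integrable (measure_pmf (signs V)) f" for f :: "(nat \<Rightarrow> bool) \<Rightarrow> real"
    by (intro integrable_measure_pmf_finite finite_set_signs V)
  have "measure_pmf.expectation (signs V) (\<lambda>negated. of_bool (sat_clause \<sigma>\<^sub>1 (clause_of V negated) \<and>
      sat_clause \<sigma>\<^sub>2 (clause_of V negated) \<and> sat_clause \<sigma>\<^sub>3 (clause_of V negated)))
    \<le> measure_pmf.expectation (signs V) (\<lambda>negated. 1 - ((1 - ?h \<sigma>\<^sub>1 \<sigma>\<^sub>2 - ?h \<sigma>\<^sub>1 \<sigma>\<^sub>3) * ?v \<sigma>\<^sub>1 negated +
        ((1 - ?h \<sigma>\<^sub>2 \<sigma>\<^sub>3) * ?v \<sigma>\<^sub>2 negated + ?v \<sigma>\<^sub>3 negated)))"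
  proof (rule integral_mono[OF int int])
    fix negated
    show "of_bool (sat_clause \<sigma>\<^sub>1 (clause_of V negated) \<and> sat_clause \<sigma>\<^sub>2 (clause_of V negated) \<and> sat_clause \<sigma>\<^sub>3 (clause_of V negated))
      \<le> 1 - ((1 - ?h \<sigma>\<^sub>1 \<sigma>\<^sub>2 - ?h \<sigma>\<^sub>1 \<sigma>\<^sub>3) * ?v \<sigma>\<^sub>1 negated + ((1 - ?h \<sigma>\<^sub>2 \<sigma>\<^sub>3) * ?v \<sigma>\<^sub>2 negated + ?v \<sigma>\<^sub>3 negated))"
      using violated_both_homogeneous[OF V(2), of \<sigma>\<^sub>1 negated \<sigma>\<^sub>2] violated_both_homogeneous[OF V(2), of \<sigma>\<^sub>1 negated \<sigma>\<^sub>3]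
        violated_both_homogeneous[OF V(2), of \<sigma>\<^sub>2 negated \<sigma>\<^sub>3]
      by (cases "sat_clause \<sigma>\<^sub>1 (clause_of V negated)"; cases "sat_clause \<sigma>\<^sub>2 (clause_of V negated)";
          cases "sat_clause \<sigma>\<^sub>3 (clause_of V negated)") (simp_all del: sat_clause.simps)
  qed
  also have "\<dots> = 1 - ((1 - ?h \<sigma>\<^sub>1 \<sigma>\<^sub>2 - ?h \<sigma>\<^sub>1 \<sigma>\<^sub>3) * (2 / 2 ^ card V) + ((1 - ?h \<sigma>\<^sub>2 \<sigma>\<^sub>3) * (2 / 2 ^ card V) + 2 / 2 ^ card V))"
    by (simp only: Bochner_Integration.integral_diff[OF int int] Bochner_Integration.integral_add[OF int int]
        integral_mult_right_zero expectation_violated[OF V] measure_pmf.prob_space lebesgue_integral_const) simp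
  also have "\<dots> = 1 - (2 / 2 ^ card V) * (3 - (?h \<sigma>\<^sub>1 \<sigma>\<^sub>2 + ?h \<sigma>\<^sub>1 \<sigma>\<^sub>3 + ?h \<sigma>\<^sub>2 \<sigma>\<^sub>3))"
    by (simp add: algebra_simps)
  finally show ?thesis .
qed

text \<open>Sampling without replacement stays inside a set of size \<open>b\<close> with at most
  the probability of sampling with replacement; factor by factor, (b - K) / (n - K) is at most b /
  n.\<close>

lemma binomial_ratio_le:
  assumes "b \<le> n"
  shows "real (b choose K) * real n ^ K \<le> real (n choose K) * real b ^ K"
proof (induction K)
  case (Suc K)
  have absorb: "real (Suc K) * real (c choose Suc K) = real (c choose K) * (real c - real K)" for c
  proof (cases "K \<le> c")
    case True
    have "Suc K * (c choose Suc K) = (c choose K) * (c - K)"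
      using binomial_absorb_comp[of c K] binomial_absorption[of K c] by (simp add: mult.commute)
    then show ?thesis using True by (metis of_nat_diff of_nat_mult)
  qed (simp add: binomial_eq_0)
  show ?case
  proof (cases "K < b")
    case True
    have "real (Suc K) * (real (b choose Suc K) * real n ^ Suc K)
        = (real (b choose K) * real n ^ K) * ((real b - real K) * real n)"
      by (simp only: mult.assoc[symmetric] absorb) (simp add: mult_ac)
    also have "\<dots> \<le> (real (n choose K) * real b ^ K) * ((real n - real K) * real b)"
    proof (rule mult_mono[OF Suc.IH])
      have "real K * real b \<le> real K * real n" using assms by (intro mult_left_mono) auto
      then show "(real b - real K) * real n \<le> (real n - real K) * real b"
        by (simp add: algebra_simps)
    qed (use True in auto)
    also have "\<dots> = real (Suc K) * (real (n choose Suc K) * real b ^ Suc K)"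
      by (simp only: mult.assoc[symmetric] absorb) (simp add: mult_ac)
    finally show ?thesis by (simp only: mult_le_cancel_left_pos of_nat_0_less_iff zero_less_Suc)
  qed (simp add: binomial_eq_0)
qed simp

lemma ksubsets_inside_prob:
  assumes "K \<le> n" "0 < n" "B \<subseteq> {1..n}"
  shows "avg (ksubsets K n) (\<lambda>V. of_bool (V \<subseteq> B)) \<le> (card B / n) ^ K"
proof -
  have B: "finite B" using assms(3) finite_subset by blast
  have "{V \<in> ksubsets K n. V \<subseteq> B} = {V. V \<subseteq> B \<and> card V = K}"
    using assms(3) by (auto simp: ksubsets_def)
  then have "avg (ksubsets K n) (\<lambda>V. of_bool (V \<subseteq> B)) = (card B choose K) / (n choose K)"
    using n_subsets[OF B, of K] finite_ksubsets[of K n] by (simp add: avg_def card_ksubsets Int_def)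
  also have "\<dots> \<le> (card B / n) ^ K"
    using binomial_ratio_le[of "card B" n K] card_mono[OF _ assms(3)] assms
    by (simp add: field_simps power_divide)
  finally show ?thesis .
qed

lemma homogeneous_prob:
  assumes "K \<le> n" "0 < n"
  shows "avg (ksubsets K n) (\<lambda>V. of_bool (homogeneous \<sigma> \<sigma>' V)) \<le> (1 - hamming n \<sigma> \<sigma>' / n) ^ K + (hamming n \<sigma> \<sigma>' / n) ^ K"
proof -
  let ?A = "{i \<in> {1..n}. \<sigma> i = \<sigma>' i}" and ?B = "{i \<in> {1..n}. \<sigma> i \<noteq> \<sigma>' i}"
  have "avg (ksubsets K n) (\<lambda>V. of_bool (homogeneous \<sigma> \<sigma>' V))
    \<le> avg (ksubsets K n) (\<lambda>V. of_bool (V \<subseteq> ?A) + of_bool (V \<subseteq> ?B))"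
    by (rule avg_mono) (auto simp: homogeneous_def ksubsets_def)
  also have "\<dots> \<le> (card ?A / n) ^ K + (card ?B / n) ^ K"
    unfolding avg_add using assms by (intro add_mono ksubsets_inside_prob) auto
  also have "card ?A / n = 1 - hamming n \<sigma> \<sigma>' / n"
  proof -
    have "card ?A + card ?B = card (?A \<union> ?B)" by (intro card_Un_disjoint[symmetric]) auto
    also have "?A \<union> ?B = {1..n}" by auto
    finally have "real (card ?A) + real (card ?B) = n" by (simp flip: of_nat_add)
    then have "real (card ?A) = n - hamming n \<sigma> \<sigma>'" unfolding hamming_def by linarith
    then show ?thesis using assms by (simp add: diff_divide_distrib)
  qed
  finally show ?thesis by (simp add: hamming_def)
qed

lemma sat_triple_prob:
  assumes K: "0 < K" "K \<le> n"
    and \<kappa>: "\<And>\<sigma> \<sigma>'. (\<sigma>, \<sigma>') \<in> {(\<sigma>\<^sub>1, \<sigma>\<^sub>2), (\<sigma>\<^sub>1, \<sigma>\<^sub>3), (\<sigma>\<^sub>2, \<sigma>\<^sub>3)} \<Longrightarrow>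
      (1 - hamming n \<sigma> \<sigma>' / n) ^ K + (hamming n \<sigma> \<sigma>' / n) ^ K \<le> \<kappa>"
  shows "measure_pmf.expectation (random_clause K n)
      (\<lambda>C. of_bool (sat_clause \<sigma>\<^sub>1 C \<and> sat_clause \<sigma>\<^sub>2 C \<and> sat_clause \<sigma>\<^sub>3 C)) \<le> 1 - 6 / 2 ^ K * (1 - \<kappa>)"
proof -
  let ?A = "ksubsets K n"
  let ?h = "\<lambda>\<sigma> \<sigma>' V. of_bool (homogeneous \<sigma> \<sigma>' V) :: real"
  have n: "0 < n" using K by simp
  have h: "avg ?A (?h \<sigma> \<sigma>') \<le> \<kappa>" if "(\<sigma>, \<sigma>') \<in> {(\<sigma>\<^sub>1, \<sigma>\<^sub>2), (\<sigma>\<^sub>1, \<sigma>\<^sub>3), (\<sigma>\<^sub>2, \<sigma>\<^sub>3)}" for \<sigma> \<sigma>'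
    using homogeneous_prob[OF K(2) n, of \<sigma> \<sigma>'] \<kappa>[OF that] by linarith
  have "measure_pmf.expectation (random_clause K n) (\<lambda>C. of_bool (sat_clause \<sigma>\<^sub>1 C \<and> sat_clause \<sigma>\<^sub>2 C \<and> sat_clause \<sigma>\<^sub>3 C))
    \<le> avg ?A (\<lambda>V. (1 - 6 / 2 ^ K) + (2 / 2 ^ K) * (?h \<sigma>\<^sub>1 \<sigma>\<^sub>2 V + (?h \<sigma>\<^sub>1 \<sigma>\<^sub>3 V + ?h \<sigma>\<^sub>2 \<sigma>\<^sub>3 V)))"
    unfolding expectation_random_clause[OF K(2)]
  proof (rule avg_mono)
    fix V assume "V \<in> ?A"
    then have V: "finite V" "V \<noteq> {}" "card V = K"
      using K(1) by (auto simp: ksubsets_def intro: finite_subset)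
    show "measure_pmf.expectation (signs V) (\<lambda>negated. of_bool (sat_clause \<sigma>\<^sub>1 (clause_of V negated) \<and>
        sat_clause \<sigma>\<^sub>2 (clause_of V negated) \<and> sat_clause \<sigma>\<^sub>3 (clause_of V negated)))
      \<le> (1 - 6 / 2 ^ K) + (2 / 2 ^ K) * (?h \<sigma>\<^sub>1 \<sigma>\<^sub>2 V + (?h \<sigma>\<^sub>1 \<sigma>\<^sub>3 V + ?h \<sigma>\<^sub>2 \<sigma>\<^sub>3 V))"
      using expectation_sat_triple[OF V(1,2), of \<sigma>\<^sub>1 \<sigma>\<^sub>2 \<sigma>\<^sub>3] unfolding V(3)
      by (rule order_trans) (simp add: algebra_simps)
  qed
  also have "\<dots> = (1 - 6 / 2 ^ K) + (2 / 2 ^ K) * (avg ?A (?h \<sigma>\<^sub>1 \<sigma>\<^sub>2) + (avg ?A (?h \<sigma>\<^sub>1 \<sigma>\<^sub>3) + avg ?A (?h \<sigma>\<^sub>2 \<sigma>\<^sub>3)))"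
    by (simp only: avg_add avg_cmult avg_const[OF finite_ksubsets ksubsets_nonempty[OF K(2)]])
  also have "\<dots> \<le> (1 - 6 / 2 ^ K) + (2 / 2 ^ K) * (\<kappa> + (\<kappa> + \<kappa>))"
    by (intro add_left_mono mult_left_mono add_mono h) auto
  also have "\<dots> = 1 - 6 / 2 ^ K * (1 - \<kappa>)" by (simp add: field_simps)
  finally show ?thesis .
qed

section \<open>First moment of close triples\<close>

definition assignments :: "nat \<Rightarrow> (nat \<Rightarrow> bool) set" where
  "assignments n = {1..n} \<rightarrow>\<^sub>E UNIV"

lemma finite_assignments: "finite (assignments n)"
  unfolding assignments_def by (intro finite_PiE) auto

lemma card_assignments: "card (assignments n) = 2 ^ n"
  by (simp add: assignments_def card_PiE)

lemma sum_power_hamming: "(\<Sum>\<sigma>'\<in>assignments n. x powr hamming n \<sigma> \<sigma>') = (1 + x) ^ n" if "0 < x"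
proof -
  let ?f = "\<lambda>i b. if \<sigma> i \<noteq> b then x else 1"
  have "x powr hamming n \<sigma> \<sigma>' = (\<Prod>i\<in>{1..n}. ?f i (\<sigma>' i))" for \<sigma>'
    unfolding hamming_def using that by (simp add: powr_realpow prod.If_cases Int_def)
  then have "(\<Sum>\<sigma>'\<in>assignments n. x powr hamming n \<sigma> \<sigma>') = (\<Prod>i\<in>{1..n}. \<Sum>b\<in>UNIV. ?f i b)"
    unfolding assignments_def by (subst prod_sum_PiE) auto
  also have "\<dots> = (\<Prod>i\<in>{1..n}. 1 + x)" by (intro prod.cong) (auto simp: UNIV_bool)
  finally show ?thesis by simp
qed

text \<open>A Chernoff bound: as \<open>x \<le> 1\<close>, the weight x^(distance - s) is at least 1
  in the ball, and the total weight factorizes over the coordinates.\<close>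

lemma card_hamming_ball_le:
  assumes x: "0 < x" "x \<le> 1"
  shows "card {\<sigma>' \<in> assignments n. hamming n \<sigma> \<sigma>' \<le> s} \<le> (1 + x) ^ n * x powr (- s)"
proof -
  have "real (card {\<sigma>' \<in> assignments n. hamming n \<sigma> \<sigma>' \<le> s}) = (\<Sum>\<sigma>'\<in>assignments n. of_bool (hamming n \<sigma> \<sigma>' \<le> s))"
    using finite_assignments by (simp add: Int_def)
  also have "\<dots> \<le> (\<Sum>\<sigma>'\<in>assignments n. x powr hamming n \<sigma> \<sigma>' * x powr (- s))"
  proof (intro sum_mono)
    fix \<sigma>'
    have "1 \<le> x powr (hamming n \<sigma> \<sigma>' - s)" if "hamming n \<sigma> \<sigma>' \<le> s"
      using powr_mono'[of "hamming n \<sigma> \<sigma>' - s" 0 x] that x by simp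
    then show "of_bool (hamming n \<sigma> \<sigma>' \<le> s) \<le> x powr hamming n \<sigma> \<sigma>' * x powr (- s)"
      using x by (simp flip: powr_add)
  qed
  also have "\<dots> = (1 + x) ^ n * x powr (- s)"
    by (simp only: sum_distrib_right[symmetric] sum_power_hamming[OF x(1)])
  finally show ?thesis .
qed

text \<open>Distances between \<open>n/128\<close> and \<open>n/64\<close>: large enough to make the violations of a random
  clause by two solutions nearly disjoint events, small enough to make such triples few.\<close>

definition overlap_triple :: "nat \<Rightarrow> clause list \<Rightarrow> bool" where
  "overlap_triple n Cs \<longleftrightarrow> (\<exists>\<sigma>\<^sub>1 \<sigma>\<^sub>2 \<sigma>\<^sub>3. (\<forall>C\<in>set Cs. sat_clause \<sigma>\<^sub>1 C \<and> sat_clause \<sigma>\<^sub>2 C \<and> sat_clause \<sigma>\<^sub>3 C) \<and>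
     \<bar>hamming n \<sigma>\<^sub>1 \<sigma>\<^sub>2 - 3 * real n / 256\<bar> < n / 256 \<and> \<bar>hamming n \<sigma>\<^sub>1 \<sigma>\<^sub>3 - 3 * real n / 256\<bar> < n / 256 \<and>
     \<bar>hamming n \<sigma>\<^sub>2 \<sigma>\<^sub>3 - 3 * real n / 256\<bar> < n / 256)"

lemma hamming_restrict: "hamming n (restrict \<sigma> {1..n}) (restrict \<sigma>' {1..n}) = hamming n \<sigma> \<sigma>'"
  unfolding hamming_def by (rule arg_cong[where f = "\<lambda>A. real (card A)"]) auto

text \<open>A triple is counted by its first member and two points in the ball of radius
  \<open>n / 64\<close> around it, with \<open>x = 1 / 64\<close>, nearly optimal, in
  \<open>card_hamming_ball_le\<close>. All three distances exceed \<open>n / 128\<close>, so the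
  homogeneity probabilities are at most 1/10, and 27/5 is 6 (1 - 1/10).\<close>

lemma overlap_triple_prob:
  assumes K: "0 < K" "K \<le> n" "(127 / 128) ^ K + (1 / 64) ^ K \<le> (1 / 10 :: real)"
  shows "measure_pmf.expectation (replicate_pmf m (random_clause K n)) (\<lambda>Cs. of_bool (overlap_triple n Cs))
    \<le> 2 ^ n * ((1 + 1 / 64) ^ n * (1 / 64) powr (- (n / 64)))\<^sup>2 * exp (- (27 / 5) / 2 ^ K) ^ m"
proof -
  let ?near = "\<lambda>\<sigma> \<sigma>'. \<bar>hamming n \<sigma> \<sigma>' - 3 * real n / 256\<bar> < n / 256"
  let ?b = "(1 + 1 / 64) ^ n * (1 / 64) powr (- (n / 64)) :: real"
  let ?B = "\<lambda>\<sigma>. {\<sigma>' \<in> assignments n. hamming n \<sigma> \<sigma>' \<le> n / 64}"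
  let ?sat = "\<lambda>(\<sigma>\<^sub>1, \<sigma>\<^sub>2, \<sigma>\<^sub>3) C. sat_clause \<sigma>\<^sub>1 C \<and> sat_clause \<sigma>\<^sub>2 C \<and> sat_clause \<sigma>\<^sub>3 C"
  let ?p = "replicate_pmf m (random_clause K n)"
  define T where "T = {(\<sigma>\<^sub>1, \<sigma>\<^sub>2, \<sigma>\<^sub>3). \<sigma>\<^sub>1 \<in> assignments n \<and> \<sigma>\<^sub>2 \<in> assignments n \<and> \<sigma>\<^sub>3 \<in> assignments n \<and>
     ?near \<sigma>\<^sub>1 \<sigma>\<^sub>2 \<and> ?near \<sigma>\<^sub>1 \<sigma>\<^sub>3 \<and> ?near \<sigma>\<^sub>2 \<sigma>\<^sub>3}"
  have n: "0 < n" using K by simp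
  have near_le: "hamming n \<sigma> \<sigma>' \<le> n / 64" if "?near \<sigma> \<sigma>'" for \<sigma> \<sigma>'
    using that by linarith
  have T_sub: "T \<subseteq> (SIGMA \<sigma>:assignments n. ?B \<sigma> \<times> ?B \<sigma>)"
    unfolding T_def using near_le by blast
  have B: "finite (?B \<sigma>)" for \<sigma> using finite_assignments by simp
  have fin_Sigma: "finite (SIGMA \<sigma>:assignments n. ?B \<sigma> \<times> ?B \<sigma>)"
    by (intro finite_SigmaI finite_cartesian_product B finite_assignments)
  have T: "finite T" by (rule finite_subset[OF T_sub fin_Sigma])
  have card_T: "card T \<le> 2 ^ n * ?b\<^sup>2"
  proof -
    have "card T \<le> card (SIGMA \<sigma>:assignments n. ?B \<sigma> \<times> ?B \<sigma>)"
      by (rule card_mono[OF fin_Sigma T_sub])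
    also have "\<dots> = (\<Sum>\<sigma>\<in>assignments n. card (?B \<sigma> \<times> ?B \<sigma>))"
      by (intro card_SigmaI finite_assignments ballI finite_cartesian_product B)
    finally have "real (card T) \<le> (\<Sum>\<sigma>\<in>assignments n. (real (card (?B \<sigma>)))\<^sup>2)"
      by (simp only: card_cartesian_product power2_eq_square of_nat_mult[symmetric] of_nat_sum[symmetric] of_nat_le_iff)
    also have "\<dots> \<le> (\<Sum>\<sigma>\<in>assignments n. ?b\<^sup>2)"
      by (intro sum_mono power_mono card_hamming_ball_le) auto
    finally show ?thesis by (simp add: card_assignments)
  qed
  note fin = finite_set_random_clause[OF K(2)]
  note int = integrable_measure_pmf_finite[OF finite_set_replicate_pmf[OF fin]]
  have "measure_pmf.expectation ?p (\<lambda>Cs. of_bool (overlap_triple n Cs))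
    \<le> measure_pmf.expectation ?p (\<lambda>Cs. \<Sum>t\<in>T. of_bool (\<forall>C\<in>set Cs. ?sat t C) :: real)"
  proof (rule integral_mono_AE[OF int int], unfold AE_measure_pmf_iff, intro ballI)
    fix Cs assume "Cs \<in> set_pmf ?p"
    then have Cs: "cvars C \<subseteq> {1..n}" if "C \<in> set Cs" for C
      using that set_random_clause(2)[OF K(2), of C] by (auto simp: set_replicate_pmf ksubsets_def)
    show "of_bool (overlap_triple n Cs) \<le> (\<Sum>t\<in>T. of_bool (\<forall>C\<in>set Cs. ?sat t C) :: real)"
    proof (cases "overlap_triple n Cs")
      case True
      then obtain \<sigma>\<^sub>1 \<sigma>\<^sub>2 \<sigma>\<^sub>3 where \<sigma>: "\<forall>C\<in>set Cs. sat_clause \<sigma>\<^sub>1 C \<and> sat_clause \<sigma>\<^sub>2 C \<and> sat_clause \<sigma>\<^sub>3 C"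
        "?near \<sigma>\<^sub>1 \<sigma>\<^sub>2" "?near \<sigma>\<^sub>1 \<sigma>\<^sub>3" "?near \<sigma>\<^sub>2 \<sigma>\<^sub>3"
        unfolding overlap_triple_def by (elim exE conjE) (rule that)
      \<comment> \<open>Satisfaction and distance depend only on the values on
        \<open>{1..n}\<close>, so restriction brings the triple into the finite set
        \<open>T\<close>.\<close>
      let ?r = "\<lambda>\<sigma> :: nat \<Rightarrow> bool. restrict \<sigma> {1..n}"
      let ?t = "(?r \<sigma>\<^sub>1, ?r \<sigma>\<^sub>2, ?r \<sigma>\<^sub>3)"
      have "?r \<sigma> \<in> assignments n" for \<sigma> by (simp add: assignments_def)
      then have "?t \<in> T" using \<sigma>(2-4) unfolding T_def by (simp only: mem_Collect_eq case_prod_conv hamming_restrict)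
      moreover have "sat_clause (?r \<sigma>) C = sat_clause \<sigma> C" if "C \<in> set Cs" for \<sigma> C
        by (rule sat_clause_cong) (use Cs[OF that] in auto)
      then have "\<forall>C\<in>set Cs. ?sat ?t C" using \<sigma>(1) by simp
      ultimately have "1 \<le> (\<Sum>t\<in>T. of_bool (\<forall>C\<in>set Cs. ?sat t C) :: real)"
        using member_le_sum[of ?t T "\<lambda>t. of_bool (\<forall>C\<in>set Cs. ?sat t C) :: real"] T by simp
      then show ?thesis using True by simp
    qed (simp add: sum_nonneg)
  qed
  also have "\<dots> = (\<Sum>t\<in>T. measure_pmf.expectation ?p (\<lambda>Cs. of_bool (\<forall>C\<in>set Cs. ?sat t C)))"
    by (rule Bochner_Integration.integral_sum) (rule int)
  also have "\<dots> \<le> (\<Sum>t\<in>T. exp (- (27 / 5) / 2 ^ K) ^ m)"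
  proof (rule sum_mono)
    fix t assume "t \<in> T"
    then obtain \<sigma>\<^sub>1 \<sigma>\<^sub>2 \<sigma>\<^sub>3 where t: "t = (\<sigma>\<^sub>1, \<sigma>\<^sub>2, \<sigma>\<^sub>3)" "?near \<sigma>\<^sub>1 \<sigma>\<^sub>2" "?near \<sigma>\<^sub>1 \<sigma>\<^sub>3" "?near \<sigma>\<^sub>2 \<sigma>\<^sub>3"
      unfolding T_def by auto
    have \<kappa>: "(1 - hamming n \<sigma> \<sigma>' / n) ^ K + (hamming n \<sigma> \<sigma>' / n) ^ K \<le> 1 / 10" if "?near \<sigma> \<sigma>'" for \<sigma> \<sigma>'
    proof -
      have "n / 128 < hamming n \<sigma> \<sigma>'" "hamming n \<sigma> \<sigma>' < n / 64" using that by linarith+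
      then have "1 / 128 < hamming n \<sigma> \<sigma>' / n" "hamming n \<sigma> \<sigma>' / n < 1 / 64"
        using n by (simp_all add: field_simps)
      then have "(1 - hamming n \<sigma> \<sigma>' / n) ^ K \<le> (127 / 128) ^ K" "(hamming n \<sigma> \<sigma>' / n) ^ K \<le> (1 / 64) ^ K"
        by (intro power_mono; linarith)+
      with K(3) show ?thesis by linarith
    qed
    have "measure_pmf.expectation (random_clause K n) (\<lambda>C. of_bool (?sat t C)) \<le> 1 - 6 / 2 ^ K * (1 - 1 / 10 :: real)"
      unfolding t(1) case_prod_conv by (intro sat_triple_prob K) (use \<kappa>[OF t(2)] \<kappa>[OF t(3)] \<kappa>[OF t(4)] in auto)
    also have "\<dots> \<le> exp (- (27 / 5) / 2 ^ K)"
      using exp_ge_add_one_self[of "- (27 / 5) / 2 ^ K"] by simp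
    finally have "measure_pmf.expectation (random_clause K n) (\<lambda>C. of_bool (?sat t C)) ^ m \<le> exp (- (27 / 5) / 2 ^ K :: real) ^ m"
      by (intro power_mono integral_nonneg) auto
    then show "measure_pmf.expectation ?p (\<lambda>Cs. of_bool (\<forall>C\<in>set Cs. ?sat t C)) \<le> exp (- (27 / 5) / 2 ^ K :: real) ^ m"
      by (simp only: expectation_replicate_all[OF fin])
  qed
  also have "\<dots> = card T * exp (- (27 / 5) / 2 ^ K) ^ m" by simp
  also have "\<dots> \<le> 2 ^ n * ?b\<^sup>2 * exp (- (27 / 5) / 2 ^ K) ^ m"
    by (intro mult_right_mono card_T) simp
  finally show ?thesis .
qed

text \<open>In units of n ln 2, the triples contribute 1 + 2 (6/64) = 19/16, apart from a further
  n/32, while the clauses cost (27/5) / 4 = 27/20. The surplus 13/80 beats 1/32 because ln 2 is at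
  least 2/3. The constant 6 absorbs the rounding of \<open>d * n\<close>.\<close>

lemma overlap_triple_bound_exp:
  assumes d: "2 powr (real K - 2) * ln 2 < d"
  shows "2 ^ n * ((1 + 1 / 64) ^ n * (1 / 64) powr (- (n / 64)))\<^sup>2 * exp (- (27 / 5) / 2 ^ K) ^ nat \<lfloor>d * n\<rfloor>
    \<le> exp (6 - n / 20)"
proof -
  let ?m = "nat \<lfloor>d * n\<rfloor>"
  have 1: "(2::real) ^ n = exp (n * ln 2)" by (simp add: exp_of_nat_mult)
  have 2: "(1 + 1 / 64 :: real) ^ n \<le> exp (n * (1 / 64))"
    unfolding exp_of_nat_mult by (intro power_mono exp_ge_add_one_self) simp
  have 3: "(1 / 64 :: real) powr (- (n / 64)) = exp (n * (6 * ln 2 / 64))"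
  proof -
    have "ln (1 / 64 :: real) = - (6 * ln 2)"
      using ln_realpow[of 2 6] by (simp add: ln_div)
    then show ?thesis by (simp add: powr_def)
  qed
  have 4: "27 / 5 / 2 ^ K * ?m \<ge> 27 / 20 * ln 2 * n - 6"
  proof -
    have "2 ^ K / 4 * ln 2 * n \<le> d * n"
      using d by (intro mult_right_mono) (auto simp: powr_diff powr_realpow)
    also have "\<dots> \<le> ?m + 1" by linarith
    finally have "27 / 5 / 2 ^ K * (2 ^ K / 4 * ln 2 * n) \<le> 27 / 5 / 2 ^ K * (real ?m + 1)"
      by (intro mult_left_mono) auto
    moreover have "27 / 5 / 2 ^ K * (2 ^ K / 4 * ln 2 * n) = 27 / 20 * ln 2 * real n" by simp
    moreover have "27 / 5 / 2 ^ K \<le> (27 / 5 :: real)" by (simp add: divide_le_eq)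
    ultimately show ?thesis by (simp add: distrib_left)
  qed
  have "2 ^ n * ((1 + 1 / 64) ^ n * (1 / 64) powr (- (n / 64)))\<^sup>2 * exp (- (27 / 5) / 2 ^ K) ^ ?m
    \<le> exp (n * ln 2) * (exp (n * (1 / 64)) * exp (n * (6 * ln 2 / 64)))\<^sup>2 * exp (- (27 / 5) / 2 ^ K) ^ ?m"
    unfolding 1 3 by (intro mult_right_mono mult_left_mono power_mono 2) auto
  also have "\<dots> = exp (n * ln 2 + 2 * (n * (1 / 64) + n * (6 * ln 2 / 64)) - 27 / 5 / 2 ^ K * ?m)"
  proof -
    have "exp (- (27 / 5) / 2 ^ K) ^ ?m = exp (- (27 / 5 / 2 ^ K * ?m) :: real)"
      unfolding exp_of_nat_mult[symmetric] by simp
    moreover have "(exp a * exp b)\<^sup>2 = exp (2 * (a + b))" for a b :: real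
      by (simp add: exp_add exp_double power_mult_distrib)
    ultimately show ?thesis by (simp only: exp_add[symmetric] diff_conv_add_uminus)
  qed
  also have "\<dots> \<le> exp (6 - n / 20)"
  proof -
    have "n * ln 2 + 2 * (n * (1 / 64) + n * (6 * ln 2 / 64)) - 27 / 5 / 2 ^ K * ?m
      \<le> n * ln 2 + 2 * (n * (1 / 64) + n * (6 * ln 2 / 64)) - (27 / 20 * ln 2 * n - 6)"
      using 4 by linarith
    also have "\<dots> = 6 + n * (1 / 32 - 13 / 80 * ln 2)" by (simp add: field_simps)
    also have "\<dots> \<le> 6 + n * (- (1 / 20))"
      using ln2_ge_two_thirds by (intro add_left_mono mult_left_mono) auto
    finally show ?thesis by simp
  qed
  finally show ?thesis .
qed

text \<open>Union bound over the centres and Markov's inequality. The exponent 12 makes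
  \<open>exp (12 * D)\<close> equal to \<open>n\<^sup>2\<close> for the later choice
  \<open>D = ln n / 6\<close>, which beats the factor \<open>n\<close>.\<close>

lemma large_ball_prob:
  fixes c D :: real
  assumes K: "K \<le> n" and n: "0 < n" and c: "real m * K / n \<le> c"
  shows "list_avg (ksubsets K n) m (\<lambda>es. of_bool (\<not> small_balls n (set es) k D))
    \<le> n * exp (ball_exponent K c 12 k - 12 * D)"
proof -
  let ?A = "ksubsets K n" and ?g = "ball_exponent K c 12 k"
  let ?e = "\<lambda>x es. exp (- (12 * D)) * exp (12 * card (hball (set es) k {x}))"
  have "list_avg ?A m (\<lambda>es. of_bool (\<not> small_balls n (set es) k D)) \<le> list_avg ?A m (\<lambda>es. \<Sum>x\<in>{1..n}. ?e x es)"
  proof (rule list_avg_mono)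
    fix es
    show "of_bool (\<not> small_balls n (set es) k D) \<le> (\<Sum>x\<in>{1..n}. ?e x es)"
    proof (cases "small_balls n (set es) k D")
      case False
      then obtain x where x: "x \<in> {1..n}" "D < card (hball (set es) k {x})"
        by (auto simp: small_balls_def not_le)
      then have "1 \<le> ?e x es" by (simp flip: exp_add)
      also have "\<dots> \<le> (\<Sum>x\<in>{1..n}. ?e x es)" by (rule member_le_sum[OF x(1)]) auto
      finally show ?thesis by simp
    qed (simp add: sum_nonneg)
  qed
  also have "\<dots> = (\<Sum>x\<in>{1..n}. exp (- (12 * D)) * list_avg ?A m (\<lambda>es. exp (12 * card (hball (set es) k {x}))))"
    by (simp only: list_avg_sum list_avg_cmult)
  also have "\<dots> \<le> (\<Sum>x\<in>{1..n}. exp (- (12 * D)) * exp ?g)"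
  proof (intro sum_mono mult_left_mono)
    fix x assume "x \<in> {1..n}"
    then show "list_avg ?A m (\<lambda>es. exp (12 * card (hball (set es) k {x}))) \<le> exp ?g"
      using hball_exp_moment[OF K n _ c, of 12 "{x}" m k] by simp
  qed simp
  also have "\<dots> = n * exp (?g - 12 * D)" by (simp add: exp_diff exp_minus field_simps)
  finally show ?thesis .
qed

definition walk_count :: "nat \<Rightarrow> nat \<Rightarrow> nat set set \<Rightarrow> real" where
  "walk_count n k E = (\<Sum>l<n. \<Sum>cs\<in>codes l. \<Sum>ws\<in>increasing_lists n l. of_bool (walk (near E k) cs ws))"

lemma walk_count_nonneg: "0 \<le> walk_count n k E"
  unfolding walk_count_def by (intro sum_nonneg) simp

section \<open>The success probability\<close>

text \<open>The cube is removed before averaging over formulas: if success is likelier than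
  \<open>\<epsilon>\<close> and there is no overlap triple, \<open>overlap_gap_bound\<close> forces
  the last summand to be at least 1. What remains is linear in the walk count, whose truncated
  expectation is known.\<close>

lemma success_given_formula_le:
  assumes Cs: "\<And>C. C \<in> set Cs \<Longrightarrow> snd C = Zero \<and> finite (fst C)" and n: "0 < n" and \<epsilon>: "0 < \<epsilon>"
  shows "measure_pmf.prob (bp_decimation (2 * Suc k) n (Inst {1..n} Cs)) (solutions (Inst {1..n} Cs))
    \<le> \<epsilon> + of_bool (overlap_triple n Cs) + 12 * walk_count n (Suc k) (set (map cvars Cs)) / ((n / 512)\<^sup>2 * \<epsilon> ^ 3)"
proof -
  let ?\<Phi> = "Inst {1..n} Cs" and ?r = "2 * Suc k"
  let ?dec = "bp_decimation ?r n ?\<Phi>" and ?\<tau> = "(\<lambda>_. undefined) :: nat \<Rightarrow> bool"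
  let ?E = "set (map cvars Cs)"
  \<comment> \<open>The process runs on total functions, so \<open>S\<close> also contains
    assignments that are not extensional.\<close>
  define S where "S = {\<sigma>. \<forall>C\<in>set Cs. sat_clause \<sigma> C}"
  define P where "P = run_mean (decimation_prob ?r ?\<Phi>) [1..<Suc n] (indicator S) ?\<tau>"
  have edges: "edges ?\<Phi> = ?E" by (simp add: edges_def)
  interpret symmetric_local_process n "decimation_prob ?r ?\<Phi>" "\<lambda>x. hball (edges ?\<Phi>) (Suc k) {x}"
    by (rule decimation_prob_process) (use Cs in simp)
  have "measure_pmf.prob ?dec (solutions ?\<Phi>) = measure_pmf.expectation ?dec (indicator (solutions ?\<Phi>))" by simp
  also have "\<dots> \<le> measure_pmf.expectation ?dec (\<lambda>\<sigma>. indicator S (\<lambda>i. if i \<in> {1..n} then \<sigma> i else ?\<tau> i))"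
  proof (rule integral_mono)
    have "finite (set_pmf ?dec)" unfolding bp_decimation_def by (rule finite_set_decimate)
    then show "integrable ?dec (indicator (solutions ?\<Phi>) :: _ \<Rightarrow> real)"
      "integrable ?dec (\<lambda>\<sigma>. indicator S (\<lambda>i. if i \<in> {1..n} then \<sigma> i else ?\<tau> i) :: real)"
      by (intro integrable_measure_pmf_finite; simp)+
    fix \<sigma>
    have "(\<lambda>i. if i \<in> {1..n} then \<sigma> i else ?\<tau> i) = \<sigma>" if "\<sigma> \<in> solutions ?\<Phi>"
      using that by (auto simp: solutions_def PiE_def extensional_def)
    then show "indicator (solutions ?\<Phi>) \<sigma> \<le> (indicator S (\<lambda>i. if i \<in> {1..n} then \<sigma> i else ?\<tau> i) :: real)"
      by (auto simp: indicator_def S_def solutions_def)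
  qed
  also have "\<dots> = P"
    using expectation_decimate[of 1 n ?r ?\<tau> ?\<Phi> "indicator S"] by (simp add: P_def bp_decimation_def fix_vars_def del: upt_Suc)
  finally have success: "measure_pmf.prob ?dec (solutions ?\<Phi>) \<le> P" .
  have P1: "P \<le> 1"
    using run_mean_mono[of "indicator S" "\<lambda>_. 1" "[1..<Suc n]" ?\<tau>] by (simp add: P_def indicator_def del: upt_Suc)
  have walks: "(\<Sum>x\<in>{1..n}. (influence x)\<^sup>2) \<le> walk_count n (Suc k) ?E"
    using sum_reach_square_le unfolding walk_count_def near_def edges .
  let ?W = "12 * walk_count n (Suc k) ?E / ((n / 512)\<^sup>2 * \<epsilon> ^ 3)"
  have W: "0 \<le> ?W" using walk_count_nonneg \<epsilon> by simp
  have "P \<le> \<epsilon> + of_bool (overlap_triple n Cs) + ?W"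
  proof (cases "overlap_triple n Cs \<or> P \<le> \<epsilon>")
    case True
    then show ?thesis using P1 W \<epsilon> by auto
  next
    case False
    \<comment> \<open>With \<open>\<delta> = n / 512\<close> the window \<open>2 * \<delta>\<close>
      is the \<open>n / 256\<close> of \<open>overlap_triple\<close>.\<close>
    have "P ^ 3 \<le> 12 * (\<Sum>x\<in>{1..n}. (influence x)\<^sup>2) / (n / 512)\<^sup>2"
      unfolding P_def
    proof (rule overlap_gap_bound[where a = "3 * real n / 256"])
      fix \<sigma>\<^sub>1 \<sigma>\<^sub>2 \<sigma>\<^sub>3 assume "\<sigma>\<^sub>1 \<in> S" "\<sigma>\<^sub>2 \<in> S" "\<sigma>\<^sub>3 \<in> S"
      then have "\<forall>C\<in>set Cs. sat_clause \<sigma>\<^sub>1 C \<and> sat_clause \<sigma>\<^sub>2 C \<and> sat_clause \<sigma>\<^sub>3 C" by (simp add: S_def)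
      with False have "\<not> (\<bar>ham \<sigma>\<^sub>1 \<sigma>\<^sub>2 - 3 * real n / 256\<bar> < n / 256 \<and> \<bar>ham \<sigma>\<^sub>1 \<sigma>\<^sub>3 - 3 * real n / 256\<bar> < n / 256 \<and>
        \<bar>ham \<sigma>\<^sub>2 \<sigma>\<^sub>3 - 3 * real n / 256\<bar> < n / 256)"
        unfolding overlap_triple_def by blast
      moreover have "2 * (n / 512) = n / 256" by simp
      ultimately show "2 * (n / 512) \<le> \<bar>ham \<sigma>\<^sub>1 \<sigma>\<^sub>2 - 3 * real n / 256\<bar> \<or> 2 * (n / 512) \<le> \<bar>ham \<sigma>\<^sub>1 \<sigma>\<^sub>3 - 3 * real n / 256\<bar> \<or>
        2 * (n / 512) \<le> \<bar>ham \<sigma>\<^sub>2 \<sigma>\<^sub>3 - 3 * real n / 256\<bar>"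
        by (simp only: not_less de_Morgan_conj)
    qed (use n in auto)
    also have "\<dots> \<le> 12 * walk_count n (Suc k) ?E / (n / 512)\<^sup>2"
      using walks by (intro divide_right_mono mult_left_mono) auto
    finally have "P ^ 3 \<le> 12 * walk_count n (Suc k) ?E / (n / 512)\<^sup>2" .
    moreover have "\<epsilon> ^ 3 \<le> P ^ 3" using False \<epsilon> by (intro power_mono) auto
    ultimately have "\<epsilon> ^ 3 \<le> 12 * walk_count n (Suc k) ?E / (n / 512)\<^sup>2" by linarith
    then have "1 \<le> 12 * walk_count n (Suc k) ?E / (n / 512)\<^sup>2 / \<epsilon> ^ 3"
      using \<epsilon> by (intro le_divide_eq_1_pos[THEN iffD2]) auto
    then have "1 \<le> ?W" by (simp only: divide_divide_eq_left)
    then show ?thesis using P1 \<epsilon> by (smt (verit) of_bool_def)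
  qed
  with success show ?thesis by linarith
qed

lemma success_prob_le:
  fixes d \<epsilon> :: real
  assumes K: "0 < K" "K \<le> n" "(127 / 128) ^ K + (1 / 64) ^ K \<le> (1 / 10 :: real)"
    and d: "2 powr (real K - 2) * ln 2 < d" and \<epsilon>: "0 < \<epsilon>" and D: "0 \<le> D"
  shows "success_prob K d (2 * Suc k) n \<le> \<epsilon> + exp (6 - n / 20) +
    n * exp (ball_exponent K (d * K) 12 (Suc k) - 12 * D) + 12 * (n * exp (3 * D)) / ((n / 512)\<^sup>2 * \<epsilon> ^ 3)"
proof -
  let ?m = "nat \<lfloor>d * n\<rfloor>" and ?A = "ksubsets K n" and ?r = "2 * Suc k"
  let ?p = "replicate_pmf ?m (random_clause K n)"
  let ?s = "\<lambda>Cs. measure_pmf.prob (bp_decimation ?r n (Inst {1..n} Cs)) (solutions (Inst {1..n} Cs))"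
  let ?c = "12 / ((n / 512)\<^sup>2 * \<epsilon> ^ 3)"
  let ?small = "\<lambda>es. of_bool (small_balls n (set es) (Suc k) D) :: real"
  let ?w = "\<lambda>es. walk_count n (Suc k) (set es)"
  have n: "0 < n" using K by simp
  have c: "0 \<le> ?c" using \<epsilon> by simp
  have fin: "finite (set_pmf ?p)" by (intro finite_set_replicate_pmf finite_set_random_clause K)
  note int = integrable_measure_pmf_finite[OF fin]
  have "0 < 2 powr (real K - 2) * ln 2" by simp
  then have "0 < d" using d by linarith
  then have "0 \<le> d * n" by simp
  then have "real ?m \<le> d * n" by simp
  then have "real ?m * K / n \<le> d * n * K / n" by (intro divide_right_mono mult_right_mono) auto
  then have m: "real ?m * K / n \<le> d * K" using n by simp
  have "success_prob K d ?r n = measure_pmf.expectation ?p ?s"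
  proof -
    let ?f = "\<lambda>Cs. map_pmf (Pair (Inst {1..n} Cs)) (bp_decimation ?r n (Inst {1..n} Cs))"
    have "success_prob K d ?r n = measure_pmf.expectation (?p \<bind> ?f) (indicator {(\<Phi>, \<sigma>). \<sigma> \<in> solutions \<Phi>})"
      by (simp add: success_prob_def random_formula_def bind_map_pmf map_pmf_def[symmetric])
    also have "\<dots> = measure_pmf.expectation ?p (\<lambda>Cs. measure_pmf.expectation (?f Cs) (indicator {(\<Phi>, \<sigma>). \<sigma> \<in> solutions \<Phi>}))"
      by (rule expectation_bind_finite[OF fin]) (simp add: bp_decimation_def finite_set_decimate)
    also have "\<dots> = measure_pmf.expectation ?p ?s"
      by (simp add: vimage_def)
    finally show ?thesis .
  qed
  also have "\<dots> \<le> measure_pmf.expectation ?p (\<lambda>Cs. (\<epsilon> + of_bool (overlap_triple n Cs)) +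
      ((1 - ?small (map cvars Cs)) + ?c * (?small (map cvars Cs) * ?w (map cvars Cs))))"
  proof (rule integral_mono_AE[OF int int], unfold AE_measure_pmf_iff, intro ballI)
    fix Cs assume "Cs \<in> set_pmf ?p"
    then have "snd C = Zero \<and> finite (fst C)" if "C \<in> set Cs" for C
      using that set_random_clause(1,3)[OF K(2), of C] by (auto simp: set_replicate_pmf)
    from success_given_formula_le[OF this n \<epsilon>, of Cs k]
    have le: "?s Cs \<le> \<epsilon> + of_bool (overlap_triple n Cs) + ?c * ?w (map cvars Cs)" by simp
    have le_1: "?s Cs \<le> 1" by (rule measure_pmf.prob_le_1)
    have triple: "0 \<le> (of_bool (overlap_triple n Cs) :: real)" by simp
    show "?s Cs \<le> (\<epsilon> + of_bool (overlap_triple n Cs)) +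
      ((1 - ?small (map cvars Cs)) + ?c * (?small (map cvars Cs) * ?w (map cvars Cs)))"
    \<comment> \<open>The walk count is controlled only together with small balls; for other
      formulas the success probability is bounded by 1.\<close>
    proof (cases "small_balls n (set (map cvars Cs)) (Suc k) D")
      case True
      then have one: "?small (map cvars Cs) = 1" by simp
      show ?thesis unfolding one mult_1_left using le by linarith
    next
      case False
      then have zero: "?small (map cvars Cs) = 0" by simp
      show ?thesis unfolding zero mult_zero_left mult_zero_right using le_1 triple \<epsilon> by linarith
    qed
  qed
  also have "\<dots> = (\<epsilon> + measure_pmf.expectation ?p (\<lambda>Cs. of_bool (overlap_triple n Cs))) +
      measure_pmf.expectation ?p (\<lambda>Cs. (1 - ?small (map cvars Cs)) + ?c * (?small (map cvars Cs) * ?w (map cvars Cs)))"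
    by (simp add: Bochner_Integration.integral_add[OF int int] del: integral_indicator)
  also have "measure_pmf.expectation ?p (\<lambda>Cs. (1 - ?small (map cvars Cs)) + ?c * (?small (map cvars Cs) * ?w (map cvars Cs)))
    = list_avg ?A ?m (\<lambda>es. of_bool (\<not> small_balls n (set es) (Suc k) D)) + ?c * list_avg ?A ?m (\<lambda>es. ?small es * ?w es)"
    unfolding expectation_clauses_cvars[OF K(2), of ?m "\<lambda>es. (1 - ?small es) + ?c * (?small es * ?w es)"]
    by (simp only: list_avg_add list_avg_cmult of_bool_not_iff)
  also have "(\<epsilon> + measure_pmf.expectation ?p (\<lambda>Cs. of_bool (overlap_triple n Cs))) +
      (list_avg ?A ?m (\<lambda>es. of_bool (\<not> small_balls n (set es) (Suc k) D)) + ?c * list_avg ?A ?m (\<lambda>es. ?small es * ?w es))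
    \<le> (\<epsilon> + exp (6 - n / 20)) + (n * exp (ball_exponent K (d * K) 12 (Suc k) - 12 * D) + ?c * (n * exp (3 * D)))"
  proof (intro add_mono order_refl mult_left_mono c)
    show "measure_pmf.expectation ?p (\<lambda>Cs. of_bool (overlap_triple n Cs)) \<le> exp (6 - n / 20)"
      using overlap_triple_prob[OF K, of ?m] overlap_triple_bound_exp[OF d, of n] by linarith
    show "list_avg ?A ?m (\<lambda>es. of_bool (\<not> small_balls n (set es) (Suc k) D))
      \<le> n * exp (ball_exponent K (d * K) 12 (Suc k) - 12 * D)"
      by (rule large_ball_prob[OF K(2) n m])
    show "list_avg ?A ?m (\<lambda>es. ?small es * ?w es) \<le> n * exp (3 * D)"
      unfolding walk_count_def by (rule expected_walks_le[OF K(2) D])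
  qed
  finally show ?thesis by simp
qed

lemma success_prob_tendsto_0:
  assumes K: "0 < K" "(127 / 128) ^ K + (1 / 64) ^ K \<le> (1 / 10 :: real)"
    and d: "2 powr (real K - 2) * ln 2 < d"
  shows "(\<lambda>n. success_prob K d (2 * Suc k) n) \<longlonglongrightarrow> 0"
proof (rule LIMSEQ_I)
  fix e :: real assume e: "0 < e"
  let ?g = "ball_exponent K (d * K) 12 (Suc k)"
  let ?f = "\<lambda>n::nat. exp 6 * exp (- (1 / 20)) ^ n + exp ?g * inverse (real n) + 12 * 512\<^sup>2 / (e / 2) ^ 3 * inverse (sqrt (real n))"
  have "?f \<longlonglongrightarrow> exp 6 * 0 + exp ?g * 0 + 12 * 512\<^sup>2 / (e / 2) ^ 3 * 0"
  proof (intro tendsto_add tendsto_mult tendsto_const LIMSEQ_realpow_zero lim_inverse_n)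
    show "(\<lambda>n. inverse (sqrt (real n))) \<longlonglongrightarrow> 0"
      by (intro tendsto_inverse_0_at_top filterlim_compose[OF sqrt_at_top] filterlim_real_sequentially)
  qed auto
  then have "?f \<longlonglongrightarrow> 0" by simp
  then have "\<forall>\<^sub>F n in sequentially. ?f n < e / 2"
    using e by (intro order_tendstoD) auto
  then obtain n\<^sub>0 where n\<^sub>0: "\<And>n. n\<^sub>0 \<le> n \<Longrightarrow> ?f n < e / 2"
    by (auto simp: eventually_sequentially)
  have "norm (success_prob K d (2 * Suc k) n - 0) < e" if n: "max n\<^sub>0 K \<le> n" for n
  proof -
    \<comment> \<open>With this choice \<open>exp (12 * ?D)\<close> is \<open>n\<^sup>2\<close>, so
      large balls cost O(1/n), and \<open>exp (3 * ?D)\<close> is \<open>sqrt n\<close>, so the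
      chains cost O(n^(3/2) / n^2). The exponent \<open>?g\<close> does not depend on
      \<open>n\<close>.\<close>
    let ?D = "ln n / 6"
    have n1: "1 \<le> n" "K \<le> n" using n K by auto
    have "success_prob K d (2 * Suc k) n \<le> e / 2 + exp (6 - n / 20) + n * exp (?g - 12 * ?D)
        + 12 * (n * exp (3 * ?D)) / ((n / 512)\<^sup>2 * (e / 2) ^ 3)"
      using n1 e K d by (intro success_prob_le) auto
    also have "exp (6 - n / 20) = exp 6 * exp (- (1 / 20)) ^ n"
      by (simp add: exp_of_nat_mult[symmetric] exp_add[symmetric])
    also have "n * exp (?g - 12 * ?D) = exp ?g * inverse n"
    proof -
      have "exp (12 * ?D) = real n * real n"
        using n1 by (simp add: exp_double power2_eq_square)
      then show ?thesis using n1 by (simp add: exp_diff field_simps)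
    qed
    also have "12 * (n * exp (3 * ?D)) / ((n / 512)\<^sup>2 * (e / 2) ^ 3) = 12 * 512\<^sup>2 / (e / 2) ^ 3 * inverse (sqrt n)"
    proof -
      have "exp (3 * ?D) = sqrt n" using n1 by (simp add: powr_half_sqrt[symmetric] powr_def)
      moreover have "12 * (s * s * s) / ((s * s / 512)\<^sup>2 * E) = 12 * 512\<^sup>2 / E * inverse s"
        if "s \<noteq> 0" "E \<noteq> 0" for s E :: real
        using that by (simp add: field_simps power2_eq_square)
      from this[of "sqrt n" "(e / 2) ^ 3"]
      have "12 * (n * sqrt n) / ((n / 512)\<^sup>2 * (e / 2) ^ 3) = 12 * 512\<^sup>2 / (e / 2) ^ 3 * inverse (sqrt n)"
        using n1 e by simp
      ultimately show ?thesis by simp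
    qed
    finally have "success_prob K d (2 * Suc k) n \<le> e / 2 + ?f n" by simp
    moreover have "?f n < e / 2" using n by (intro n\<^sub>0) simp
    moreover have "0 \<le> success_prob K d (2 * Suc k) n" by (simp add: success_prob_def)
    ultimately show ?thesis by simp
  qed
  then show "\<exists>n\<^sub>0. \<forall>n\<ge>n\<^sub>0. norm (success_prob K d (2 * Suc k) n - 0) < e" by blast
qed

theorem corollary2p5:
  shows "\<exists>K\<^sub>0::nat. \<forall>K\<ge>K\<^sub>0. \<forall>d::real. \<forall>r::nat.
           d > 2 powr (real K - 2) * ln 2 \<longrightarrow> even r \<longrightarrow> r > 0 \<longrightarrow>
           (\<lambda>n. success_prob K d r n) \<longlonglongrightarrow> 0"
proof -
  have "(\<lambda>K. (127 / 128) ^ K + (1 / 64) ^ K :: real) \<longlonglongrightarrow> 0 + 0"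
    by (intro tendsto_add LIMSEQ_realpow_zero) auto
  then have "\<forall>\<^sub>F K in sequentially. (127 / 128) ^ K + (1 / 64) ^ K < (1 / 10 :: real)"
    by (intro order_tendstoD) auto
  then obtain K\<^sub>0 where K\<^sub>0: "\<And>K. K\<^sub>0 \<le> K \<Longrightarrow> (127 / 128) ^ K + (1 / 64) ^ K < (1 / 10 :: real)"
    by (auto simp: eventually_sequentially)
  show ?thesis
  \<comment> \<open>The maximum with 1 makes the clauses nonempty.\<close>
  proof (intro exI[of _ "max 1 K\<^sub>0"] allI impI)
    fix K r :: nat and d :: real
    assume K: "max 1 K\<^sub>0 \<le> K" and d: "2 powr (real K - 2) * ln 2 < d" and r: "even r" "0 < r"
    from r obtain k where "r = 2 * Suc k"
      by (metis evenE gr0_implies_Suc mult_0_right not_gr_zero)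
    then show "(\<lambda>n. success_prob K d r n) \<longlonglongrightarrow> 0"
      using success_prob_tendsto_0[of K d k] K K\<^sub>0[of K] d by simp
  qed
qed

end
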